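(* Let $U,V:L^2([0,1])\to L^2([0,1])$ be two unitary operators (boundary unitaries), and let $P_U$ and $P_V$ be the corresponding selfadjoint extensions of $P_{\min}$ in $L^2([0,1]^2)$. Then $P_U$ and $P_V$ are unitarily equivalent if and only if $U$ and $V$ are unitarily equivalent.
   Context: All Hilbert spaces are complex. In $L^2([0,1]^2)$ let $P_{\min}=\frac{1}{i2\pi}\partial_x$ be the symmetric operator with domain the smooth functions compactly supported in the open unit square. Its adjoint is $P_{\max}=\frac{1}{i2\pi}\partial_x$ (distributional derivative) with domain $\{f\in L^2([0,1]^2)\mid \partial_x f\in L^2([0,1]^2)\}$. For $f\in\mathrm{dom}(P_{\max})$ the boundary values $f(0,\cdot),f(1,\cdot)$ are well-defined elements of $L^2([0,1])$. For a unitary operator $V$ on $L^2([0,1])$, $P_V$ denotes the restriction of $P_{\max}$ to the domain $\{f\in\mathrm{dom}(P_{\max})\mid f(1,\cdot)=Vf(0,\cdot)\}$; it is a selfadjoint extension of $P_{\min}$, and all selfadjoint extensions of $P_{\min}$ arise this way. Two (possibly unbounded) operators $A,B$ are unitarily equivalent if there is a unitary $W$ with $WA=BW$ (including equality of domains). *)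

theory Defs
  imports "HOL-Analysis.Analysis"
begin

section \<open>The complex Hilbert space \<open>L\<^sup>2([0,1]\<^sup>n)\<close>\<close>

text \<open>
  For \<^term>\<open>One = (\<Sum>b\<in>Basis. b)\<close> the set \<^term>\<open>cbox 0 One\<close> is the closed unit cube of a Euclidean
  space: the interval \<open>[0,1]\<close> in \<^typ>\<open>real\<close> and the square \<open>[0,1]\<^sup>2\<close> in \<^typ>\<open>real \<times> real\<close>.
\<close>

abbreviation cube :: "'a::euclidean_space measure"
  where "cube \<equiv> restrict_space lborel (cbox 0 One)"

definition square_integrable :: "('a::euclidean_space \<Rightarrow> complex) \<Rightarrow> bool"
  where "square_integrable f \<longleftrightarrow>
    f \<in> borel_measurable cube \<and> integrable cube (\<lambda>x. (cmod (f x))\<^sup>2)"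

lemma square_integrable_zero: "square_integrable (\<lambda>_. 0)"
  by (simp add: square_integrable_def)

lemma square_integrable_measurable:
  "square_integrable f \<Longrightarrow> f \<in> borel_measurable cube"
  by (simp add: square_integrable_def)

lemma square_integrable_scale:
  "square_integrable f \<Longrightarrow> square_integrable (\<lambda>x. c * f x)"
  by (auto simp: square_integrable_def norm_mult power_mult_distrib)

lemma square_integrable_add:
  assumes "square_integrable f" "square_integrable g"
  shows "square_integrable (\<lambda>x. f x + g x)"
proof -
  have [measurable]: "f \<in> borel_measurable cube" "g \<in> borel_measurable cube"
    using assms by (auto simp: square_integrable_def)
  have "integrable cube (\<lambda>x. 2 * (cmod (f x))\<^sup>2 + 2 * (cmod (g x))\<^sup>2)"
    using assms by (auto simp: square_integrable_def)
  then have "integrable cube (\<lambda>x. (cmod (f x + g x))\<^sup>2)"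
  proof (rule Bochner_Integration.integrable_bound)
    have "(cmod (f x + g x))\<^sup>2 \<le> 2 * (cmod (f x))\<^sup>2 + 2 * (cmod (g x))\<^sup>2" for x
    proof -
      have "(cmod (f x + g x))\<^sup>2 \<le> (cmod (f x) + cmod (g x))\<^sup>2"
        by (simp add: norm_triangle_ineq power_mono)
      also have "\<dots> \<le> 2 * (cmod (f x))\<^sup>2 + 2 * (cmod (g x))\<^sup>2"
        using sum_squares_bound[of "cmod (f x)" "cmod (g x)"] by (simp add: power2_sum)
      finally show ?thesis .
    qed
    then show "AE x in cube. norm ((cmod (f x + g x))\<^sup>2)
        \<le> norm (2 * (cmod (f x))\<^sup>2 + 2 * (cmod (g x))\<^sup>2)"
      by (intro AE_I2) (auto intro: order_trans)
  qed measurable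
  then show ?thesis by (simp add: square_integrable_def)
qed

lemma square_integrable_diff:
  "square_integrable f \<Longrightarrow> square_integrable g \<Longrightarrow> square_integrable (\<lambda>x. f x - g x)"
  using square_integrable_add[of f "\<lambda>x. (-1) * g x"] square_integrable_scale[of g "-1"] by simp

lemma square_integrable_uminus:
  "square_integrable f \<Longrightarrow> square_integrable (\<lambda>x. - f x)"
  using square_integrable_scale[of f "-1"] by simp

quotient_type (overloaded) 'a cube_L2 = "'a::euclidean_space \<Rightarrow> complex" / partial:
  "\<lambda>f g. square_integrable f \<and> square_integrable g \<and> (AE x in cube. f x = g x)"
proof (rule part_equivpI)
  show "\<exists>f::'a \<Rightarrow> complex. square_integrable f \<and> square_integrable f \<and> (AE x in cube. f x = f x)"
    using square_integrable_zero by auto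
  show "symp (\<lambda>f g::'a \<Rightarrow> complex. square_integrable f \<and> square_integrable g \<and> (AE x in cube. f x = g x))"
    by (auto intro!: sympI elim: AE_mp)
  show "transp (\<lambda>f g::'a \<Rightarrow> complex. square_integrable f \<and> square_integrable g \<and> (AE x in cube. f x = g x))"
    by (rule transpI) (auto elim!: AE_mp)
qed

text \<open>\<^term>\<open>represents F f\<close>: the function \<open>F\<close> is square integrable and \<open>f\<close> is its class.\<close>

lift_definition represents :: "('a::euclidean_space \<Rightarrow> complex) \<Rightarrow> 'a cube_L2 \<Rightarrow> bool"
  is "\<lambda>F f. square_integrable F \<and> (AE x in cube. F x = f x)"
  by (auto elim: AE_mp)

instantiation cube_L2 :: (euclidean_space) ab_group_add
begin

lift_definition zero_cube_L2 :: "'a cube_L2" is "\<lambda>_. 0"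
  by (simp add: square_integrable_zero)

lift_definition plus_cube_L2 :: "'a cube_L2 \<Rightarrow> 'a cube_L2 \<Rightarrow> 'a cube_L2" is "\<lambda>f g x. f x + g x"
  by (auto simp: square_integrable_add elim: AE_mp)

lift_definition minus_cube_L2 :: "'a cube_L2 \<Rightarrow> 'a cube_L2 \<Rightarrow> 'a cube_L2" is "\<lambda>f g x. f x - g x"
  by (auto simp: square_integrable_diff elim: AE_mp)

lift_definition uminus_cube_L2 :: "'a cube_L2 \<Rightarrow> 'a cube_L2" is "\<lambda>f x. - f x"
  by (auto simp: square_integrable_uminus elim: AE_mp)

instance
  by standard (transfer; auto simp: square_integrable_add square_integrable_diff
      square_integrable_uminus square_integrable_zero algebra_simps)+

end

lift_definition scaleC :: "complex \<Rightarrow> 'a::euclidean_space cube_L2 \<Rightarrow> 'a cube_L2" (infixr "*\<^sub>C" 75)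
  is "\<lambda>c f x. c * f x"
  by (auto simp: square_integrable_scale elim: AE_mp)

lift_definition cinner :: "'a::euclidean_space cube_L2 \<Rightarrow> 'a cube_L2 \<Rightarrow> complex"
  is "\<lambda>f g. LINT x|cube. f x * cnj (g x)"
proof (elim conjE)
  fix f f' g g' :: "'a \<Rightarrow> complex"
  assume "square_integrable f" "square_integrable f'" "square_integrable g" "square_integrable g'"
    and ae: "AE x in cube. f x = f' x" "AE x in cube. g x = g' x"
  then have [measurable]: "f \<in> borel_measurable cube" "f' \<in> borel_measurable cube"
    "g \<in> borel_measurable cube" "g' \<in> borel_measurable cube"
    by (auto dest: square_integrable_measurable)
  have [measurable]: "cnj \<in> borel_measurable borel"
    by (intro borel_measurable_continuous_onI continuous_intros)
  show "(LINT x|cube. f x * cnj (g x)) = (LINT x|cube. f' x * cnj (g' x))"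
    by (rule integral_cong_AE) (measurable, use ae in \<open>auto elim: AE_mp\<close>)
qed


section \<open>Operators\<close>

text \<open>
  A possibly unbounded operator on a Hilbert space is identified with its graph, so that equality
  of operators includes equality of domains.  Relational composition is written in
  diagrammatic order: \<^term>\<open>A O B\<close> is the operator product \<open>BA\<close>.
\<close>

definition op_graph :: "('h \<Rightarrow> 'h) \<Rightarrow> ('h \<times> 'h) set"
  where "op_graph T = {(f, T f) |f. True}"

definition op_adjoint :: "('a::euclidean_space cube_L2 \<times> 'a cube_L2) set \<Rightarrow> ('a cube_L2 \<times> 'a cube_L2) set"
  where "op_adjoint A = {(f, g). \<forall>(u, v)\<in>A. cinner v f = cinner u g}"

definition unitary :: "('a::euclidean_space cube_L2 \<Rightarrow> 'a cube_L2) \<Rightarrow> bool"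
  where "unitary U \<longleftrightarrow>
    (\<forall>f g. U (f + g) = U f + U g) \<and> (\<forall>c f. U (c *\<^sub>C f) = c *\<^sub>C U f) \<and>
    (\<forall>f g. cinner (U f) (U g) = cinner f g) \<and> surj U"

definition unitarily_equivalent ::
    "('a::euclidean_space cube_L2 \<times> 'a cube_L2) set \<Rightarrow> ('a cube_L2 \<times> 'a cube_L2) set \<Rightarrow> bool"
  where "unitarily_equivalent A B \<longleftrightarrow> (\<exists>W. unitary W \<and> A O op_graph W = op_graph W O B)"


section \<open>Test functions and the momentum operators on the unit square\<close>

fun k_smooth :: "nat \<Rightarrow> ('a::euclidean_space \<Rightarrow> complex) \<Rightarrow> bool" where
  "k_smooth 0 \<phi> \<longleftrightarrow> continuous_on UNIV \<phi>"
| "k_smooth (Suc k) \<phi> \<longleftrightarrow>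
    (\<forall>x. \<phi> differentiable (at x)) \<and> (\<forall>v. k_smooth k (\<lambda>x. frechet_derivative \<phi> (at x) v))"

text \<open>
  Smooth functions compactly supported in the open unit cube, extended by zero to the whole space.
\<close>

definition test_function :: "('a::euclidean_space \<Rightarrow> complex) \<Rightarrow> bool"
  where "test_function \<phi> \<longleftrightarrow> (\<forall>k. k_smooth k \<phi>) \<and> closure {x. \<phi> x \<noteq> 0} \<subseteq> box 0 One"

definition partial_x :: "(real \<times> real \<Rightarrow> complex) \<Rightarrow> real \<times> real \<Rightarrow> complex"
  where "partial_x \<phi> p = frechet_derivative \<phi> (at p) (1, 0)"

definition P_min :: "((real \<times> real) cube_L2 \<times> (real \<times> real) cube_L2) set"
  where "P_min = {(f, g). \<exists>\<phi>. test_function \<phi> \<and> represents \<phi> f \<and>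
    represents (\<lambda>p. 1 / (\<i> * (2 * pi)) * partial_x \<phi> p) g}"

lemma k_smooth_partial_x: "k_smooth (Suc k) \<phi> \<Longrightarrow> k_smooth k (partial_x \<phi>)"
  by (simp add: partial_x_def[abs_def])

lemma test_function_measurable:
  assumes "test_function \<phi>"
  shows "\<phi> \<in> borel_measurable cube" "partial_x \<phi> \<in> borel_measurable cube"
proof -
  have "continuous_on UNIV \<phi>" "continuous_on UNIV (partial_x \<phi>)"
    using assms k_smooth_partial_x[of 0 \<phi>] unfolding test_function_def
    by (metis k_smooth.simps(1))+
  then show "\<phi> \<in> borel_measurable cube" "partial_x \<phi> \<in> borel_measurable cube"
    by (auto intro!: measurable_restrict_space1 borel_measurable_continuous_onI)
qed

text \<open>\<^term>\<open>has_weak_dx f g\<close>: the distributional derivative of \<open>f\<close> in the first variable is \<open>g\<close>.\<close>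

lift_definition has_weak_dx :: "(real \<times> real) cube_L2 \<Rightarrow> (real \<times> real) cube_L2 \<Rightarrow> bool"
  is "\<lambda>f g. \<forall>\<phi>. test_function \<phi> \<longrightarrow>
    (LINT p|cube. f p * partial_x \<phi> p) = - (LINT p|cube. g p * \<phi> p)"
proof (elim conjE)
  fix f f' g g' :: "real \<times> real \<Rightarrow> complex"
  assume si: "square_integrable f" "square_integrable f'" "square_integrable g" "square_integrable g'"
    and ae: "AE x in cube. f x = f' x" "AE x in cube. g x = g' x"
  note [measurable] = si[THEN square_integrable_measurable]
  have "(LINT p|cube. f p * partial_x \<phi> p) = (LINT p|cube. f' p * partial_x \<phi> p)"
    "(LINT p|cube. g p * \<phi> p) = (LINT p|cube. g' p * \<phi> p)" if "test_function \<phi>" for \<phi>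
  proof -
    note [measurable] = test_function_measurable[OF that]
    show "(LINT p|cube. f p * partial_x \<phi> p) = (LINT p|cube. f' p * partial_x \<phi> p)"
      by (rule integral_cong_AE) (use ae in \<open>auto elim: AE_mp\<close>)
    show "(LINT p|cube. g p * \<phi> p) = (LINT p|cube. g' p * \<phi> p)"
      by (rule integral_cong_AE) (use ae in \<open>auto elim: AE_mp\<close>)
  qed
  then show "(\<forall>\<phi>. test_function \<phi> \<longrightarrow>
       (LINT p|cube. f p * partial_x \<phi> p) = - (LINT p|cube. g p * \<phi> p)) =
      (\<forall>\<phi>. test_function \<phi> \<longrightarrow>
       (LINT p|cube. f' p * partial_x \<phi> p) = - (LINT p|cube. g' p * \<phi> p))"
    by auto
qed

definition P_max :: "((real \<times> real) cube_L2 \<times> (real \<times> real) cube_L2) set"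
  where "P_max = {(f, (1 / (\<i> * (2 * pi))) *\<^sub>C g) |f g. has_weak_dx f g}"


lemma frechet_derivative_cnj:
  assumes "\<phi> differentiable (at x)"
  shows "(\<lambda>y. cnj (\<phi> y)) differentiable (at x)"
    and "frechet_derivative (\<lambda>y. cnj (\<phi> y)) (at x) v = cnj (frechet_derivative \<phi> (at x) v)"
proof -
  have "(\<phi> has_derivative frechet_derivative \<phi> (at x)) (at x)"
    using assms by (simp add: frechet_derivative_works)
  then have *: "((\<lambda>y. cnj (\<phi> y)) has_derivative (\<lambda>v. cnj (frechet_derivative \<phi> (at x) v))) (at x)"
    by (rule bounded_linear.has_derivative[OF bounded_linear_cnj])
  then show "(\<lambda>y. cnj (\<phi> y)) differentiable (at x)"
    by (auto simp: differentiable_def)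
  from frechet_derivative_at[OF *]
  show "frechet_derivative (\<lambda>y. cnj (\<phi> y)) (at x) v = cnj (frechet_derivative \<phi> (at x) v)"
    by (metis)
qed

lemma k_smooth_cnj: "k_smooth k \<phi> \<Longrightarrow> k_smooth k (\<lambda>x. cnj (\<phi> x))"
proof (induction k arbitrary: \<phi>)
  case 0
  then show ?case by (auto intro: continuous_intros)
next
  case (Suc k)
  then show ?case by (auto simp: frechet_derivative_cnj)
qed

lemma test_function_cnj: "test_function \<phi> \<Longrightarrow> test_function (\<lambda>x. cnj (\<phi> x))"
  by (simp add: test_function_def k_smooth_cnj)

lemma partial_x_cnj: "test_function \<phi> \<Longrightarrow> partial_x (\<lambda>x. cnj (\<phi> x)) = (\<lambda>p. cnj (partial_x \<phi> p))"
  unfolding test_function_def partial_x_def by (metis frechet_derivative_cnj(2) k_smooth.simps(2))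

lemma emeasure_cube: "emeasure (cube :: 'a::euclidean_space measure) (space cube) < \<infinity>"
  by (simp add: space_restrict_space emeasure_restrict_space emeasure_lborel_cbox_eq)

lemma square_integrable_continuous:
  assumes "continuous_on UNIV f"
  shows "square_integrable f"
proof -
  have m: "f \<in> borel_measurable cube"
    using assms by (intro measurable_restrict_space1) (auto intro: borel_measurable_continuous_onI)
  have "compact (f ` cbox 0 One)"
    using assms by (intro compact_continuous_image compact_cbox) (auto intro: continuous_on_subset)
  then obtain B where B: "cmod (f x) \<le> B" if "x \<in> cbox 0 One" for x
    by (metis compact_imp_bounded bounded_iff imageI)
  interpret finite_measure "cube :: 'a measure"
    by (rule finite_measureI) (use emeasure_cube[where 'a='a] in auto)
  have "integrable cube (\<lambda>x. (cmod (f x))\<^sup>2)"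
  proof (rule integrable_const_bound[where B = "B\<^sup>2"])
    show "AE x in cube. norm ((cmod (f x))\<^sup>2) \<le> B\<^sup>2"
      by (intro AE_I2) (auto simp: space_restrict_space intro!: power_mono B)
  qed (use m in measurable)
  with m show ?thesis by (simp add: square_integrable_def)
qed

lemma represents_exists: "square_integrable F \<Longrightarrow> \<exists>f. represents F f"
  by transfer auto

lemma representative_exists: "\<exists>F. represents F f"
  by transfer (auto elim: AE_mp)

lemma cinner_eq:
  assumes "represents F f" "represents G g"
  shows "cinner f g = (LINT p|cube. F p * cnj (G p))"
proof -
  have [measurable]: "cnj \<in> borel_measurable borel"
    by (intro borel_measurable_continuous_onI continuous_intros)
  show ?thesis
    using assms
  proof (transfer, elim conjE)
    fix F f G g :: "'a \<Rightarrow> complex"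
    assume si: "square_integrable F" "square_integrable f" "square_integrable G" "square_integrable g"
      and ae: "AE x in cube. F x = f x" "AE x in cube. G x = g x"
    note [measurable] = si[THEN square_integrable_measurable]
    show "(LINT x|cube. f x * cnj (g x)) = (LINT p|cube. F p * cnj (G p))"
      by (rule integral_cong_AE) (measurable, use ae in \<open>auto elim: AE_mp\<close>)
  qed
qed

lemma has_weak_dx_eq:
  assumes "represents F f" "represents G g"
  shows "has_weak_dx f g \<longleftrightarrow> (\<forall>\<phi>. test_function \<phi> \<longrightarrow>
    (LINT p|cube. F p * partial_x \<phi> p) = - (LINT p|cube. G p * \<phi> p))"
  using assms
proof (transfer, elim conjE)
  fix F f G g :: "real \<times> real \<Rightarrow> complex"
  assume si: "square_integrable F" "square_integrable f" "square_integrable G" "square_integrable g"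
    and ae: "AE x in cube. F x = f x" "AE x in cube. G x = g x"
  note [measurable] = si[THEN square_integrable_measurable]
  have "(LINT p|cube. f p * partial_x \<phi> p) = (LINT p|cube. F p * partial_x \<phi> p)"
    "(LINT p|cube. g p * \<phi> p) = (LINT p|cube. G p * \<phi> p)" if "test_function \<phi>" for \<phi>
  proof -
    note [measurable] = test_function_measurable[OF that]
    show "(LINT p|cube. f p * partial_x \<phi> p) = (LINT p|cube. F p * partial_x \<phi> p)"
      by (rule integral_cong_AE) (measurable, use ae in \<open>auto elim: AE_mp\<close>)
    show "(LINT p|cube. g p * \<phi> p) = (LINT p|cube. G p * \<phi> p)"
      by (rule integral_cong_AE) (measurable, use ae in \<open>auto elim: AE_mp\<close>)
  qed
  then show "(\<forall>\<phi>. test_function \<phi> \<longrightarrow>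
       (LINT p|cube. f p * partial_x \<phi> p) = - (LINT p|cube. g p * \<phi> p)) =
      (\<forall>\<phi>. test_function \<phi> \<longrightarrow>
       (LINT p|cube. F p * partial_x \<phi> p) = - (LINT p|cube. G p * \<phi> p))"
    by auto
qed

lemma scaleC_scaleC: "a *\<^sub>C b *\<^sub>C f = (a * b) *\<^sub>C f"
  by transfer (auto simp: square_integrable_scale mult.assoc)

lemma scaleC_one: "1 *\<^sub>C f = f"
  by transfer auto

lemma represents_scaleC: "represents F f \<Longrightarrow> represents (\<lambda>p. c * F p) (c *\<^sub>C f)"
  by transfer (auto simp: square_integrable_scale elim: AE_mp)

lemma in_P_max_iff: "(f, g) \<in> P_max \<longleftrightarrow> has_weak_dx f ((\<i> * (2 * pi)) *\<^sub>C g)"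
proof
  assume "(f, g) \<in> P_max"
  then show "has_weak_dx f ((\<i> * (2 * pi)) *\<^sub>C g)"
    by (auto simp: P_max_def scaleC_scaleC scaleC_one simp flip: of_real_mult)
next
  assume "has_weak_dx f ((\<i> * (2 * pi)) *\<^sub>C g)"
  moreover have "g = (1 / (\<i> * (2 * pi))) *\<^sub>C (\<i> * (2 * pi)) *\<^sub>C g"
    by (simp add: scaleC_scaleC scaleC_one)
  ultimately show "(f, g) \<in> P_max"
    unfolding P_max_def by blast
qed

lemma test_function_square_integrable:
  assumes "test_function \<phi>"
  shows "square_integrable \<phi>" "square_integrable (partial_x \<phi>)"
proof -
  have "continuous_on UNIV \<phi>" "continuous_on UNIV (partial_x \<phi>)"
    using assms k_smooth_partial_x[of 0 \<phi>] unfolding test_function_def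
    by (metis k_smooth.simps(1))+
  then show "square_integrable \<phi>" "square_integrable (partial_x \<phi>)"
    by (auto intro: square_integrable_continuous)
qed

lemma P_max_eq_adjoint: "P_max = op_adjoint P_min"
proof -
  define c :: complex where "c = \<i> * (2 * pi)"
  have c: "c \<noteq> 0" "cnj c = - c" by (auto simp: c_def)
  have "(f, g) \<in> P_max \<longleftrightarrow> (f, g) \<in> op_adjoint P_min" for f g
  proof -
    obtain F G where F: "represents F f" and G: "represents G g"
      using representative_exists by metis
    have wd: "(f, g) \<in> P_max \<longleftrightarrow> (\<forall>\<phi>. test_function \<phi> \<longrightarrow>
        (LINT p|cube. F p * partial_x \<phi> p) = - (LINT p|cube. c * G p * \<phi> p))"
      unfolding in_P_max_iff c_def[symmetric]
      by (rule has_weak_dx_eq[OF F represents_scaleC[OF G]])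
    have pair: "cinner v f = cinner u g \<longleftrightarrow>
        (LINT p|cube. F p * partial_x (\<lambda>p. cnj (\<phi> p)) p) = - (LINT p|cube. c * G p * cnj (\<phi> p))"
      if t: "test_function \<phi>" and u: "represents \<phi> u"
        and v: "represents (\<lambda>p. 1 / c * partial_x \<phi> p) v" for \<phi> u v
    proof -
      have "cinner v f = 1 / c * (LINT p|cube. partial_x \<phi> p * cnj (F p))"
        using cinner_eq[OF v F] by (simp add: mult.assoc)
      also have "(LINT p|cube. partial_x \<phi> p * cnj (F p)) =
          cnj (LINT p|cube. F p * partial_x (\<lambda>p. cnj (\<phi> p)) p)"
        by (simp add: partial_x_cnj[OF t] mult.commute flip: Bochner_Integration.integral_cnj)
      finally have 1: "cinner v f = 1 / c * cnj (LINT p|cube. F p * partial_x (\<lambda>p. cnj (\<phi> p)) p)" .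
      have "cinner u g = cnj (LINT p|cube. G p * cnj (\<phi> p))"
        using cinner_eq[OF u G] by (simp add: mult.commute flip: Bochner_Integration.integral_cnj)
      then have 2: "cinner u g = 1 / c * cnj (- (LINT p|cube. c * G p * cnj (\<phi> p)))"
        using c by (simp add: mult.assoc)
      show ?thesis
        unfolding 1 2 using c(1) by (simp only: mult_cancel_left complex_cnj_cancel_iff) simp
    qed
    have "(f, g) \<in> op_adjoint P_min \<longleftrightarrow> (\<forall>\<phi>. test_function \<phi> \<longrightarrow>
        (LINT p|cube. F p * partial_x (\<lambda>p. cnj (\<phi> p)) p) = - (LINT p|cube. c * G p * cnj (\<phi> p)))"
    proof (intro iffI allI impI)
      fix \<phi> :: "real \<times> real \<Rightarrow> complex"
      assume adj: "(f, g) \<in> op_adjoint P_min" and t: "test_function \<phi>"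
      obtain u v where u: "represents \<phi> u" and v: "represents (\<lambda>p. 1 / c * partial_x \<phi> p) v"
        using represents_exists[OF test_function_square_integrable(1)[OF t]]
          represents_exists[OF square_integrable_scale[OF test_function_square_integrable(2)[OF t]]]
        by blast
      have "(u, v) \<in> P_min"
        unfolding P_min_def c_def[symmetric] using t u v by blast
      with adj have "cinner v f = cinner u g" by (auto simp: op_adjoint_def)
      then show "(LINT p|cube. F p * partial_x (\<lambda>p. cnj (\<phi> p)) p) = - (LINT p|cube. c * G p * cnj (\<phi> p))"
        using pair[OF t u v] by blast
    next
      assume "\<forall>\<phi>. test_function \<phi> \<longrightarrow>
        (LINT p|cube. F p * partial_x (\<lambda>p. cnj (\<phi> p)) p) = - (LINT p|cube. c * G p * cnj (\<phi> p))"
      then have "cinner v f = cinner u g" if "(u, v) \<in> P_min" for u v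
        using that pair unfolding P_min_def c_def[symmetric] by blast
      then show "(f, g) \<in> op_adjoint P_min"
        by (auto simp: op_adjoint_def)
    qed
    also have "\<dots> \<longleftrightarrow> (f, g) \<in> P_max"
      (is "(\<forall>\<phi>. test_function \<phi> \<longrightarrow> ?Q (\<lambda>p. cnj (\<phi> p))) \<longleftrightarrow> _")
    proof
      assume *: "\<forall>\<phi>. test_function \<phi> \<longrightarrow> ?Q (\<lambda>p. cnj (\<phi> p))"
      have "?Q \<phi>" if "test_function \<phi>" for \<phi>
        using *[rule_format, OF test_function_cnj[OF that]] by (simp only: complex_cnj_cnj)
      then show "(f, g) \<in> P_max" unfolding wd by blast
    next
      assume "(f, g) \<in> P_max"
      then show "\<forall>\<phi>. test_function \<phi> \<longrightarrow> ?Q (\<lambda>p. cnj (\<phi> p))"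
        unfolding wd using test_function_cnj by blast
    qed
    finally show ?thesis by blast
  qed
  then show ?thesis by auto
qed

text \<open>
  \<^term>\<open>has_trace t f h\<close>: the restriction \<open>f(t,\<cdot>)\<close> is \<open>h\<close>.  It is read off from a representative
  of \<open>f\<close> that is continuous in the first variable on almost every horizontal line; two such
  representatives agree on almost every horizontal line, so \<open>h\<close> is unique.  Every \<open>f\<close> in the domain
  of \<^term>\<open>P_max\<close> has such a representative (even an absolutely continuous one), and its
  restrictions are in \<open>L\<^sup>2([0,1])\<close>.
\<close>

definition has_trace :: "real \<Rightarrow> (real \<times> real) cube_L2 \<Rightarrow> real cube_L2 \<Rightarrow> bool"
  where "has_trace t f h \<longleftrightarrow> (\<exists>F. represents F f \<and>
    (AE y in cube. continuous_on {0..1} (\<lambda>x. F (x, y))) \<and> represents (\<lambda>y. F (t, y)) h)"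

definition P_ext :: "(real cube_L2 \<Rightarrow> real cube_L2) \<Rightarrow> ((real \<times> real) cube_L2 \<times> (real \<times> real) cube_L2) set"
  where "P_ext V = {(f, g) \<in> P_max. \<exists>h. has_trace 0 f h \<and> has_trace 1 f (V h)}"

end

theory Submission imports Defs begin

text \<open>
  A boundary unitary \<open>V\<close> has a logarithm: \<open>V = exp (2\<pi>i A)\<close> with \<open>A\<close> selfadjoint, spectrum in \<open>[0,1]\<close>, and
  1 not an eigenvalue. Multiplication by \<open>exp (2\<pi>i x A)\<close> turns \<open>P_ext V\<close> into an operator that is
  diagonal in the Fourier modes \<open>exp (2\<pi>i n x) \<otimes> k\<close>, acting as \<open>n + A\<close> on the \<open>n\<close>-th one. If \<open>B\<close> is the
  logarithm for a second unitary, then \<open>n + A\<close> and \<open>m + B\<close> with \<open>n \<noteq> m\<close> have spectra that meet at most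
  in a single point, which is an eigenvalue of at most one of them; so an intertwining unitary maps
  the zeroth mode onto the zeroth mode. There it intertwines \<open>A\<close> with \<open>B\<close>, hence the boundary unitaries.
  Conversely, if \<open>W\<close> intertwines the boundary unitaries, then \<open>1 \<otimes> W\<close> intertwines the extensions.
\<close>

section \<open>Operator theory in a real Hilbert space with a complex structure, up to the logarithm
  of a unitary\<close>

section \<open>Hilbert spaces\<close>

text \<open>The logarithm is the main obstacle, and it is built without spectral measures. The power
  series of log (1 - r U) converges for r < 1; what survives r \<rightarrow> 1 is the difference of
  this series for U and for its inverse, because positivity of the Poisson kernel bounds that
  difference by pi uniformly in r. Away from the fixed space of U its strong limit D is a logarithm
  of -U, not of U, so A is 1/2 + D / (2 pi i) there; on the fixed space A is set to 0. The choice 0,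
  not 1, is what keeps 1 from being an eigenvalue. Unbounded operators are handled through bounded
  data only. Membership in an extension becomes Green's identity tested against tensors of a C1
  function and a vector, and the separation of spectra becomes the vanishing of a bounded bilinear
  form, obtained by moving powers of 2 A - 1 from one argument to the other. Endomorphisms are real
  linear, and complex linearity is commutation with an operator whose square is -1.\<close>

lemma ortho_decomp:
  fixes S :: "'a::{real_inner,complete_space} set"
  assumes S: "subspace S" "closed S"
  obtains s t where "s \<in> S" "x = s + t" "\<And>y. y \<in> S \<Longrightarrow> inner t y = 0"
proof -
  define d where "d = infdist x S"
  have ne: "S \<noteq> {}" using S(1) subspace_0 by blast
  have d0: "0 \<le> d" by (simp add: d_def infdist_nonneg)
  have dle: "d \<le> norm (x - y)" if "y \<in> S" for y
    using infdist_le[OF that, of x] by (simp add: d_def dist_norm)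
  have "\<exists>y\<in>S. norm (x - y) < d + 1 / real (Suc n)" for n
  proof (rule ccontr)
    assume "\<not> ?thesis"
    then have "d + 1 / real (Suc n) \<le> infdist x S"
      unfolding infdist_notempty[OF ne] dist_norm by (intro cINF_greatest ne) (auto simp: not_less)
    then show False by (simp add: d_def)
  qed
  then obtain y where yS: "\<And>n. y n \<in> S" and yd: "\<And>n. norm (x - y n) < d + 1 / real (Suc n)"
    by metis
  have lim0: "(\<lambda>n. d + 1 / real (Suc n)) \<longlonglongrightarrow> d"
    using tendsto_add[OF tendsto_const LIMSEQ_inverse_real_of_nat, of d] by (simp add: inverse_eq_divide)
  have "(\<lambda>n. norm (x - y n)) \<longlonglongrightarrow> d"
    by (rule tendsto_sandwich[OF _ _ tendsto_const lim0])
      (use dle[OF yS] less_imp_le[OF yd] in \<open>auto intro!: always_eventually\<close>)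
  then have sq: "(\<lambda>n. (norm (x - y n))\<^sup>2) \<longlonglongrightarrow> d\<^sup>2"
    by (rule tendsto_power)
  \<comment> \<open>Parallelogram law: the midpoint of two members of \<open>S\<close> lies in
    \<open>S\<close> and so has distance at least \<open>d\<close> from \<open>x\<close>.\<close>
  have par: "(norm (y m - y n))\<^sup>2 \<le> 2 * ((norm (x - y m))\<^sup>2 - d\<^sup>2) + 2 * ((norm (x - y n))\<^sup>2 - d\<^sup>2)" for m n
  proof -
    have "(1/2) *\<^sub>R (y m + y n) \<in> S"
      using S(1) yS by (intro subspace_scale subspace_add)
    from power_mono[OF dle[OF this] d0, of 2]
    have "d\<^sup>2 \<le> (norm (x - (1/2) *\<^sub>R (y m + y n)))\<^sup>2" .
    moreover have "4 * (norm (x - (1/2) *\<^sub>R (y m + y n)))\<^sup>2 =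
        2 * (norm (x - y m))\<^sup>2 + 2 * (norm (x - y n))\<^sup>2 - (norm (y m - y n))\<^sup>2"
      unfolding power2_norm_eq_inner by (simp add: inner_simps inner_commute algebra_simps)
    ultimately show ?thesis by simp
  qed
  have "Cauchy y"
  proof (rule CauchyI)
    fix e :: real assume e: "0 < e"
    have "\<forall>\<^sub>F n in sequentially. (norm (x - y n))\<^sup>2 < d\<^sup>2 + e\<^sup>2 / 4"
      using order_tendstoD(2)[OF sq, of "d\<^sup>2 + e\<^sup>2/4"] e by simp
    then obtain N where N: "\<And>n. n \<ge> N \<Longrightarrow> (norm (x - y n))\<^sup>2 < d\<^sup>2 + e\<^sup>2 / 4"
      by (auto simp: eventually_sequentially)
    have "norm (y m - y n) < e" if "m \<ge> N" "n \<ge> N" for m n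
    proof -
      have "(norm (y m - y n))\<^sup>2 < e\<^sup>2"
        using par[of m n] N[OF that(1)] N[OF that(2)] by simp
      then show ?thesis using e by (simp add: power_less_imp_less_base)
    qed
    then show "\<exists>M. \<forall>m\<ge>M. \<forall>n\<ge>M. norm (y m - y n) < e" by blast
  qed
  then obtain s where s: "y \<longlonglongrightarrow> s" using Cauchy_convergent_iff convergent_def by blast
  have sS: "s \<in> S" using closed_sequentially[OF S(2)] yS s by blast
  have "(\<lambda>n. (norm (x - y n))\<^sup>2) \<longlonglongrightarrow> (norm (x - s))\<^sup>2"
    by (intro tendsto_intros s)
  then have ds: "(norm (x - s))\<^sup>2 = d\<^sup>2" using sq LIMSEQ_unique by blast
  have "inner (x - s) z = 0" if z: "z \<in> S" for z
  proof (cases "z = 0")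
    case False
    \<comment> \<open>The step along \<open>z\<close> that would lower the distance most; that it
      cannot lower it at all forces the inner product to vanish.\<close>
    define c where "c = inner (x - s) z / inner z z"
    have zz: "inner z z > 0" using False by simp
    have "s + c *\<^sub>R z \<in> S" using S(1) sS z by (intro subspace_scale subspace_add)
    from power_mono[OF dle[OF this] d0, of 2]
    have "(norm (x - s))\<^sup>2 \<le> (norm ((x - s) - c *\<^sub>R z))\<^sup>2" by (simp add: ds algebra_simps)
    then have "0 \<le> c * c * inner z z - 2 * c * inner (x - s) z"
      unfolding power2_norm_eq_inner by (simp add: inner_simps inner_commute algebra_simps)
    then have "(inner (x - s) z)\<^sup>2 / inner z z \<le> 0"
      using zz by (simp add: c_def power2_eq_square)
    then show ?thesis using zz by (simp add: divide_le_0_iff) 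
  qed simp
  then show ?thesis using that[of s "x - s"] sS by simp
qed

text \<open>The density device used throughout: taking for \<open>S\<close> the set where two
  continuous linear maps agree, or where a sequence converges, reduces a claim to a total family of
  vectors.\<close>

lemma closed_subspace_eq_UNIV:
  fixes S :: "'a::{real_inner,complete_space} set"
  assumes "subspace S" "closed S" "\<And>t. (\<And>y. y \<in> S \<Longrightarrow> inner t y = 0) \<Longrightarrow> t = 0"
  shows "x \<in> S"
proof -
  obtain s t where st: "s \<in> S" "x = s + t" "\<And>y. y \<in> S \<Longrightarrow> inner t y = 0"
    using ortho_decomp[OF assms(1,2)] by metis
  from st(3) have "t = 0" using assms(3) by blast
  with st show ?thesis by simp
qed

text \<open>The orthogonal complement of the kernel is a line spanned by \<open>t\<close>; the
  representing vector is the multiple of \<open>t\<close> for which both sides agree at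
  \<open>t\<close>.\<close>

lemma riesz_representation:
  fixes \<phi> :: "'a::{real_inner,complete_space} \<Rightarrow> real"
  assumes "bounded_linear \<phi>"
  obtains z where "\<And>x. \<phi> x = inner z x"
proof (cases "\<forall>x. \<phi> x = 0")
  case True
  then show ?thesis using that[of 0] by simp
next
  case False
  interpret bounded_linear \<phi> by fact
  obtain x0 where x0: "\<phi> x0 \<noteq> 0" using False by blast
  define S where "S = {x. \<phi> x = 0}"
  have "subspace S" by (auto simp: S_def subspace_def zero add scale)
  moreover have "closed S" unfolding S_def
    by (intro closed_Collect_eq continuous_on_const linear_continuous_on assms)
  ultimately obtain s t where st: "s \<in> S" "x0 = s + t" "\<And>y. y \<in> S \<Longrightarrow> inner t y = 0"
    using ortho_decomp by metis
  have t: "\<phi> t = \<phi> x0" using st by (simp add: S_def add)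
  then have tt: "inner t t \<noteq> 0" using x0 zero by auto
  have "\<phi> x = inner ((\<phi> t / inner t t) *\<^sub>R t) x" for x
  proof -
    have "x - (\<phi> x / \<phi> t) *\<^sub>R t \<in> S" using t x0 by (simp add: S_def diff scale)
    then have "inner t x = (\<phi> x / \<phi> t) * inner t t"
      using st(3)[of "x - (\<phi> x / \<phi> t) *\<^sub>R t"] by (simp add: inner_simps)
    then show ?thesis using tt t x0 by (simp add: field_simps)
  qed
  then show ?thesis using that by blast
qed

lemma adjoint_exists:
  fixes T :: "'a::{real_inner,complete_space} \<Rightarrow> 'b::real_inner"
  assumes T: "bounded_linear T"
  obtains S where "bounded_linear S" "\<And>x y. inner (T x) y = inner x (S y)"
proof -
  interpret T: bounded_linear T by fact
  have "\<exists>z. \<forall>x. inner (T x) y = inner z x" for y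
    using riesz_representation[OF bounded_linear_compose[OF bounded_linear_inner_left T], of y] by metis
  then obtain S where S: "\<And>x y. inner (T x) y = inner (S y) x" by metis
  obtain C where C: "C \<ge> 0" "\<And>x. norm (T x) \<le> norm x * C" using T.nonneg_bounded by blast
  have ext: "a = b" if "\<And>x. inner a x = inner b x" for a b :: 'a
    using that[of "a - b"] by (metis inner_diff_left inner_eq_zero_iff right_minus_eq)
  have "bounded_linear S"
  proof (rule bounded_linear_intro)
    show "S (x + y) = S x + S y" for x y
      by (rule ext) (simp add: S[symmetric] inner_simps)
    show "S (r *\<^sub>R x) = r *\<^sub>R S x" for r x
      by (rule ext) (simp add: S[symmetric] inner_simps)
    show "norm (S y) \<le> norm y * C" for y
    proof (cases "S y = 0")
      case True
      then show ?thesis using C(1) by simp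
    next
      case False
      have "norm (S y) * norm (S y) = inner (T (S y)) y"
        by (simp add: S norm_eq_sqrt_inner)
      also have "\<dots> \<le> norm (T (S y)) * norm y" by (rule norm_cauchy_schwarz)
      also have "\<dots> \<le> norm (S y) * C * norm y" by (intro mult_right_mono C(2)) simp
      finally show ?thesis using False by (simp add: mult.commute mult.left_commute)
    qed
  qed
  then show ?thesis using that[of S] S by (simp add: inner_commute)
qed

text \<open>The uniform bound makes the vectors with convergent images a closed subspace, so
  convergence is only asked for on a total family, through \<open>tot\<close>. Both the logarithm
  and the lift of an operator to the tensor product arise as such limits.\<close>

lemma strong_limit_exists:
  fixes T :: "nat \<Rightarrow> 'a::{real_inner,complete_space} \<Rightarrow> 'b::banach"
  assumes T: "\<And>n. linear (T n)" and C: "\<And>n x. norm (T n x) \<le> C * norm x"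
    and tot: "\<And>t. (\<And>y. convergent (\<lambda>n. T n y) \<Longrightarrow> inner t y = 0) \<Longrightarrow> t = 0"
  obtains L where "linear L" "\<And>x. norm (L x) \<le> C * norm x" "\<And>x. (\<lambda>n. T n x) \<longlonglongrightarrow> L x"
proof -
  define X where "X = {x. convergent (\<lambda>n. T n x)}"
  have "convergent (\<lambda>n. c *\<^sub>R T n x)" if "convergent (\<lambda>n. T n x)" for c x
    using that tendsto_scaleR[OF tendsto_const] unfolding convergent_def by blast
  then have "subspace X"
    using T by (auto simp: X_def subspace_def linear_add linear_scale linear_0 convergent_const convergent_add)
  moreover have "closed X"
  proof (unfold closed_sequential_limits, intro allI impI, elim conjE)
    fix x l assume x: "\<forall>n. x n \<in> X" and l: "x \<longlonglongrightarrow> l"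
    have "Cauchy (\<lambda>n. T n l)"
    proof (rule CauchyI)
      fix e :: real assume e: "0 < e"
      \<comment> \<open>A strictly positive majorant of \<open>C\<close>, so that the tolerance can
        be divided by it.\<close>
      define c where "c = \<bar>C\<bar> + 1"
      have c: "c > 0" by (simp add: c_def add_nonneg_pos)
      have Cc: "norm (T n y) \<le> c * norm y" for n y
        using C[of n y] by (rule order_trans) (auto simp: c_def intro!: mult_right_mono)
      obtain k where k: "norm (x k - l) < e / (3 * c)"
        using LIMSEQ_D[OF l, of "e / (3*c)"] e c by fastforce
      have "Cauchy (\<lambda>n. T n (x k))" using x by (simp add: X_def convergent_Cauchy)
      then obtain M where M: "\<And>m n. m \<ge> M \<Longrightarrow> n \<ge> M \<Longrightarrow> norm (T m (x k) - T n (x k)) < e / 3"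
        using CauchyD[of "\<lambda>n. T n (x k)" "e/3"] e by auto
      have "norm (T m l - T n l) < e" if "m \<ge> M" "n \<ge> M" for m n
      proof -
        have b: "norm (T j (x k - l)) < e/3" for j
        proof -
          have "norm (T j (x k - l)) \<le> c * norm (x k - l)" by (rule Cc)
          also have "\<dots> < c * (e / (3 * c))" using k c by (rule mult_strict_left_mono)
          also have "\<dots> = e / 3" using c by simp
          finally show ?thesis .
        qed
        have "T m l - T n l = (T m (x k) - T n (x k)) - T m (x k - l) + T n (x k - l)"
          using T by (simp add: linear_diff)
        then have "norm (T m l - T n l) \<le> norm (T m (x k) - T n (x k)) + norm (T m (x k - l)) + norm (T n (x k - l))"
          by (simp only:) (intro order_trans[OF norm_triangle_ineq] add_right_mono norm_triangle_ineq4)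
        then show ?thesis using M[OF that] b[of m] b[of n] by linarith
      qed
      then show "\<exists>M. \<forall>m\<ge>M. \<forall>n\<ge>M. norm (T m l - T n l) < e" by blast
    qed
    then show "l \<in> X" by (simp add: X_def Cauchy_convergent_iff)
  qed
  ultimately have all: "x \<in> X" for x
    by (rule closed_subspace_eq_UNIV) (use tot in \<open>auto simp: X_def\<close>)
  then have lim: "(\<lambda>n. T n x) \<longlonglongrightarrow> lim (\<lambda>n. T n x)" for x
    by (simp add: X_def convergent_LIMSEQ_iff)
  have "linear (\<lambda>x. lim (\<lambda>n. T n x))"
  proof (rule linearI)
    show "lim (\<lambda>n. T n (x + y)) = lim (\<lambda>n. T n x) + lim (\<lambda>n. T n y)" for x y
      by (rule limI) (use tendsto_add[OF lim lim, of x y] T in \<open>simp add: linear_add\<close>)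
    show "lim (\<lambda>n. T n (r *\<^sub>R x)) = r *\<^sub>R lim (\<lambda>n. T n x)" for r x
      by (rule limI) (use tendsto_scaleR[OF tendsto_const lim, of r x] T in \<open>simp add: linear_scale\<close>)
  qed
  moreover have "norm (lim (\<lambda>n. T n x)) \<le> C * norm x" for x
    using LIMSEQ_le_const2[OF tendsto_norm[OF lim[of x]]] C by blast
  ultimately show ?thesis using that lim by blast
qed

section \<open>The Banach algebra of bounded operators\<close>

text \<open>A copy of the type of bounded linear maps whose multiplication is composition, so that the
  exponential function of Banach algebras is available.\<close>

typedef (overloaded) 'a endo = "UNIV :: ('a::real_normed_vector \<Rightarrow>\<^sub>L 'a) set"
  by simp

setup_lifting type_definition_endo

lift_definition app :: "'a::real_normed_vector endo \<Rightarrow> 'a \<Rightarrow> 'a" (infixr "\<cdot>" 78)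
  is "blinfun_apply" .

lemma endo_eqI: "(\<And>x. S \<cdot> x = T \<cdot> x) \<Longrightarrow> S = T"
  by transfer (rule blinfun_eqI)

instantiation endo :: (real_normed_vector) real_normed_vector
begin
lift_definition zero_endo :: "'a endo" is 0 .
lift_definition plus_endo :: "'a endo \<Rightarrow> 'a endo \<Rightarrow> 'a endo" is "(+)" .
lift_definition minus_endo :: "'a endo \<Rightarrow> 'a endo \<Rightarrow> 'a endo" is "(-)" .
lift_definition uminus_endo :: "'a endo \<Rightarrow> 'a endo" is "uminus" .
lift_definition scaleR_endo :: "real \<Rightarrow> 'a endo \<Rightarrow> 'a endo" is "scaleR" .
lift_definition norm_endo :: "'a endo \<Rightarrow> real" is norm .
definition sgn_endo :: "'a endo \<Rightarrow> 'a endo" where "sgn_endo x = scaleR (inverse (norm x)) x"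
definition dist_endo :: "'a endo \<Rightarrow> 'a endo \<Rightarrow> real" where "dist_endo x y = norm (x - y)"
definition [code del]: "(uniformity :: ('a endo \<times> 'a endo) filter) = (INF e\<in>{0 <..}. principal {(x, y). dist x y < e})"
definition [code del]: "open (S :: 'a endo set) = (\<forall>x\<in>S. \<forall>\<^sub>F (x', y) in uniformity. x' = x \<longrightarrow> y \<in> S)"
instance
  apply standard
  unfolding open_endo_def sgn_endo_def dist_endo_def uniformity_endo_def
                apply (rule refl | (transfer; force simp: algebra_simps norm_triangle_ineq))+
  done
end

instance endo :: (banach) banach
proof
  fix X :: "nat \<Rightarrow> 'a endo" assume "Cauchy X"
  then have "Cauchy (\<lambda>n. Rep_endo (X n))"
    unfolding Cauchy_def dist_norm by (simp add: norm_endo.rep_eq minus_endo.rep_eq)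
  then obtain L where "(\<lambda>n. Rep_endo (X n)) \<longlonglongrightarrow> L" using Cauchy_convergent_iff convergent_def by blast
  then have "X \<longlonglongrightarrow> Abs_endo L"
    unfolding lim_sequentially dist_norm by (simp add: norm_endo.rep_eq minus_endo.rep_eq Abs_endo_inverse)
  then show "convergent X" by (auto simp: convergent_def)
qed

text \<open>\<open>perfect_space\<close> excludes the zero space, on which the identity has norm 0
  instead of 1.\<close>

instantiation endo :: ("{real_normed_vector,perfect_space}") real_normed_algebra_1
begin
lift_definition one_endo :: "'a endo" is id_blinfun .
lift_definition times_endo :: "'a endo \<Rightarrow> 'a endo \<Rightarrow> 'a endo" is "(o\<^sub>L)" .
instance
proof
  fix a b c :: "'a endo" and r :: real
  show "a * b * c = a * (b * c)" by transfer (auto intro: blinfun_eqI)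
  show "(a + b) * c = a * c + b * c" by transfer (auto intro!: blinfun_eqI simp: blinfun.bilinear_simps)
  show "a * (b + c) = a * b + a * c" by transfer (auto intro!: blinfun_eqI simp: blinfun.bilinear_simps)
  show "r *\<^sub>R a * b = r *\<^sub>R (a * b)" "a * r *\<^sub>R b = r *\<^sub>R (a * b)"
    by (transfer; auto intro!: blinfun_eqI simp: blinfun.bilinear_simps)+
  show "1 * a = a" "a * 1 = a" by (transfer; auto intro: blinfun_eqI)+
  show n1: "norm (1 :: 'a endo) = 1" by transfer simp
  show "norm (a * b) \<le> norm a * norm b" by transfer (rule norm_blinfun_compose)
  have "norm (0 :: 'a endo) = 0" by simp
  with n1 show "(0 :: 'a endo) \<noteq> 1" by (metis zero_neq_one)
qed
end

lemma app_simps [simp]: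
  "(S + T) \<cdot> x = S \<cdot> x + T \<cdot> x" "(S - T) \<cdot> x = S \<cdot> x - T \<cdot> x" "(- T) \<cdot> x = - (T \<cdot> x)"
  "(r *\<^sub>R T) \<cdot> x = r *\<^sub>R (T \<cdot> x)" "0 \<cdot> x = 0"
  by (transfer; simp add: blinfun.bilinear_simps)+

lemma app_mult_one [simp]:
  fixes S T :: "'a::{real_normed_vector,perfect_space} endo"
  shows "(S * T) \<cdot> x = S \<cdot> T \<cdot> x" "1 \<cdot> x = x"
  by (transfer; simp)+

lemma bounded_bilinear_app: "bounded_bilinear (\<cdot>)"
proof (rule bounded_bilinear.intro)
  show "\<exists>K. \<forall>a (b::'a). norm (a \<cdot> b) \<le> norm a * norm b * K"
    by (intro exI[of _ 1]) (transfer, simp add: norm_blinfun)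
qed (transfer; simp add: blinfun.bilinear_simps)+

interpretation app: bounded_bilinear "(\<cdot>)"
  by (rule bounded_bilinear_app)

lemma norm_app: "norm (T \<cdot> x) \<le> norm T * norm x"
  by transfer (rule norm_blinfun)

lemma norm_endo_bound: "0 \<le> b \<Longrightarrow> (\<And>x. norm (T \<cdot> x) \<le> b * norm x) \<Longrightarrow> norm T \<le> b"
  by transfer (rule norm_blinfun_bound)

lemma endo_exists:
  assumes "linear f" "\<And>x. norm (f x) \<le> C * norm x"
  obtains T where "\<And>x. T \<cdot> x = f x"
proof -
  have "bounded_linear f"
    using assms by (intro bounded_linear_intro[where K=C]) (auto simp: linear_add linear_scale mult.commute)
  then have "Abs_endo (Blinfun f) \<cdot> x = f x" for x
    by (simp add: app.rep_eq Abs_endo_inverse bounded_linear_Blinfun_apply)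
  then show ?thesis using that by blast
qed

lemma app_sum [simp]: "(sum T A) \<cdot> x = (\<Sum>i\<in>A. T i \<cdot> x)"
  by (rule app.sum_left)

section \<open>Exponentials and logarithms in Banach algebras\<close>

lemma suminf_mult_commute:
  fixes a b :: "'b::{real_normed_algebra_1,banach}"
  assumes "summable f" "\<And>n. a * f n = f n * a"
  shows "a * suminf f = suminf f * a"
  using assms suminf_mult[OF assms(1), of a] suminf_mult2[OF assms(1), of a] by simp

lemma exp_commute:
  fixes a b :: "'b::{real_normed_algebra_1,banach}"
  assumes "a * b = b * a"
  shows "a * exp b = exp b * a"
  unfolding exp_def
  by (rule suminf_mult_commute[OF summable_exp_generic])
    (simp add: power_commuting_commutes[OF assms[symmetric]])

text \<open>The factor \<open>c\<close> is split off on the right, so that the effect of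
  \<open>exp c - 1\<close> on a vector is controlled by the image of that vector under
  \<open>c\<close>. Hence \<open>exp c\<close> fixes the kernel of \<open>c\<close>, and strong
  convergence of bounded commuting exponents passes to their exponentials.\<close>

lemma exp_minus_one_factor:
  fixes c :: "'b::{real_normed_algebra_1,banach}"
  obtains d where "exp c - 1 = d * c" "norm d \<le> exp (norm c)"
proof -
  define f where "f = (\<lambda>n. inverse (fact (Suc n)) *\<^sub>R c ^ n)"
  have fn: "norm (f n) \<le> inverse (fact n) * norm c ^ n" for n
  proof -
    have "norm (f n) \<le> inverse (fact (Suc n)) * norm c ^ n"
      by (simp add: f_def norm_power_ineq mult_left_mono del: fact_Suc)
    also have "\<dots> \<le> inverse (fact n) * norm c ^ n"
      by (intro mult_right_mono le_imp_inverse_le fact_mono) auto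
    finally show ?thesis .
  qed
  have sm: "summable (\<lambda>n. inverse (fact n) * norm c ^ n)"
    using summable_exp_generic[of "norm c"] by (simp add: divide_inverse mult.commute scaleR_conv_of_real)
  have nf: "summable (\<lambda>n. norm (f n))"
    by (rule summable_comparison_test'[OF sm, of 0]) (simp add: fn)
  have "exp c - 1 = suminf f * c"
    unfolding exp_first_term f_def
    using suminf_mult2[OF summable_norm_cancel[OF nf], of c]
    by (simp add: f_def power_commutes del: fact_Suc)
  moreover have "norm (suminf f) \<le> exp (norm c)"
  proof -
    have "norm (suminf f) \<le> (\<Sum>n. norm (f n))" by (rule summable_norm[OF nf])
    also have "\<dots> \<le> (\<Sum>n. inverse (fact n) * norm c ^ n)"
      by (rule suminf_le[OF fn nf sm])
    also have "\<dots> = exp (norm c)" by (simp add: exp_def scaleR_conv_of_real)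
    finally show ?thesis .
  qed
  ultimately show ?thesis using that by blast
qed

text \<open>The remainder after two terms is at most the squared norm of \<open>h\<close> times
  \<open>exp (norm h)\<close>. Without commutativity the derivative has this simple form at 0 only;
  other points are reached through commuting exponents.\<close>

lemma exp_has_derivative_0:
  "((exp :: 'b::{real_normed_algebra_1,banach} \<Rightarrow> 'b) has_derivative (\<lambda>h. h)) (at 0)"
proof -
  have "\<exists>e. (\<forall>h. norm (e h) \<le> norm h * norm h * exp (norm h)) \<and> (\<forall>h::'b. exp h = 1 + h + e h)"
  proof -
    have "\<exists>e. norm e \<le> norm h * norm h * exp (norm h) \<and> exp h = 1 + h + e" for h :: 'b
    proof -
      define f where "f = (\<lambda>n. inverse (fact (n + 2)) *\<^sub>R h ^ (n + 2))"
      have fn: "norm (f n) \<le> (norm h * norm h) * (inverse (fact n) * norm h ^ n)" for n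
      proof -
        have "norm (f n) \<le> inverse (fact (n + 2)) * norm h ^ (n + 2)"
          by (simp add: f_def norm_power_ineq mult_left_mono del: fact_Suc power_Suc)
        also have "\<dots> \<le> inverse (fact n) * norm h ^ (n + 2)"
          by (intro mult_right_mono le_imp_inverse_le fact_mono) auto
        finally show ?thesis by (simp add: power_add power2_eq_square mult_ac)
      qed
      have sm: "summable (\<lambda>n. inverse (fact n) * norm h ^ n)"
        using summable_exp_generic[of "norm h"] by (simp add: divide_inverse mult.commute scaleR_conv_of_real)
      have nf: "summable (\<lambda>n. norm (f n))"
        by (rule summable_comparison_test'[OF summable_mult[OF sm], where N = 0]) (use fn in simp)
      have "norm (suminf f) \<le> (\<Sum>n. norm (f n))" by (rule summable_norm[OF nf])
      also have "\<dots> \<le> (\<Sum>n. (norm h * norm h) * (inverse (fact n) * norm h ^ n))"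
        by (rule suminf_le[OF fn nf summable_mult[OF sm]])
      also have "\<dots> = norm h * norm h * exp (norm h)"
        by (simp add: suminf_mult[OF sm] exp_def scaleR_conv_of_real)
      finally show ?thesis using exp_first_two_terms[of h] by (auto simp: f_def)
    qed
    then show ?thesis by metis
  qed
  then obtain e where e: "\<And>h. norm (e h) \<le> norm h * norm h * exp (norm h)" "\<And>h::'b. exp h = 1 + h + e h"
    by blast
  have "((\<lambda>h::'b. norm h * exp (norm h)) \<longlongrightarrow> 0) (at 0)"
    by (auto intro!: tendsto_eq_intros)
  moreover have bd: "norm (norm (exp (0 + h) - exp 0 - h) / norm h) \<le> norm h * exp (norm h)" for h :: 'b
  proof -
    have "exp (0 + h) - exp 0 - h = e h" by (simp add: e(2)[of h])
    then have "norm (norm (exp (0 + h) - exp 0 - h) / norm h) = norm (e h) / norm h" by simp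
    also have "\<dots> \<le> norm h * exp (norm h)"
    proof (cases "h = 0")
      case False
      then show ?thesis using e(1)[of h] by (simp add: divide_le_eq mult.commute mult.left_commute)
    qed simp
    finally show ?thesis .
  qed
  ultimately have "((\<lambda>h::'b. norm (exp (0 + h) - exp 0 - h) / norm h) \<longlongrightarrow> 0) (at 0)"
    by (intro Lim_null_comparison[OF always_eventually[OF allI[OF bd]]])
  then show ?thesis
    unfolding has_derivative_at using bounded_linear_ident by blast
qed

text \<open>Commutation gives \<open>exp (L s) = exp (L s - L r) * exp (L r)\<close>, which moves
  the differentiation to the point 0.\<close>

lemma exp_commuting_has_vector_derivative:
  fixes L :: "real \<Rightarrow> 'b::{real_normed_algebra_1,banach}"
  assumes L: "(L has_vector_derivative L') (at r within S)" and com: "\<And>s. L s * L r = L r * L s"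
  shows "((\<lambda>s. exp (L s)) has_vector_derivative L' * exp (L r)) (at r within S)"
proof -
  have "((\<lambda>s. L s - L r) has_derivative (\<lambda>x. x *\<^sub>R L')) (at r within S)"
    using L unfolding has_vector_derivative_def by (auto intro!: derivative_eq_intros)
  from has_derivative_compose[OF this, of exp "\<lambda>h. h"]
  have "((\<lambda>s. exp (L s - L r)) has_vector_derivative L') (at r within S)"
    using exp_has_derivative_0 by (simp add: has_vector_derivative_def)
  then have "((\<lambda>s. exp (L s - L r) * exp (L r)) has_vector_derivative L' * exp (L r)) (at r within S)"
    by (auto intro!: derivative_eq_intros)
  moreover have "exp (L s - L r) * exp (L r) = exp (L s)" for s
  proof -
    have "(L s - L r) * L r = L r * (L s - L r)"
      unfolding left_diff_distrib right_diff_distrib com[of s] ..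
    from exp_add_commuting[OF this] show ?thesis by simp
  qed
  ultimately show ?thesis by simp
qed

text \<open>For \<open>\<parallel>X\<parallel> \<le> 1\<close> these are \<open>(1 - rX)\<inverse>\<close> and \<open>- log (1 - rX)\<close>.\<close>

definition geom_ser :: "'b::{real_normed_algebra_1,banach} \<Rightarrow> real \<Rightarrow> 'b"
  where "geom_ser X r = (\<Sum>n. r ^ n *\<^sub>R X ^ n)"

definition log_ser :: "'b::{real_normed_algebra_1,banach} \<Rightarrow> real \<Rightarrow> 'b"
  where "log_ser X r = (\<Sum>n. (r ^ Suc n / real (Suc n)) *\<^sub>R X ^ Suc n)"

context
  fixes X :: "'b::{real_normed_algebra_1,banach}"
  assumes X: "norm X \<le> 1"
begin

lemma norm_power_le_1: "norm (X ^ n) \<le> 1"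
  using norm_power_ineq[of X n] power_le_one[OF norm_ge_zero X, of n] by linarith

lemma geom_ser_norm_summable:
  assumes "0 \<le> r" "r < 1"
  shows "summable (\<lambda>n. norm (r ^ n *\<^sub>R X ^ n))"
  by (rule summable_comparison_test'[OF summable_geometric[of r], of 0])
    (use assms norm_power_le_1 in \<open>auto intro: mult_left_le\<close>)

lemma log_ser_norm_summable:
  assumes "0 \<le> r" "r < 1"
  shows "summable (\<lambda>n. norm ((r ^ Suc n / real (Suc n)) *\<^sub>R X ^ Suc n))"
proof (rule summable_comparison_test'[OF summable_geometric[of r], of 0])
  fix n
  have "r ^ Suc n / real (Suc n) \<le> r ^ n"
  proof -
    have "r ^ Suc n \<le> r ^ n * 1" using assms by (simp add: mult_left_le_one_le)
    also have "\<dots> \<le> r ^ n * real (Suc n)" using assms by (intro mult_left_mono) auto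
    finally show ?thesis by (simp add: divide_le_eq)
  qed
  then show "norm (norm ((r ^ Suc n / real (Suc n)) *\<^sub>R X ^ Suc n)) \<le> r ^ n"
    using norm_power_le_1[of "Suc n"] assms mult_mono[of "r ^ Suc n / real (Suc n)" "r ^ n" "norm (X ^ Suc n)" 1]
    by (simp del: power_Suc)
qed (use assms in auto)

lemmas geom_ser_summable = summable_norm_cancel[OF geom_ser_norm_summable]
lemmas log_ser_summable = summable_norm_cancel[OF log_ser_norm_summable]

lemma geom_ser_inverse:
  assumes r: "0 \<le> r" "r < 1"
  shows "geom_ser X r * (1 - r *\<^sub>R X) = 1"
proof -
  have s: "(\<lambda>n. r ^ n *\<^sub>R X ^ n) sums geom_ser X r"
    unfolding geom_ser_def by (rule summable_sums[OF geom_ser_summable[OF r]])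
  have "(\<lambda>n. (r ^ n *\<^sub>R X ^ n) * (r *\<^sub>R X)) sums (geom_ser X r * (r *\<^sub>R X))"
    by (rule sums_mult2[OF s])
  then have "(\<lambda>n. r ^ Suc n *\<^sub>R X ^ Suc n) sums (geom_ser X r * (r *\<^sub>R X))"
    by (simp add: power_commutes mult.commute)
  moreover have "(\<lambda>n. r ^ Suc n *\<^sub>R X ^ Suc n) sums (geom_ser X r - 1)"
    using s by (subst sums_Suc_iff) simp
  ultimately have "geom_ser X r * (r *\<^sub>R X) = geom_ser X r - 1" by (rule sums_unique2)
  then show ?thesis by (simp add: algebra_simps)
qed

lemma norm_geom_ser:
  assumes r: "0 \<le> r" "r < 1"
  shows "norm (geom_ser X r) \<le> 1 / (1 - r)"
proof -
  have "norm (geom_ser X r) \<le> (\<Sum>n. norm (r ^ n *\<^sub>R X ^ n))"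
    unfolding geom_ser_def by (rule summable_norm[OF geom_ser_norm_summable[OF r]])
  also have "\<dots> \<le> (\<Sum>n. r ^ n)"
    by (rule suminf_le[OF _ geom_ser_norm_summable[OF r] summable_geometric])
      (use r norm_power_le_1 in \<open>auto intro: mult_left_le\<close>)
  finally show ?thesis using r by (simp add: suminf_geometric)
qed

text \<open>Uniformly bounded as \<open>r\<close> tends to 1, although \<open>geom_ser X r\<close> is not.\<close>

lemma norm_geom_ser_one_minus:
  assumes r: "0 \<le> r" "r < 1"
  shows "norm (geom_ser X r * (1 - X)) \<le> 2"
proof -
  \<comment> \<open>The first summand is inverted by the geometric series; the second carries the
    factor 1 - r, which offsets the bound 1 / (1 - r) of that series.\<close>
  have "1 - X = (1 - r *\<^sub>R X) - (1 - r) *\<^sub>R X" by (simp add: algebra_simps)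
  then have "geom_ser X r * (1 - X) = 1 - (1 - r) *\<^sub>R (geom_ser X r * X)"
    by (simp only: right_diff_distrib[of _ "1 - r *\<^sub>R X"] geom_ser_inverse[OF r] mult_scaleR_right)
  then have "norm (geom_ser X r * (1 - X)) \<le> 1 + (1 - r) * (norm (geom_ser X r) * norm X)"
    using norm_triangle_ineq4[of 1 "(1 - r) *\<^sub>R (geom_ser X r * X)"] r
      mult_left_mono[OF norm_mult_ineq, of "1 - r" "geom_ser X r" X]
    by (simp only: norm_scaleR norm_one) (smt (verit))
  also have "\<dots> \<le> 1 + (1 - r) * ((1 / (1 - r)) * 1)"
    using r norm_geom_ser[OF r] X by (intro add_left_mono mult_left_mono mult_mono) auto
  finally show ?thesis using r by simp
qed

lemma log_ser_has_vector_derivative: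
  assumes r: "0 \<le> r" "r < 1"
  shows "(log_ser X has_vector_derivative X * geom_ser X r) (at r within {0..<1})"
proof -
  \<comment> \<open>Strictly between \<open>r\<close> and 1: powers of \<rho> dominate the series of
    derivatives on \<open>{0..\<rho>}\<close>, which is still a neighbourhood of \<open>r\<close>
    within \<open>{0..<1}\<close>.\<close>
  define \<rho> where "\<rho> = (1 + r) / 2"
  have \<rho>: "0 \<le> \<rho>" "\<rho> < 1" "r < \<rho>" using r by (auto simp: \<rho>_def)
  define S where "S = {0..\<rho>}"
  define f where "f = (\<lambda>n s. (s ^ Suc n / real (Suc n)) *\<^sub>R X ^ Suc n)"
  define f' where "f' = (\<lambda>n s (h::real). h *\<^sub>R s ^ n *\<^sub>R X ^ Suc n)"
  define g' where "g' = (\<lambda>s (h::real). h *\<^sub>R (X * geom_ser X s))"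
  have ul: "uniform_limit S (\<lambda>n s. \<Sum>i<n. s ^ i *\<^sub>R X ^ Suc i) (\<lambda>s. \<Sum>i. s ^ i *\<^sub>R X ^ Suc i) sequentially"
  proof (rule Weierstrass_m_test)
    show "summable (\<lambda>n. \<rho> ^ n)" using \<rho> by (simp add: summable_geometric)
    show "norm (s ^ n *\<^sub>R X ^ Suc n) \<le> \<rho> ^ n" if "s \<in> S" for n s
      using that \<rho> norm_power_le_1[of "Suc n"] mult_mono[of "s ^ n" "\<rho> ^ n" "norm (X ^ Suc n)" 1]
      by (simp add: S_def power_mono del: power_Suc)
  qed
  have gg: "(\<Sum>i. s ^ i *\<^sub>R X ^ Suc i) = X * geom_ser X s" if "s \<in> S" for s
    using suminf_mult[OF geom_ser_summable[of s], of X] that \<rho> by (simp add: geom_ser_def S_def)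
  have "\<exists>g. \<forall>x\<in>S. (\<lambda>n. f n x) sums (g x) \<and> (g has_derivative g' x) (at x within S)"
  proof (rule has_derivative_series)
    show "convex S" "r \<in> S" using r \<rho> by (auto simp: S_def)
    show "(f n has_derivative f' n s) (at s within S)" for n s
    proof -
      have "((\<lambda>s. s ^ Suc n / real (Suc n)) has_field_derivative s ^ n) (at s within S)"
        by (rule derivative_eq_intros refl | simp)+
      then have "((\<lambda>s. s ^ Suc n / real (Suc n)) has_derivative (\<lambda>h. s ^ n * h)) (at s within S)"
        by (simp add: has_field_derivative_def)
      from has_derivative_scaleR_left[OF this, of "X ^ Suc n"]
      show ?thesis by (simp add: f_def f'_def mult.commute del: power_Suc)
    qed
    show "\<forall>\<^sub>F n in sequentially. \<forall>x\<in>S. \<forall>h. norm ((\<Sum>i<n. f' i x h) - g' x h) \<le> e * norm h" if "e > 0" for e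
    proof -
      have "\<forall>\<^sub>F n in sequentially. \<forall>x\<in>S. norm ((\<Sum>i<n. x ^ i *\<^sub>R X ^ Suc i) - X * geom_ser X x) < e"
        using uniform_limitD[OF ul that] by (simp add: dist_norm gg cong: ball_cong del: power_Suc)
      then show ?thesis
      proof (rule eventually_mono, intro ballI allI)
        fix n x and h :: real
        assume *: "\<forall>x\<in>S. norm ((\<Sum>i<n. x ^ i *\<^sub>R X ^ Suc i) - X * geom_ser X x) < e" and "x \<in> S"
        have "(\<Sum>i<n. f' i x h) - g' x h = h *\<^sub>R ((\<Sum>i<n. x ^ i *\<^sub>R X ^ Suc i) - X * geom_ser X x)"
          by (simp add: f'_def g'_def scaleR_sum_right scaleR_right_diff_distrib)
        then show "norm ((\<Sum>i<n. f' i x h) - g' x h) \<le> e * norm h"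
          using * \<open>x \<in> S\<close>
          by (auto simp: mult.commute[of e] intro!: mult_left_mono[OF less_imp_le] simp del: power_Suc)
      qed
    qed
    show "(\<lambda>n. f n r) sums log_ser X r"
      unfolding f_def log_ser_def by (rule summable_sums[OF log_ser_summable[OF r]])
  qed
  then obtain g where g: "\<And>x. x \<in> S \<Longrightarrow> (\<lambda>n. f n x) sums (g x)"
      "\<And>x. x \<in> S \<Longrightarrow> (g has_derivative g' x) (at x within S)" by blast
  have eq: "g x = log_ser X x" if "x \<in> S" for x
    using sums_unique[OF g(1)[OF that]] by (simp add: log_ser_def f_def)
  have rS: "r \<in> S" using r \<rho> by (auto simp: S_def)
  have "(log_ser X has_derivative g' r) (at r within S)"
    by (rule has_derivative_transform[OF rS _ g(2)[OF rS]]) (simp add: eq)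
  moreover have "at r within S = at r within {0..<1}"
    by (rule at_within_nhd[of _ "{..<\<rho>}"]) (use \<rho> in \<open>auto simp: S_def\<close>)
  ultimately show ?thesis by (simp add: has_vector_derivative_def g'_def)
qed

lemma log_ser_commute:
  assumes r: "0 \<le> r" "r < 1" and a: "a * X = X * a"
  shows "a * log_ser X r = log_ser X r * a"
  unfolding log_ser_def
  by (rule suminf_mult_commute[OF log_ser_summable[OF r]])
    (simp add: power_commuting_commutes[OF a[symmetric]] del: power_Suc)

lemma geom_ser_commute:
  assumes r: "0 \<le> r" "r < 1" and a: "a * X = X * a"
  shows "a * geom_ser X r = geom_ser X r * a"
  unfolding geom_ser_def
  by (rule suminf_mult_commute[OF geom_ser_summable[OF r]])
    (simp add: power_commuting_commutes[OF a[symmetric]] del: power_Suc)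

text \<open>The left-hand side has derivative 0 in \<open>r\<close> and equals 1 at
  \<open>r = 0\<close>.\<close>

lemma exp_log_ser:
  assumes r: "0 \<le> r" "r < 1"
  shows "exp (log_ser X r) * (1 - r *\<^sub>R X) = 1"
proof -
  define \<phi> where "\<phi> = (\<lambda>s. exp (log_ser X s) * (1 - s *\<^sub>R X))"
  have "(\<phi> has_vector_derivative 0) (at s within {0..<1})" if s: "s \<in> {0..<1}" for s
  proof -
    define s' where "s' = s"
    have s0: "0 \<le> s" "s < 1" using that by auto
    \<comment> \<open>Outside \<open>{0..<1}\<close> the series need not converge; the default 0
      makes the commutation with \<open>L s\<close> hold at every real parameter.\<close>
    define L where "L = (\<lambda>t. if t \<in> {0..<1} then log_ser X t else 0)"
    have "L t * L s = L s * L t" for t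
      using s unfolding L_def
      by (auto intro!: log_ser_commute log_ser_commute[symmetric])
    moreover have "(L has_vector_derivative X * geom_ser X s) (at s within {0..<1})"
      by (rule has_vector_derivative_transform[OF s _ log_ser_has_vector_derivative[OF s0]]) (simp add: L_def)
    ultimately have "((\<lambda>t. exp (L t)) has_vector_derivative X * geom_ser X s * exp (L s)) (at s within {0..<1})"
      by (intro exp_commuting_has_vector_derivative) auto
    then have "((\<lambda>t. exp (log_ser X t)) has_vector_derivative X * geom_ser X s * exp (L s)) (at s within {0..<1})"
      by (rule has_vector_derivative_transform[OF s, rotated]) (simp add: L_def)
    moreover have "((\<lambda>t. 1 - t *\<^sub>R X) has_vector_derivative - X) (at s within {0..<1})"
      by (auto intro!: derivative_eq_intros)
    ultimately have "(\<phi> has_vector_derivative exp (log_ser X s) * - X + X * geom_ser X s * exp (L s) * (1 - s *\<^sub>R X)) (at s within {0..<1})"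
      unfolding \<phi>_def by (rule has_vector_derivative_mult)
    moreover have "X * geom_ser X s * exp (L s) * (1 - s *\<^sub>R X) = exp (log_ser X s) * X"
    proof -
      have c1: "X * exp (L s) = exp (L s) * X"
        using s0 by (intro exp_commute) (simp add: L_def log_ser_commute)
      then have "(1 - s *\<^sub>R X) * exp (L s) = exp (L s) * (1 - s *\<^sub>R X)"
        by (simp add: algebra_simps)
      then have "X * geom_ser X s * exp (L s) * (1 - s *\<^sub>R X) = X * (geom_ser X s * (1 - s *\<^sub>R X)) * exp (L s)"
        by (simp add: mult.assoc)
      also have "\<dots> = X * exp (L s)" by (simp add: geom_ser_inverse[OF s0])
      finally show ?thesis using c1 s0 by (simp add: L_def)
    qed
    ultimately show ?thesis by simp
  qed
  then obtain c where "\<And>s. s \<in> {0..<1} \<Longrightarrow> \<phi> s = c"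
    using has_vector_derivative_zero_constant[of "{0..<1::real}" \<phi>] by auto
  then have "\<phi> r = \<phi> 0" using r by simp
  then show ?thesis by (simp add: \<phi>_def log_ser_def)
qed

end

section \<open>The logarithm of a unitary operator\<close>

text \<open>Polarisation with \<open>y\<close>, the image of \<open>x\<close> rescaled to the norm
  of \<open>x\<close>: by symmetry \<open>4 * inner (T \<cdot> x) y\<close> is the difference of the
  quadratic form at x + y and x - y, and the parallelogram law sums the two bounds.\<close>

lemma symmetric_norm_bound:
  fixes T :: "'a::{real_inner} endo"
  assumes sym: "\<And>x y. inner (T \<cdot> x) y = inner x (T \<cdot> y)"
    and c: "\<And>x. \<bar>inner (T \<cdot> x) x\<bar> \<le> c * (norm x)\<^sup>2"
  shows "norm (T \<cdot> x) \<le> c * norm x"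
proof (cases "T \<cdot> x = 0 \<or> x = 0")
  case True
  have "0 \<le> c * (norm x)\<^sup>2" using c[of x] abs_ge_zero order_trans by blast
  then have "0 \<le> c * norm x" by (cases "x = 0") (auto simp: zero_le_mult_iff)
  then show ?thesis using True by (auto simp: app.zero_right)
next
  case False
  define y where "y = (norm x / norm (T \<cdot> x)) *\<^sub>R (T \<cdot> x)"
  have ny: "norm y = norm x" using False by (simp add: y_def)
  have "inner (T \<cdot> y) x = inner (T \<cdot> x) y"
    using sym[of y x] by (simp add: inner_commute)
  then have "4 * inner (T \<cdot> x) y = inner (T \<cdot> (x + y)) (x + y) - inner (T \<cdot> (x - y)) (x - y)"
    by (simp add: app.add_right app.diff_right inner_simps)
  also have "\<dots> \<le> c * (norm (x + y))\<^sup>2 + c * (norm (x - y))\<^sup>2"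
    using c[of "x + y"] c[of "x - y"] by linarith
  also have "\<dots> = c * (2 * (norm x)\<^sup>2 + 2 * (norm y)\<^sup>2)"
    by (simp add: power2_norm_eq_inner inner_simps inner_commute algebra_simps)
  also have "\<dots> = 4 * (c * (norm x)\<^sup>2)" by (simp add: ny)
  finally have "inner (T \<cdot> x) y \<le> c * (norm x)\<^sup>2" by simp
  moreover have "inner (T \<cdot> x) y = norm x * norm (T \<cdot> x)"
    using False by (simp add: y_def power2_norm_eq_inner[symmetric] power2_eq_square)
  ultimately have "norm x * norm (T \<cdot> x) \<le> norm x * (c * norm x)"
    by (simp add: power2_eq_square mult_ac)
  then show ?thesis using False by simp
qed

text \<open>Fourier coefficients of a sawtooth: the cosine part vanishes, and the sine part carries
  the factor 1 / (m + 1) that turns a geometric series into a logarithmic one. For \<sigma> = 1 and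
  \<sigma> = -1 the weight is nonnegative on the period.\<close>

lemma weighted_trig_integrals:
  fixes \<sigma> :: real
  shows "((\<lambda>t. pi + \<sigma> * (t - pi)) has_integral 2 * pi\<^sup>2) {0..2*pi}"
    and "((\<lambda>t. (pi + \<sigma> * (t - pi)) * cos (real (Suc m) * t)) has_integral 0) {0..2*pi}"
    and "((\<lambda>t. (pi + \<sigma> * (t - pi)) * sin (real (Suc m) * t)) has_integral - (2 * pi * \<sigma> / real (Suc m))) {0..2*pi}"
proof -
  define k where "k = real (Suc m)"
  have k: "k \<noteq> 0" by (simp add: k_def)
  have cs: "cos (k * (2 * pi)) = 1" "sin (k * (2 * pi)) = 0"
    using cos_2npi[of "Suc m"] sin_2npi[of "Suc m"] unfolding k_def by (metis mult.assoc mult.commute)+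
  have ftc: "(f has_integral F (2*pi) - F 0) {0..2*pi}"
    if "\<And>t. (F has_real_derivative f t) (at t)" for f F :: "real \<Rightarrow> real"
    by (rule fundamental_theorem_of_calculus)
      (use that in \<open>auto simp: has_real_derivative_iff_has_vector_derivative[symmetric] intro: DERIV_subset\<close>)
  have "((\<lambda>t. pi + \<sigma> * (t - pi)) has_integral (\<lambda>t. pi * t + \<sigma> * (t\<^sup>2 / 2 - pi * t)) (2*pi) - (\<lambda>t. pi * t + \<sigma> * (t\<^sup>2 / 2 - pi * t)) 0) {0..2*pi}"
    by (rule ftc) (auto intro!: derivative_eq_intros simp: algebra_simps)
  then show "((\<lambda>t. pi + \<sigma> * (t - pi)) has_integral 2 * pi\<^sup>2) {0..2*pi}"
    by (simp add: power2_eq_square mult_ac)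
  have "((\<lambda>t. (pi + \<sigma> * (t - pi)) * cos (k * t)) has_integral
      (\<lambda>t. (pi + \<sigma> * (t - pi)) * (sin (k * t) / k) + \<sigma> * (cos (k * t) / (k * k))) (2*pi) -
      (\<lambda>t. (pi + \<sigma> * (t - pi)) * (sin (k * t) / k) + \<sigma> * (cos (k * t) / (k * k))) 0) {0..2*pi}"
    by (rule ftc) (rule derivative_eq_intros refl | simp add: k)+
  then show "((\<lambda>t. (pi + \<sigma> * (t - pi)) * cos (real (Suc m) * t)) has_integral 0) {0..2*pi}"
    unfolding k_def[symmetric] by (simp add: cs)
  have "((\<lambda>t. (pi + \<sigma> * (t - pi)) * sin (k * t)) has_integral
      (\<lambda>t. \<sigma> * (sin (k * t) / (k * k)) - (pi + \<sigma> * (t - pi)) * (cos (k * t) / k)) (2*pi) -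
      (\<lambda>t. \<sigma> * (sin (k * t) / (k * k)) - (pi + \<sigma> * (t - pi)) * (cos (k * t) / k)) 0) {0..2*pi}"
    by (rule ftc) (rule derivative_eq_intros refl | simp add: k)+
  moreover have "(pi + \<sigma> * (0 - pi)) / k - (pi + \<sigma> * (2 * pi - pi)) / k = - (2 * pi * \<sigma> / k)"
    using k by (simp add: field_simps)
  ultimately show "((\<lambda>t. (pi + \<sigma> * (t - pi)) * sin (real (Suc m) * t)) has_integral - (2 * pi * \<sigma> / real (Suc m))) {0..2*pi}"
    unfolding k_def[symmetric] by (simp add: cs)
qed

text \<open>Multiplication by the complex number \<open>z\<close> with \<open>J\<close> as imaginary
  unit. Keeping \<open>J\<close> as an operator lets all power series live in the real Banach
  algebra of endomorphisms.\<close>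

definition cstr :: "'a::{real_normed_vector,perfect_space} endo \<Rightarrow> complex \<Rightarrow> 'a endo"
  where "cstr J z = Re z *\<^sub>R 1 + Im z *\<^sub>R J"

context
  fixes J :: "'a::{real_inner,banach,perfect_space} endo"
  assumes JJ: "J * J = -1" and J_skew: "\<And>x y. inner (J \<cdot> x) y = - inner x (J \<cdot> y)"
begin

lemma cstr_mult: "cstr J z * cstr J w = cstr J (z * w)"
  by (simp add: cstr_def algebra_simps JJ)

lemma cstr_1: "cstr J 1 = 1" and cstr_neg_1: "cstr J (-1) = -1"
  by (simp_all add: cstr_def)

lemma cstr_power: "cstr J z ^ n = cstr J (z ^ n)"
  by (induction n) (simp_all add: cstr_1 cstr_mult)

lemma exp_cstr: "exp (cstr J z) = cstr J (exp z)"
proof -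
  have "bounded_linear (cstr J)"
    unfolding cstr_def
    by (intro bounded_linear_add bounded_linear_scaleR_const bounded_linear_Re bounded_linear_Im)
  from bounded_linear.sums[OF this exp_converges[of z]] linear_scale[OF bounded_linear.linear[OF this]]
  have "(\<lambda>n. cstr J z ^ n /\<^sub>R fact n) sums cstr J (exp z)"
    by (simp add: cstr_power)
  then show ?thesis using exp_converges sums_unique2 by blast
qed

lemma norm_cstr_app: "norm (cstr J z \<cdot> x) = cmod z * norm x"
proof -
  have "inner x (J \<cdot> x) = 0" using J_skew[of x x] by (simp add: inner_commute)
  moreover have "J \<cdot> J \<cdot> x = - x" using arg_cong[OF JJ, of "\<lambda>T. T \<cdot> x"] by simp
  ultimately have "(norm (cstr J z \<cdot> x))\<^sup>2 = (cmod z * norm x)\<^sup>2"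
    unfolding power_mult_distrib cmod_power2 power2_norm_eq_inner
    by (simp add: cstr_def inner_simps J_skew algebra_simps power2_eq_square)
  then show ?thesis by (simp add: power2_eq_iff_nonneg)
qed

context
  fixes U Ui :: "'a endo"
  assumes UUi: "U * Ui = 1" "Ui * U = 1" and U_adj: "\<And>x y. inner (U \<cdot> x) y = inner x (Ui \<cdot> y)"
    and JU: "J * U = U * J"
begin

lemma JUi: "J * Ui = Ui * J"
proof -
  have "J * Ui = (Ui * U) * J * Ui" by (simp add: UUi)
  also have "\<dots> = Ui * (U * J) * Ui" by (simp add: mult.assoc)
  also have "\<dots> = Ui * J * (U * Ui)" by (simp add: JU[symmetric] mult.assoc)
  finally show ?thesis by (simp add: UUi)
qed

lemma Ui_adj: "inner (Ui \<cdot> x) y = inner x (U \<cdot> y)"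
  using U_adj[of y x] by (simp add: inner_commute)

lemma U_Ui_app: "U \<cdot> Ui \<cdot> x = x" "Ui \<cdot> U \<cdot> x = x"
  using arg_cong[OF UUi(1), of "\<lambda>T. T \<cdot> x"] arg_cong[OF UUi(2), of "\<lambda>T. T \<cdot> x"] by simp_all

lemma norm_U_app: "norm (U \<cdot> x) = norm x" and norm_Ui_app: "norm (Ui \<cdot> x) = norm x"
  by (simp_all add: norm_eq_sqrt_inner U_adj Ui_adj U_Ui_app)

lemma norm_U: "norm U \<le> 1" and norm_Ui: "norm Ui \<le> 1"
  by (auto intro!: norm_endo_bound simp: norm_U_app norm_Ui_app)

lemma norm_U_power_app: "norm (U ^ n \<cdot> x) = norm x"
  by (induction n) (simp_all add: norm_U_app)

text \<open>The right-hand side is a truncated Poisson integral of the spectral measure of \<open>x\<close>,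
  hence nonnegative up to the truncation error.\<close>

lemma poisson_sum_ge:
  assumes r: "0 \<le> r" "r < 1"
  shows "- (2 / (1 - r) + 2) * r ^ M * (norm x)\<^sup>2 \<le>
    2 * (\<Sum>m<M. r ^ m * (cos (real m * t) * inner (U ^ m \<cdot> x) x - sin (real m * t) * inner (J \<cdot> U ^ m \<cdot> x) x)) - (norm x)\<^sup>2"
proof -
  \<comment> \<open>\<open>U\<close> rotated by the angle -t and shrunk by \<open>r\<close>. Twice
    the real part of the inverse of 1 - X, minus 1, is the Poisson kernel evaluated at
    \<open>U\<close>; \<open>R\<close> below is the truncated Neumann series of that inverse,
    applied to \<open>x\<close>.\<close>
  define X where "X = r *\<^sub>R (cstr J (cis (- t)) * U)"
  have cU: "cstr J z * U = U * cstr J z" for z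
    by (simp add: cstr_def distrib_left distrib_right JU)
  have Xm: "X ^ m = r ^ m *\<^sub>R (cstr J (cis (- (real m * t))) * U ^ m)" for m
  proof (induction m)
    case (Suc m)
    have "X ^ Suc m = r ^ Suc m *\<^sub>R (cstr J (cis (-t)) * (U * cstr J (cis (- (real m * t)))) * U ^ m)"
      by (subst power_Suc, subst Suc) (simp add: X_def mult.assoc)
    also have "\<dots> = r ^ Suc m *\<^sub>R ((cstr J (cis (-t)) * cstr J (cis (- (real m * t)))) * U ^ Suc m)"
      by (simp only: cU[symmetric] mult.assoc power_Suc)
    also have "cstr J (cis (-t)) * cstr J (cis (- (real m * t))) = cstr J (cis (- (real (Suc m) * t)))"
      by (simp add: cstr_mult cis_mult algebra_simps)
    finally show ?case .
  qed (simp add: cstr_1)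
  have nX: "norm (X ^ m \<cdot> y) = r ^ m * norm y" for m y
    using r by (simp add: Xm norm_cstr_app norm_U_power_app)
  define R where "R = (\<Sum>m<M. X ^ m \<cdot> x)"
  define k where "k = x - X ^ M \<cdot> x"
  have kR: "k = R - X \<cdot> R"
  proof -
    have "(1 - X) * (\<Sum>m<M. X ^ m) = 1 - X ^ M" by (induction M) (simp_all add: distrib_left left_diff_distrib)
    from arg_cong[OF this, of "\<lambda>T. T \<cdot> x"] show ?thesis by (simp add: R_def k_def)
  qed
  \<comment> \<open>Completing the square with \<open>R - k = X \<cdot> R\<close>. As
    \<open>X\<close> is a contraction, the right-hand side is nonnegative: this is the positivity of
    the Poisson kernel in operator form.\<close>
  have "2 * inner R k - (norm k)\<^sup>2 = (norm R)\<^sup>2 - (norm (X \<cdot> R))\<^sup>2"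
    unfolding kR power2_norm_eq_inner by (simp add: inner_simps inner_commute algebra_simps)
  moreover have "norm (X \<cdot> R) \<le> norm R"
    using nX[of 1 R] r by (simp add: mult_left_le_one_le)
  ultimately have pos: "0 \<le> 2 * inner R k - (norm k)\<^sup>2"
    by (simp add: power_mono)
  have nR: "norm R \<le> 1 / (1 - r) * norm x"
  proof -
    have "norm R \<le> (\<Sum>m<M. r ^ m * norm x)"
      unfolding R_def by (rule order_trans[OF norm_sum]) (simp add: nX)
    also have "\<dots> = (\<Sum>m<M. r ^ m) * norm x" by (simp add: sum_distrib_right)
    also have "\<dots> \<le> (\<Sum>m. r ^ m) * norm x"
      using r by (intro mult_right_mono sum_le_suminf summable_geometric) auto
    finally show ?thesis using r by (simp add: suminf_geometric)
  qed
  have "(1 - r ^ M) * norm x \<le> norm k"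
    using norm_triangle_ineq2[of x "X ^ M \<cdot> x"] by (simp add: k_def nX algebra_simps)
  moreover have rM: "0 \<le> r ^ M" "r ^ M \<le> 1" using r by (auto simp: power_le_one)
  ultimately have "((1 - r ^ M) * norm x)\<^sup>2 \<le> (norm k)\<^sup>2"
    by (intro power_mono) auto
  \<comment> \<open>Replacing \<open>k\<close> by \<open>x\<close> costs at most
    \<open>2 * r ^ M\<close> in the squared norm and, below, \<open>2 / (1 - r) * r ^ M\<close> in
    the doubled inner product, each times the squared norm of \<open>x\<close>; together they form
    the error of the statement.\<close>
  then have nk: "(norm x)\<^sup>2 - (norm k)\<^sup>2 \<le> 2 * r ^ M * (norm x)\<^sup>2"
  proof -
    have "((1 - r ^ M) * norm x)\<^sup>2 = (norm x)\<^sup>2 - 2 * r ^ M * (norm x)\<^sup>2 + (r ^ M * norm x)\<^sup>2"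
      by (simp add: power2_eq_square algebra_simps)
    then show ?thesis using \<open>((1 - r ^ M) * norm x)\<^sup>2 \<le> (norm k)\<^sup>2\<close> by (smt (verit) zero_le_power2)
  qed
  have "\<bar>inner R (X ^ M \<cdot> x)\<bar> \<le> norm R * norm (X ^ M \<cdot> x)" by (rule Cauchy_Schwarz_ineq2)
  also have "\<dots> \<le> (1 / (1 - r) * norm x) * (r ^ M * norm x)"
    unfolding nX using r by (intro mult_right_mono nR) auto
  finally have e1: "\<bar>inner R (X ^ M \<cdot> x)\<bar> \<le> 1 / (1 - r) * r ^ M * (norm x)\<^sup>2"
    by (simp add: power2_eq_square mult_ac)
  have "inner R x = inner R k + inner R (X ^ M \<cdot> x)" by (simp add: k_def inner_simps)
  then have "- (2 * (1 / (1 - r) * r ^ M * (norm x)\<^sup>2)) - 2 * r ^ M * (norm x)\<^sup>2 \<le> 2 * inner R x - (norm x)\<^sup>2"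
    using pos e1 nk by linarith
  moreover have "inner R x = (\<Sum>m<M. r ^ m * (cos (real m * t) * inner (U ^ m \<cdot> x) x - sin (real m * t) * inner (J \<cdot> U ^ m \<cdot> x) x))"
    unfolding R_def inner_sum_left by (intro sum.cong) (auto simp: Xm cstr_def inner_simps)
  ultimately show ?thesis by (simp add: algebra_simps)
qed

text \<open>Integrating the Poisson sums against the two nonnegative weights \<open>t\<close> and \<open>2\<pi> - t\<close> on
  \<open>[0, 2\<pi>]\<close> bounds the sawtooth series \<open>\<Sum> r\<^sup>m sin(mt)/m\<close>, evaluated at \<open>U\<close>, by \<open>\<pi>/2\<close>.\<close>

lemma inner_J_log_ser_bound:
  assumes r: "0 \<le> r" "r < 1"
  shows "\<bar>inner (J \<cdot> log_ser U r \<cdot> x) x\<bar> \<le> pi / 2 * (norm x)\<^sup>2"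
proof -
  define S where "S = (\<lambda>N. inner (J \<cdot> (\<Sum>i<N. (r ^ Suc i / real (Suc i)) *\<^sub>R U ^ Suc i) \<cdot> x) x)"
  define \<epsilon> where "\<epsilon> = (\<lambda>M. (2 / (1 - r) + 2) * r ^ M * (norm x)\<^sup>2)"
  \<comment> \<open>The two values of \<sigma> select the two weights, one for each sign inside the
    absolute value.\<close>
  have bound: "- \<sigma> * S N \<le> pi / 2 * ((norm x)\<^sup>2 + \<epsilon> (Suc N))" if \<sigma>: "\<sigma> = 1 \<or> \<sigma> = -1" for \<sigma> N
  proof -
    define w where "w = (\<lambda>t. pi + \<sigma> * (t - pi))"
    define \<alpha> where "\<alpha> = (\<lambda>m. inner (U ^ m \<cdot> x) x)"
    define \<beta> where "\<beta> = (\<lambda>m. inner (J \<cdot> U ^ m \<cdot> x) x)"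
    have I: "(w has_integral 2 * pi\<^sup>2) {0..2*pi}"
      "((\<lambda>t. w t * cos (real (Suc m) * t)) has_integral 0) {0..2*pi}"
      "((\<lambda>t. w t * sin (real (Suc m) * t)) has_integral - (2 * pi * \<sigma> / real (Suc m))) {0..2*pi}" for m
      unfolding w_def by (rule weighted_trig_integrals)+
    \<comment> \<open>The weight times the nonnegative truncated Poisson sum, with the summand m = 0
      merged into the squared norm of \<open>x\<close>. Of the oscillating terms only the sines
      survive integration; they add up to \<open>4 * pi * \<sigma> * S N\<close>.\<close>
    define f where "f = (\<lambda>t. ((norm x)\<^sup>2 + \<epsilon> (Suc N)) * w t + (\<Sum>i<N. 2 * r ^ Suc i * \<alpha> (Suc i) * (w t * cos (real (Suc i) * t))
       - 2 * r ^ Suc i * \<beta> (Suc i) * (w t * sin (real (Suc i) * t))))"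
    have "(f has_integral ((norm x)\<^sup>2 + \<epsilon> (Suc N)) * (2 * pi\<^sup>2) + (\<Sum>i<N. 2 * r ^ Suc i * \<alpha> (Suc i) * 0
       - 2 * r ^ Suc i * \<beta> (Suc i) * (- (2 * pi * \<sigma> / real (Suc i))))) {0..2*pi}"
      unfolding f_def by (intro has_integral_add has_integral_sum has_integral_diff has_integral_mult_right I) auto
    moreover have "0 \<le> f t" if t: "t \<in> {0..2*pi}" for t
    proof -
      have w0: "0 \<le> w t" using t \<sigma> by (auto simp: w_def)
      have "0 \<le> \<epsilon> (Suc N) + 2 * (\<Sum>m<Suc N. r ^ m * (cos (real m * t) * \<alpha> m - sin (real m * t) * \<beta> m)) - (norm x)\<^sup>2"
        using poisson_sum_ge[OF r, of "Suc N" x t] unfolding \<epsilon>_def \<alpha>_def \<beta>_def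
        by linarith
      also have "(\<Sum>m<Suc N. r ^ m * (cos (real m * t) * \<alpha> m - sin (real m * t) * \<beta> m)) =
          (norm x)\<^sup>2 + (\<Sum>i<N. r ^ Suc i * (cos (real (Suc i) * t) * \<alpha> (Suc i) - sin (real (Suc i) * t) * \<beta> (Suc i)))"
        by (subst sum.lessThan_Suc_shift) (simp add: \<alpha>_def power2_norm_eq_inner)
      finally have "0 \<le> w t * ((norm x)\<^sup>2 + \<epsilon> (Suc N) + 2 * (\<Sum>i<N. r ^ Suc i * (cos (real (Suc i) * t) * \<alpha> (Suc i) - sin (real (Suc i) * t) * \<beta> (Suc i))))"
        using w0 by (intro mult_nonneg_nonneg) (auto simp: algebra_simps)
      also have "\<dots> = f t"
        unfolding f_def distrib_left sum_distrib_left
        by (auto simp: algebra_simps simp del: of_nat_Suc power_Suc intro!: sum.cong)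
      finally show ?thesis .
    qed
    ultimately have "0 \<le> ((norm x)\<^sup>2 + \<epsilon> (Suc N)) * (2 * pi\<^sup>2) + (\<Sum>i<N. 2 * r ^ Suc i * \<alpha> (Suc i) * 0
       - 2 * r ^ Suc i * \<beta> (Suc i) * (- (2 * pi * \<sigma> / real (Suc i))))"
      by (rule has_integral_nonneg)
    also have "(\<Sum>i<N. 2 * r ^ Suc i * \<alpha> (Suc i) * 0
       - 2 * r ^ Suc i * \<beta> (Suc i) * (- (2 * pi * \<sigma> / real (Suc i)))) = 4 * pi * \<sigma> * S N"
      unfolding S_def \<beta>_def
      by (simp add: app.sum_right inner_sum_left sum_distrib_left app.scaleR_right mult_ac del: of_nat_Suc power_Suc)
    finally have "0 \<le> (2 * pi) * (pi * ((norm x)\<^sup>2 + \<epsilon> (Suc N)) + 2 * \<sigma> * S N)"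
      by (simp add: algebra_simps power2_eq_square)
    then have "0 \<le> pi * ((norm x)\<^sup>2 + \<epsilon> (Suc N)) + 2 * \<sigma> * S N"
      using pi_gt_zero by (simp only: zero_le_mult_iff) linarith
    then show ?thesis by (simp add: field_simps)
  qed
  have "(\<lambda>N. \<Sum>i<N. (r ^ Suc i / real (Suc i)) *\<^sub>R U ^ Suc i) \<longlonglongrightarrow> log_ser U r"
    unfolding log_ser_def by (rule summable_LIMSEQ[OF log_ser_summable[OF norm_U r]])
  then have Slim: "S \<longlonglongrightarrow> inner (J \<cdot> log_ser U r \<cdot> x) x"
    unfolding S_def by (intro tendsto_inner tendsto_const app.tendsto)
  have "(\<lambda>N. \<epsilon> (Suc N)) \<longlonglongrightarrow> (2 / (1 - r) + 2) * 0 * (norm x)\<^sup>2"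
    unfolding \<epsilon>_def using r by (intro tendsto_intros LIMSEQ_Suc LIMSEQ_power_zero) auto
  then have rlim: "(\<lambda>N. pi / 2 * ((norm x)\<^sup>2 + \<epsilon> (Suc N))) \<longlonglongrightarrow> pi / 2 * ((norm x)\<^sup>2 + 0)"
    by (intro tendsto_intros) simp
  have "- \<sigma> * inner (J \<cdot> log_ser U r \<cdot> x) x \<le> pi / 2 * ((norm x)\<^sup>2 + 0)" if "\<sigma> = 1 \<or> \<sigma> = -1" for \<sigma> :: real
    by (rule LIMSEQ_le[OF tendsto_mult[OF tendsto_const Slim] rlim]) (use bound[OF that] in auto)
  from this[of 1] this[of "-1"] show ?thesis by auto
qed

lemma log_ser_adj:
  assumes r: "0 \<le> r" "r < 1"
  shows "inner (log_ser U r \<cdot> x) y = inner x (log_ser Ui r \<cdot> y)"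
proof -
  have p: "inner (U ^ n \<cdot> x) y = inner x (Ui ^ n \<cdot> y)" for n x y
    by (induction n arbitrary: x y) (simp, subst power_Suc2, simp add: U_adj)
  have s: "(\<lambda>n. ((r ^ Suc n / real (Suc n)) *\<^sub>R X ^ Suc n) \<cdot> z) sums (log_ser X r \<cdot> z)" if "norm X \<le> 1" for X :: "'a endo" and z
    unfolding log_ser_def
    by (rule bounded_linear.sums[OF app.bounded_linear_left summable_sums[OF log_ser_summable[OF that r]]])
  have "(\<lambda>n. inner (((r ^ Suc n / real (Suc n)) *\<^sub>R U ^ Suc n) \<cdot> x) y) sums inner (log_ser U r \<cdot> x) y"
    by (rule bounded_linear.sums[OF bounded_linear_inner_left s[OF norm_U]])
  moreover have "(\<lambda>n. inner x (((r ^ Suc n / real (Suc n)) *\<^sub>R Ui ^ Suc n) \<cdot> y)) sums inner x (log_ser Ui r \<cdot> y)"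
    by (rule bounded_linear.sums[OF bounded_linear_inner_right s[OF norm_Ui]])
  moreover have eq: "inner (((r ^ Suc n / real (Suc n)) *\<^sub>R U ^ Suc n) \<cdot> x) y = inner x (((r ^ Suc n / real (Suc n)) *\<^sub>R Ui ^ Suc n) \<cdot> y)" for n
    using p[of "Suc n" x y] by (simp del: power_Suc)
  ultimately show ?thesis unfolding eq by (intro sums_unique2)
qed

text \<open>Formally \<open>log_diff r\<close> is \<open>log ((1 - rU) / (1 - rU\<inverse>))\<close>, which tends to \<open>log (- U)\<close>.\<close>

definition "log_diff r = log_ser Ui r - log_ser U r"

context
  fixes r :: real
  assumes r: "0 \<le> r" "r < 1"
begin

lemma log_diff_skew: "inner (log_diff r \<cdot> x) y = - inner x (log_diff r \<cdot> y)"
  using log_ser_adj[OF r, of x y] log_ser_adj[OF r, of y x]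
  by (simp add: log_diff_def inner_simps inner_commute)

lemma J_log_ser: "J * log_ser U r = log_ser U r * J" "J * log_ser Ui r = log_ser Ui r * J"
  by (rule log_ser_commute norm_U norm_Ui r JU JUi)+

lemma J_log_diff: "J * log_diff r = log_diff r * J"
  by (simp add: log_diff_def right_diff_distrib left_diff_distrib J_log_ser)

text \<open>\<open>J * log_diff r\<close> is symmetric, so its quadratic form decides its norm. The
  two series are adjoint to each other and contribute equally to this form, which doubles the bound
  pi / 2 of a single one.\<close>

lemma norm_log_diff_app: "norm (log_diff r \<cdot> x) \<le> pi * norm x"
proof -
  have Jc: "J \<cdot> log_diff r \<cdot> y = log_diff r \<cdot> J \<cdot> y" "J \<cdot> log_ser U r \<cdot> y = log_ser U r \<cdot> J \<cdot> y" for y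
    using arg_cong[OF J_log_diff, of "\<lambda>T. T \<cdot> y"] arg_cong[OF J_log_ser(1), of "\<lambda>T. T \<cdot> y"] by simp_all
  have "norm ((J * log_diff r) \<cdot> x) \<le> pi * norm x"
  proof (rule symmetric_norm_bound)
    show "inner ((J * log_diff r) \<cdot> x) y = inner x ((J * log_diff r) \<cdot> y)" for x y
      by (simp add: J_skew log_diff_skew Jc)
    fix x
    have "inner (J \<cdot> log_ser Ui r \<cdot> x) x = - inner (J \<cdot> log_ser U r \<cdot> x) x"
    proof -
      have "inner (J \<cdot> log_ser Ui r \<cdot> x) x = - inner (J \<cdot> x) (log_ser Ui r \<cdot> x)"
        by (simp add: J_skew inner_commute)
      also have "\<dots> = - inner (log_ser U r \<cdot> J \<cdot> x) x" by (simp add: log_ser_adj[OF r])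
      finally show ?thesis by (simp add: Jc)
    qed
    then show "\<bar>inner ((J * log_diff r) \<cdot> x) x\<bar> \<le> pi * (norm x)\<^sup>2"
      using inner_J_log_ser_bound[OF r, of x]
      by (simp add: log_diff_def app.diff_right inner_simps)
  qed
  moreover have "norm (J \<cdot> y) = norm y" for y
    using norm_cstr_app[of \<i> y] by (simp add: cstr_def)
  ultimately show ?thesis by simp
qed

lemma exp_log_diff: "exp (log_diff r) * (1 - r *\<^sub>R Ui) = 1 - r *\<^sub>R U"
proof -
  have "log_ser U r * log_ser Ui r = log_ser Ui r * log_ser U r"
    by (intro log_ser_commute[OF norm_Ui r] log_ser_commute[OF norm_U r, symmetric]) (simp add: UUi)
  then have "exp (- log_ser U r + log_ser Ui r) = exp (- log_ser U r) * exp (log_ser Ui r)"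
    by (intro exp_add_commuting) simp
  then have "exp (log_diff r) * (1 - r *\<^sub>R Ui) = exp (- log_ser U r)"
    by (simp add: log_diff_def mult.assoc exp_log_ser[OF norm_Ui r])
  also have "\<dots> = exp (- log_ser U r) * (exp (log_ser U r) * (1 - r *\<^sub>R U))"
    by (simp add: exp_log_ser[OF norm_U r])
  also have "\<dots> = 1 - r *\<^sub>R U"
    unfolding mult.assoc[symmetric] using exp_minus_inverse[of "- log_ser U r"] by simp
  finally show ?thesis .
qed

end

text \<open>The derivative of \<open>log_diff\<close> in \<open>r\<close> need not stay bounded near
  1, but it does on the range of \<open>(1 - U) * (1 - Ui)\<close>, each of the two series absorbing
  one factor. So the limit exists on this range. Vectors orthogonal to the range are fixed by
  \<open>U\<close>, and there \<open>log_diff\<close> vanishes for every \<open>r\<close>.\<close>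

lemma log_diff_tendsto:
  obtains D where "\<And>x. (\<lambda>n. log_diff (real n / real (Suc n)) \<cdot> x) \<longlonglongrightarrow> D \<cdot> x"
    "\<And>x. norm (D \<cdot> x) \<le> pi * norm x" "\<And>x. U \<cdot> x = x \<Longrightarrow> D \<cdot> x = 0"
proof -
  define r where "r = (\<lambda>n. real n / real (Suc n))"
  have r: "0 \<le> r n" "r n < 1" for n by (auto simp: r_def)
  have "(\<lambda>n. r n) \<longlonglongrightarrow> 1"
    unfolding r_def by (rule LIMSEQ_n_over_Suc_n)
  then have rC: "Cauchy r" by (auto simp: Cauchy_convergent_iff convergent_def)
  have fix0: "log_diff (r n) \<cdot> x = 0" if "U \<cdot> x = x" for n x
  proof -
    have Uix: "Ui \<cdot> x = x" using U_Ui_app(2)[of x] that by simp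
    have eq: "log_ser X (r n) \<cdot> x = (\<Sum>k. (r n ^ Suc k / real (Suc k)) *\<^sub>R x)" if "X \<cdot> x = x" "norm X \<le> 1" for X :: "'a endo"
    proof -
      have "X ^ k \<cdot> x = x" for k by (induction k) (simp_all add: that(1))
      then have "(X ^ Suc k) \<cdot> x = x" for k by blast
      then show ?thesis
        unfolding log_ser_def
        using bounded_linear.suminf[OF app.bounded_linear_left[of x] log_ser_summable[OF that(2) r[of n]]]
        by (simp del: power_Suc)
    qed
    show ?thesis by (simp add: log_diff_def eq[OF that norm_U] eq[OF Uix norm_Ui])
  qed
  \<comment> \<open>8 is 2 * 2 * 2: there are two series, each has norm at most 2 after absorbing
    its own factor, and the other factor has norm at most 2.\<close>
  have lip: "norm (log_diff s \<cdot> k - log_diff t \<cdot> k) \<le> 8 * norm h * \<bar>s - t\<bar>"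
    if st: "s \<in> {0..<1}" "t \<in> {0..<1}" and k: "k = ((1 - U) * (1 - Ui)) \<cdot> h" for s t h k
  proof -
    have der: "((\<lambda>s. log_diff s \<cdot> k) has_derivative
        (\<lambda>d. d *\<^sub>R ((Ui * geom_ser Ui u - U * geom_ser U u) \<cdot> k))) (at u within {0..<1})"
      if "u \<in> {0..<1}" for u
    proof -
      have "(log_diff has_vector_derivative Ui * geom_ser Ui u - U * geom_ser U u) (at u within {0..<1})"
        unfolding log_diff_def[abs_def]
        by (intro has_vector_derivative_diff log_ser_has_vector_derivative norm_U norm_Ui) (use that in auto)
      from bounded_linear.has_vector_derivative[OF app.bounded_linear_left this, of k]
      show ?thesis by (simp add: has_vector_derivative_def)
    qed
    have bd: "norm ((Ui * geom_ser Ui u - U * geom_ser U u) \<cdot> k) \<le> 8 * norm h" if "u \<in> {0..<1}" for u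
    proof -
      have u: "0 \<le> u" "u < 1" using that by auto
      have bound: "norm ((A * geom_ser A u) \<cdot> (1 - A) \<cdot> (1 - B) \<cdot> h) \<le> 4 * norm h"
        if A: "norm A \<le> 1" "norm B \<le> 1" for A B :: "'a endo"
      proof -
        have "norm ((A * geom_ser A u) \<cdot> (1 - A) \<cdot> (1 - B) \<cdot> h) =
            norm (A \<cdot> (geom_ser A u * (1 - A)) \<cdot> (1 - B) \<cdot> h)" by simp
        also have "\<dots> \<le> norm ((geom_ser A u * (1 - A)) \<cdot> (1 - B) \<cdot> h)"
          using norm_app[of A] A(1) by (meson mult_left_le_one_le norm_ge_zero order_trans)
        also have "\<dots> \<le> 2 * norm ((1 - B) \<cdot> h)"
          using norm_app norm_geom_ser_one_minus[OF A(1) u] by (meson mult_right_mono norm_ge_zero order_trans)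
        also have "norm ((1 - B) \<cdot> h) \<le> norm h + norm (B \<cdot> h)" by (simp add: norm_triangle_ineq4)
        also have "norm (B \<cdot> h) \<le> norm h"
          using norm_app[of B h] A(2) by (meson mult_left_le_one_le norm_ge_zero order_trans)
        finally show ?thesis by simp
      qed
      have c: "(1 - U) * (1 - Ui) = (1 - Ui) * (1 - U)" by (simp add: algebra_simps UUi)
      have k1: "k = (1 - Ui) \<cdot> (1 - U) \<cdot> h" unfolding k c by simp
      have k2: "k = (1 - U) \<cdot> (1 - Ui) \<cdot> h" unfolding k by simp
      have "norm ((Ui * geom_ser Ui u) \<cdot> k) \<le> 4 * norm h" "norm ((U * geom_ser U u) \<cdot> k) \<le> 4 * norm h"
        using bound[OF norm_Ui norm_U] bound[OF norm_U norm_Ui] by (simp_all only: k1[symmetric] k2[symmetric])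
      then show ?thesis
        using norm_triangle_ineq4[of "(Ui * geom_ser Ui u) \<cdot> k" "(U * geom_ser U u) \<cdot> k"]
        unfolding app_simps(2) by linarith
    qed
    show ?thesis
    proof (rule differentiable_bound[of "{0..<1::real}" _ "\<lambda>u d. d *\<^sub>R ((Ui * geom_ser Ui u - U * geom_ser U u) \<cdot> k)", unfolded real_norm_def])
      show "onorm (\<lambda>d. d *\<^sub>R ((Ui * geom_ser Ui u - U * geom_ser U u) \<cdot> k)) \<le> 8 * norm h" if "u \<in> {0..<1}" for u
        by (rule onorm_bound) (use bd[OF that] in \<open>auto simp: mult.commute intro!: mult_left_mono\<close>)
    qed (use der st in auto)
  qed
  obtain D where D: "linear D" "\<And>x. norm (D x) \<le> pi * norm x" "\<And>x. (\<lambda>n. log_diff (r n) \<cdot> x) \<longlonglongrightarrow> D x"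
  proof (rule strong_limit_exists[of "\<lambda>n. app (log_diff (r n))"])
    show "linear (app (log_diff (r n)))" for n
      using app.bounded_linear_right bounded_linear.linear by blast
    show "norm (log_diff (r n) \<cdot> x) \<le> pi * norm x" for n x
      by (rule norm_log_diff_app[OF r])
    fix t assume t: "\<And>y. convergent (\<lambda>n. log_diff (r n) \<cdot> y) \<Longrightarrow> inner t y = 0"
    have "convergent (\<lambda>n. log_diff (r n) \<cdot> ((1 - U) * (1 - Ui)) \<cdot> h)" for h
    proof (rule Cauchy_convergent, rule CauchyI)
      fix e :: real assume e: "0 < e"
      define c where "c = 8 * norm h + 1"
      have c: "c > 0" by (simp add: c_def add_nonneg_pos)
      obtain N where N: "\<And>m n. m \<ge> N \<Longrightarrow> n \<ge> N \<Longrightarrow> norm (r m - r n) < e / c"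
        using CauchyD[OF rC, of "e / c"] e c by auto
      have "norm (log_diff (r m) \<cdot> ((1 - U) * (1 - Ui)) \<cdot> h - log_diff (r n) \<cdot> ((1 - U) * (1 - Ui)) \<cdot> h) < e"
        if "m \<ge> N" "n \<ge> N" for m n
      proof -
        have "norm (log_diff (r m) \<cdot> ((1 - U) * (1 - Ui)) \<cdot> h - log_diff (r n) \<cdot> ((1 - U) * (1 - Ui)) \<cdot> h) \<le> 8 * norm h * \<bar>r m - r n\<bar>"
          by (rule lip) (use r in auto)
        also have "\<dots> \<le> c * \<bar>r m - r n\<bar>" by (intro mult_right_mono) (auto simp: c_def)
        also have "\<dots> < c * (e / c)" using N[OF that] c by (intro mult_strict_left_mono) auto
        finally show ?thesis using c by simp
      qed
      then show "\<exists>M. \<forall>m\<ge>M. \<forall>n\<ge>M. norm (log_diff (r m) \<cdot> ((1 - U) * (1 - Ui)) \<cdot> h - log_diff (r n) \<cdot> ((1 - U) * (1 - Ui)) \<cdot> h) < e"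
        by blast
    qed
    \<comment> \<open>With \<open>h = t\<close>, moving \<open>1 - U\<close> to the left argument
      turns this into the squared norm of \<open>t - Ui \<cdot> t\<close>.\<close>
    then have "inner t (((1 - U) * (1 - Ui)) \<cdot> t) = 0" using t by blast
    then have "inner ((1 - Ui) \<cdot> t) ((1 - Ui) \<cdot> t) = 0"
      by (simp add: inner_simps U_adj Ui_adj U_Ui_app app.diff_right)
    then have "Ui \<cdot> t = t" by simp
    then have "U \<cdot> t = t" using U_Ui_app(1)[of t] by simp
    then have "convergent (\<lambda>n. log_diff (r n) \<cdot> t)" by (simp add: fix0 convergent_const)
    then show "t = 0" using t by force
  qed auto
  obtain D' where D': "\<And>x. D' \<cdot> x = D x" using endo_exists[OF D(1,2)] by blast
  show ?thesis
  proof (rule that[of D'])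
    show "(\<lambda>n. log_diff (real n / real (Suc n)) \<cdot> x) \<longlonglongrightarrow> D' \<cdot> x" for x
      using D(3) by (simp add: D' r_def)
    show "norm (D' \<cdot> x) \<le> pi * norm x" for x by (simp add: D' D(2))
    show "D' \<cdot> x = 0" if "U \<cdot> x = x" for x
      using D(3)[of x] LIMSEQ_unique[OF _ tendsto_const] by (simp add: fix0[OF that] D' tendsto_const_iff)
  qed
qed

text \<open>The convergence is only strong, so norm continuity of \<open>exp\<close> does not carry
  it over. But all the \<open>log_diff r\<close> commute with one another and with the limit, and
  the factorisation of \<open>exp c - 1\<close> takes the strong limit through the exponential. The
  last identity says \<open>exp D = - U\<close> on the range of \<open>1 - Ui\<close> and leaves the
  fixed space of \<open>U\<close> open.\<close>

lemma exp_limit_log_diff: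
  assumes D: "\<And>x. (\<lambda>n. log_diff (real n / real (Suc n)) \<cdot> x) \<longlonglongrightarrow> D \<cdot> x"
  shows "J * D = D * J" "\<And>x y. inner (D \<cdot> x) y = - inner x (D \<cdot> y)"
    "exp D * (1 - Ui) = 1 - U"
proof -
  define r where "r = (\<lambda>n. real n / real (Suc n))"
  have r: "0 \<le> r n" "r n < 1" for n by (auto simp: r_def)
  have r1: "(\<lambda>n. r n) \<longlonglongrightarrow> 1"
    unfolding r_def by (rule LIMSEQ_n_over_Suc_n)
  define E where "E = (\<lambda>n. log_diff (r n))"
  have E: "(\<lambda>n. E n \<cdot> x) \<longlonglongrightarrow> D \<cdot> x" for x using D by (simp add: E_def r_def)
  have com: "T * D = D * T" if "\<And>n. T * E n = E n * T" for T
  proof (rule endo_eqI)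
    fix x
    have "(\<lambda>n. T \<cdot> E n \<cdot> x) \<longlonglongrightarrow> T \<cdot> D \<cdot> x" by (intro app.tendsto tendsto_const E)
    moreover have "T \<cdot> E n \<cdot> x = E n \<cdot> T \<cdot> x" for n
      using arg_cong[OF that, of "\<lambda>S. S \<cdot> x"] by simp
    ultimately show "(T * D) \<cdot> x = (D * T) \<cdot> x"
      using LIMSEQ_unique[OF E[of "T \<cdot> x"]] by simp
  qed
  show "J * D = D * J" by (rule com) (simp add: E_def J_log_diff[OF r])
  show "inner (D \<cdot> x) y = - inner x (D \<cdot> y)" for x y
  proof -
    have "(\<lambda>n. inner (E n \<cdot> x) y) \<longlonglongrightarrow> inner (D \<cdot> x) y"
      "(\<lambda>n. - inner x (E n \<cdot> y)) \<longlonglongrightarrow> - inner x (D \<cdot> y)"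
      by (intro tendsto_intros E)+
    then show ?thesis using LIMSEQ_unique by (simp add: E_def log_diff_skew[OF r, of _ x y])
  qed
  have EE: "E m * E n = E n * E m" for m n
  proof -
    have "T * E n = E n * T" if "T * U = U * T" "T * Ui = Ui * T" for T n
      using that log_ser_commute[OF norm_U r[of n]] log_ser_commute[OF norm_Ui r[of n]]
      by (simp add: E_def log_diff_def algebra_simps)
    note c = this
    have "U * E m = E m * U" "Ui * E m = E m * Ui" by (rule c; simp add: UUi)+
    then show ?thesis by (intro c) auto
  qed
  have ED: "E n * D = D * E n" for n by (rule com) (rule EE)
  have nE: "norm (E n - D) \<le> 2 * pi" for n
  proof -
    have "norm (D \<cdot> x) \<le> pi * norm x" for x
      using LIMSEQ_le_const2[OF tendsto_norm[OF E[of x]]] norm_log_diff_app[OF r] by (auto simp: E_def)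
    then have "norm D \<le> pi" by (intro norm_endo_bound) auto
    moreover have "norm (E n) \<le> pi" by (intro norm_endo_bound) (auto simp: E_def norm_log_diff_app[OF r])
    ultimately show ?thesis using norm_triangle_ineq4[of "E n" D] by linarith
  qed
  have expE: "(\<lambda>n. exp (E n) \<cdot> x) \<longlonglongrightarrow> exp D \<cdot> x" for x
  proof -
    have bd: "norm (exp (E n) \<cdot> x - exp D \<cdot> x) \<le> norm (exp D) * exp (2 * pi) * norm (E n \<cdot> x - D \<cdot> x)" for n
    proof -
      have "exp (E n) = exp D * exp (E n - D)"
        using exp_add_commuting[of D "E n - D"] by (simp add: algebra_simps ED)
      then have 1: "exp (E n) \<cdot> x - exp D \<cdot> x = exp D \<cdot> (exp (E n - D) - 1) \<cdot> x"
        by (simp add: app.diff_right)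
      obtain d where d: "exp (E n - D) - 1 = d * (E n - D)" "norm d \<le> exp (norm (E n - D))"
        using exp_minus_one_factor by blast
      have bd: "norm (exp (E n) \<cdot> x - exp D \<cdot> x) \<le> norm (exp D) * norm (d \<cdot> (E n - D) \<cdot> x)"
        unfolding 1 d(1) app_mult_one by (rule norm_app)
      also have "\<dots> \<le> norm (exp D) * (exp (2 * pi) * norm ((E n - D) \<cdot> x))"
      proof (intro mult_left_mono order_trans[OF norm_app] mult_right_mono)
        show "norm d \<le> exp (2 * pi)" using d(2) nE[of n] by (meson exp_le_cancel_iff order_trans)
      qed auto
      finally show ?thesis by (simp add: mult.assoc)
    qed
    have "(\<lambda>n. norm (exp D) * exp (2 * pi) * norm (E n \<cdot> x - D \<cdot> x)) \<longlonglongrightarrow> norm (exp D) * exp (2 * pi) * norm (D \<cdot> x - D \<cdot> x)"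
      by (intro tendsto_intros E)
    then have "(\<lambda>n. exp (E n) \<cdot> x - exp D \<cdot> x) \<longlonglongrightarrow> 0"
      by (intro Lim_null_comparison[OF always_eventually[OF allI[OF bd]]]) simp
    then show ?thesis by (simp add: LIM_zero_iff)
  qed
  show "exp D * (1 - Ui) = 1 - U"
  proof (rule endo_eqI)
    fix x
    have eq: "exp (E n) \<cdot> x - r n *\<^sub>R (exp (E n) \<cdot> Ui \<cdot> x) = x - r n *\<^sub>R (U \<cdot> x)" for n
      using arg_cong[OF exp_log_diff[OF r], of "\<lambda>S. S \<cdot> x" n]
      by (simp add: E_def app.diff_right app.scaleR_right)
    have "(\<lambda>n. exp (E n) \<cdot> x - r n *\<^sub>R (exp (E n) \<cdot> Ui \<cdot> x)) \<longlonglongrightarrow> exp D \<cdot> x - 1 *\<^sub>R (exp D \<cdot> Ui \<cdot> x)"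
      by (intro tendsto_intros expE r1)
    moreover have "(\<lambda>n. x - r n *\<^sub>R (U \<cdot> x)) \<longlonglongrightarrow> x - 1 *\<^sub>R (U \<cdot> x)"
      by (intro tendsto_intros r1)
    ultimately show "(exp D * (1 - Ui)) \<cdot> x = (1 - U) \<cdot> x"
      unfolding eq using LIMSEQ_unique by (fastforce simp: app.diff_right)
  qed
qed

end

end

lemma orthogonal_projection_exists:
  fixes S :: "'a::{real_inner,banach} set"
  assumes S: "subspace S" "closed S"
  obtains P :: "'a endo" where "\<And>x. P \<cdot> x \<in> S" "\<And>x. x \<in> S \<Longrightarrow> P \<cdot> x = x"
    "\<And>x y. y \<in> S \<Longrightarrow> inner (P \<cdot> x) y = inner x y"
proof -
  have "\<exists>s. s \<in> S \<and> (\<forall>y\<in>S. inner s y = inner x y)" for x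
  proof -
    obtain s t where "s \<in> S" "x = s + t" "\<And>y. y \<in> S \<Longrightarrow> inner t y = 0"
      by (rule ortho_decomp[OF S, of x]) auto
    then show ?thesis by (auto simp: inner_simps intro!: exI[of _ s])
  qed
  then obtain p where p: "\<And>x. p x \<in> S" "\<And>x y. y \<in> S \<Longrightarrow> inner (p x) y = inner x y" by metis
  have uniq: "p x = s" if "s \<in> S" "\<And>y. y \<in> S \<Longrightarrow> inner s y = inner x y" for x s
  proof -
    have "p x - s \<in> S" using p(1) that(1) S(1) subspace_diff by blast
    then have "inner (p x - s) (p x - s) = 0" using p(2) that(2) by (simp add: inner_diff_left)
    then show ?thesis by simp
  qed
  have "linear p"
  proof (rule linearI)
    show "p (x + y) = p x + p y" for x y
      by (rule uniq) (use S(1) p in \<open>auto simp: subspace_add inner_add_left\<close>)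
    show "p (c *\<^sub>R x) = c *\<^sub>R p x" for c x
      by (rule uniq) (use S(1) p in \<open>auto simp: subspace_scale\<close>)
  qed
  moreover have "norm (p x) \<le> 1 * norm x" for x
  proof (cases "p x = 0")
    case False
    have "norm (p x) * norm (p x) = inner x (p x)"
      using p(2)[OF p(1)] by (metis power2_norm_eq_inner power2_eq_square)
    also have "\<dots> \<le> norm x * norm (p x)" by (rule norm_cauchy_schwarz)
    finally show ?thesis using False by simp
  qed simp
  ultimately obtain P where P: "\<And>x. P \<cdot> x = p x" using endo_exists by metis
  show ?thesis by (rule that[of P]) (auto simp: P p uniq)
qed

text \<open>On the range of \<open>1 - Ui\<close> the limit \<open>D\<close> is a logarithm of -U,
  and the factor -1 is the exponential of \<open>pi *\<^sub>R J\<close>: hence the summand 1/2 in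
  \<open>A\<close>. The bound pi of \<open>D\<close> becomes
  \<open>norm (2 *\<^sub>R A - 1) \<le> 1\<close>, the form in which a spectrum in [0,1] is used
  later.\<close>

theorem unitary_log_exists:
  fixes J U Ui :: "'a::{real_inner,banach,perfect_space} endo"
  assumes J: "J * J = -1" "\<And>x y. inner (J \<cdot> x) y = - inner x (J \<cdot> y)"
    and U: "U * Ui = 1" "Ui * U = 1" "\<And>x y. inner (U \<cdot> x) y = inner x (Ui \<cdot> y)" "J * U = U * J"
  obtains A :: "'a endo" where "J * A = A * J" "\<And>x y. inner (A \<cdot> x) y = inner x (A \<cdot> y)"
    "norm (2 *\<^sub>R A - 1) \<le> 1" "\<And>x. A \<cdot> x = x \<Longrightarrow> x = 0" "exp ((2 * pi) *\<^sub>R (J * A)) = U"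
proof -
  note ctx = J U
  obtain D where D: "\<And>x. (\<lambda>n. log_diff U Ui (real n / real (Suc n)) \<cdot> x) \<longlonglongrightarrow> D \<cdot> x"
    "\<And>x. norm (D \<cdot> x) \<le> pi * norm x" "\<And>x. U \<cdot> x = x \<Longrightarrow> D \<cdot> x = 0"
    by (rule log_diff_tendsto[OF ctx]) (rule that, assumption+)
  note D2 = exp_limit_log_diff[OF ctx D(1)]
  define K where "K = {x. U \<cdot> x = x}"
  have K: "subspace K" "closed K"
    unfolding K_def subspace_def
    by (auto simp: app.zero_right app.add_right app.scaleR_right intro!: closed_Collect_eq continuous_intros linear_continuous_on app.bounded_linear_right)
  obtain P where P: "\<And>x. P \<cdot> x \<in> K" "\<And>x. x \<in> K \<Longrightarrow> P \<cdot> x = x"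
    "\<And>x y. y \<in> K \<Longrightarrow> inner (P \<cdot> x) y = inner x y"
    by (rule orthogonal_projection_exists[OF K]) (rule that, assumption+)
  have P_uniq: "P \<cdot> x = s" if "s \<in> K" "\<And>y. y \<in> K \<Longrightarrow> inner s y = inner x y" for x s
  proof -
    have "P \<cdot> x - s \<in> K" using P(1) that(1) K(1) subspace_diff by blast
    then have "inner (P \<cdot> x - s) (P \<cdot> x - s) = 0" using P(3) that(2) by (simp add: inner_diff_left)
    then show ?thesis by simp
  qed
  have Japp: "J \<cdot> J \<cdot> x = - x" "J \<cdot> U \<cdot> x = U \<cdot> J \<cdot> x" "J \<cdot> D \<cdot> x = D \<cdot> J \<cdot> x" for x
    using arg_cong[OF J(1), of "\<lambda>T. T \<cdot> x"] arg_cong[OF U(4), of "\<lambda>T. T \<cdot> x"] arg_cong[OF D2(1), of "\<lambda>T. T \<cdot> x"] by simp_all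
  have JK: "J \<cdot> x \<in> K" if "x \<in> K" for x using that Japp(2)[of x] by (simp add: K_def)
  have PJ: "P \<cdot> J \<cdot> x = J \<cdot> P \<cdot> x" for x
    by (rule P_uniq) (use P(1,3) JK in \<open>auto simp: J(2)\<close>)
  have P_sym: "inner (P \<cdot> x) y = inner x (P \<cdot> y)" for x y
    using P(3)[OF P(1), of x y] P(3)[OF P(1), of y x] by (simp add: inner_commute)
  have DK: "D \<cdot> x = 0" if "x \<in> K" for x using D(3) that by (simp add: K_def)
  have PD: "P \<cdot> D \<cdot> x = 0" for x
    by (rule P_uniq) (use K(1) in \<open>auto simp: subspace_0 D2(2) DK\<close>)
  \<comment> \<open>On the fixed space \<open>K\<close> of \<open>U\<close> the operator
    \<open>D\<close> is 0, so the first summand alone would give 1/2 there; subtracting half of the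
    projection onto \<open>K\<close> gives 0.\<close>
  define A where "A = (1/2) *\<^sub>R 1 - (1 / (2 * pi)) *\<^sub>R (J * D) - (1/2) *\<^sub>R P"
  have A_app: "A \<cdot> x = (1/2) *\<^sub>R x - (1 / (2 * pi)) *\<^sub>R (J \<cdot> D \<cdot> x) - (1/2) *\<^sub>R (P \<cdot> x)" for x
    by (simp add: A_def)
  have AK: "A \<cdot> x = 0" if "x \<in> K" for x using that by (simp add: A_app P(2) DK app.zero_right)
  have JA: "J * A = A * J"
    by (rule endo_eqI) (simp add: A_app app.diff_right app.scaleR_right PJ Japp(3))
  have A_sym: "inner (A \<cdot> x) y = inner x (A \<cdot> y)" for x y
  proof -
    have "inner (J \<cdot> D \<cdot> x) y = inner x (J \<cdot> D \<cdot> y)" by (simp add: J(2) D2(2) Japp(3))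
    then show ?thesis by (simp add: A_app inner_diff_left inner_diff_right P_sym)
  qed
  have nJ: "norm (J \<cdot> x) = norm x" for x
    by (simp add: norm_eq_sqrt_inner J(2) Japp(1))
  have A_norm: "norm (2 *\<^sub>R A - 1) \<le> 1"
  proof (rule norm_endo_bound)
    fix x
    \<comment> \<open>\<open>2 *\<^sub>R A - 1\<close> maps \<open>x\<close> to a vector orthogonal
      to \<open>K\<close>, of norm at most that of \<open>x - P \<cdot> x\<close> because of the
      bound pi, minus \<open>P \<cdot> x\<close>; Pythagoras adds the two.\<close>
    define y where "y = J \<cdot> D \<cdot> (x - P \<cdot> x)"
    have y: "J \<cdot> D \<cdot> x = y" by (simp add: y_def app.diff_right DK P(1) app.zero_right)
    have "(2 *\<^sub>R A - 1) \<cdot> x = - ((1 / pi) *\<^sub>R y) - P \<cdot> x"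
      by (simp add: A_app scaleR_right_diff_distrib y)
    moreover have orth: "inner y (P \<cdot> x) = 0"
      unfolding y_def J(2) D2(2) by (simp add: Japp(3)[symmetric] DK P(1) JK app.zero_right)
    ultimately have "(norm ((2 *\<^sub>R A - 1) \<cdot> x))\<^sup>2 = (norm ((1 / pi) *\<^sub>R y))\<^sup>2 + (norm (P \<cdot> x))\<^sup>2"
      using norm_add_Pythagorean[of "(1 / pi) *\<^sub>R y" "P \<cdot> x"] norm_minus_cancel[of "(1 / pi) *\<^sub>R y + P \<cdot> x"]
      by (simp add: orthogonal_def)
    moreover have "norm ((1 / pi) *\<^sub>R y) \<le> norm (x - P \<cdot> x)"
      using D(2)[of "x - P \<cdot> x"] by (simp add: y_def nJ divide_le_eq mult.commute)
    then have "(norm ((1 / pi) *\<^sub>R y))\<^sup>2 \<le> (norm (x - P \<cdot> x))\<^sup>2" by (rule power_mono) simp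
    moreover have "(norm (x - P \<cdot> x))\<^sup>2 + (norm (P \<cdot> x))\<^sup>2 = (norm x)\<^sup>2"
      using P(3)[OF P(1), of x x] norm_add_Pythagorean[of "x - P \<cdot> x" "P \<cdot> x"]
      by (simp add: orthogonal_def inner_diff_left)
    ultimately have "(norm ((2 *\<^sub>R A - 1) \<cdot> x))\<^sup>2 \<le> (norm x)\<^sup>2" by linarith
    from power2_le_imp_le[OF this norm_ge_zero]
    show "norm ((2 *\<^sub>R A - 1) \<cdot> x) \<le> 1 * norm x" by simp
  qed simp
  define M where "M = (2 * pi) *\<^sub>R (J * A)"
  have exp_fix: "exp Q \<cdot> x = x" if "Q \<cdot> x = 0" for Q :: "'a endo" and x
  proof -
    obtain d where "exp Q - 1 = d * Q" using exp_minus_one_factor by metis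
    from arg_cong[OF this, of "\<lambda>T. T \<cdot> x"] that show ?thesis by (simp add: app.zero_right)
  qed
  have M_eq: "M = (cstr J (pi * \<i>) + D) + - (pi *\<^sub>R (J * P))"
    by (rule endo_eqI) (simp add: M_def A_app cstr_def app.diff_right app.scaleR_right app.minus_right Japp
        scaleR_right_diff_distrib scaleR_add_right)
  have "exp M = exp (cstr J (pi * \<i>) + D) * exp (- (pi *\<^sub>R (J * P)))"
    unfolding M_eq
  proof (rule exp_add_commuting, rule endo_eqI)
    show "((cstr J (pi * \<i>) + D) * - (pi *\<^sub>R (J * P))) \<cdot> x = (- (pi *\<^sub>R (J * P)) * (cstr J (pi * \<i>) + D)) \<cdot> x" for x
      by (simp add: cstr_def app.add_right app.scaleR_right app.minus_right PJ PD JK DK P(1) app.zero_right)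
  qed
  also have "exp (cstr J (pi * \<i>) + D) = - exp D"
  proof -
    have "cstr J (pi * \<i>) * D = D * cstr J (pi * \<i>)" by (simp add: cstr_def D2(1))
    then have "exp (cstr J (pi * \<i>) + D) = exp (cstr J (pi * \<i>)) * exp D" by (rule exp_add_commuting)
    then show ?thesis by (simp add: exp_cstr[OF J] cstr_neg_1[OF J] exp_pi_i mult.commute)
  qed
  finally have expM: "exp M = - exp D * exp (- (pi *\<^sub>R (J * P)))" .
  \<comment> \<open>\<open>exp M\<close> and \<open>U\<close> are compared on the fixed space and on
    the range of \<open>1 - Ui\<close>. Together these are total, since a vector orthogonal to that
    range is fixed by \<open>U\<close>.\<close>
  define Y where "Y = {x. exp M \<cdot> x = U \<cdot> x}"
  have Y: "subspace Y" "closed Y"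
    unfolding Y_def subspace_def
    by (auto simp: app.zero_right app.add_right app.scaleR_right intro!: closed_Collect_eq continuous_intros linear_continuous_on app.bounded_linear_right)
  have KY: "x \<in> Y" if "x \<in> K" for x
    using that AK[OF that] exp_fix[of M x] by (simp add: Y_def K_def M_def app.zero_right)
  have UiY: "x - Ui \<cdot> x \<in> Y" for x
  proof -
    have UUx: "U \<cdot> Ui \<cdot> x = x" using arg_cong[OF U(1), of "\<lambda>T. T \<cdot> x"] by simp
    have "P \<cdot> (x - Ui \<cdot> x) = 0"
    proof (rule P_uniq)
      show "inner 0 y = inner (x - Ui \<cdot> x) y" if "y \<in> K" for y
        using that U(3)[of y x] by (simp add: K_def inner_diff_left inner_diff_right inner_commute)
    qed (use K(1) subspace_0 in blast)
    then have "exp M \<cdot> (x - Ui \<cdot> x) = - (exp D \<cdot> (x - Ui \<cdot> x))"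
      unfolding expM by (simp add: exp_fix app.zero_right)
    also have "\<dots> = - (x - U \<cdot> x)"
      using arg_cong[OF D2(3), of "\<lambda>T. T \<cdot> x"] by simp
    also have "\<dots> = U \<cdot> (x - Ui \<cdot> x)" by (simp add: app.diff_right UUx)
    finally show ?thesis by (simp add: Y_def)
  qed
  have all: "x \<in> Y" for x
  proof (rule closed_subspace_eq_UNIV[OF Y])
    fix t assume t: "\<And>y. y \<in> Y \<Longrightarrow> inner t y = 0"
    have "inner (t - U \<cdot> t) x = 0" for x
      using t[OF UiY, of x] by (simp add: inner_diff_left inner_diff_right U(3))
    from this[of "t - U \<cdot> t"] have "t \<in> K" by (simp add: K_def)
    then show "t = 0" using t[OF KY, of t] by simp
  qed
  have expU: "exp M = U" by (rule endo_eqI) (use all in \<open>simp add: Y_def\<close>)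
  \<comment> \<open>On such an \<open>x\<close> the exponent \<open>M\<close> acts as
    \<open>2 * pi\<close> times \<open>J\<close>, whose exponential is 1. So \<open>U\<close> fixes
    \<open>x\<close>, and on the fixed space \<open>A\<close> is 0.\<close>
  have "x = 0" if "A \<cdot> x = x" for x
  proof -
    have "M \<cdot> x = cstr J (2 * pi * \<i>) \<cdot> x" by (simp add: M_def that cstr_def)
    moreover have "M * cstr J (2 * pi * \<i>) = cstr J (2 * pi * \<i>) * M"
      by (simp add: M_def cstr_def JA[symmetric] mult.assoc)
    ultimately have "exp (M - cstr J (2 * pi * \<i>)) \<cdot> x = x" "(M - cstr J (2 * pi * \<i>)) * cstr J (2 * pi * \<i>) = cstr J (2 * pi * \<i>) * (M - cstr J (2 * pi * \<i>))"
      by (auto intro!: exp_fix simp: algebra_simps)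
    then have "exp M \<cdot> x = x"
      using exp_add_commuting[of "M - cstr J (2 * pi * \<i>)" "cstr J (2 * pi * \<i>)"]
      by (simp add: exp_cstr[OF J] cstr_1[OF J])
    then have "x \<in> K" by (simp add: expU K_def)
    then show ?thesis using AK that by simp
  qed
  then show ?thesis using that JA A_sym A_norm expU unfolding M_def by blast
qed

section \<open>Analysis on the interval and the square: completeness, total families, primitives and
  traces\<close>

section \<open>The Hilbert space structure of \<open>L\<^sup>2\<close>\<close>

lemma measurable_cnj [measurable]: "cnj \<in> borel_measurable borel"
  by (intro borel_measurable_continuous_onI continuous_intros)

lemma square_integrable_mult_integrable:
  assumes "square_integrable f" "square_integrable g"
  shows "integrable cube (\<lambda>x. f x * g x)"
proof -
  note [measurable] = assms[THEN square_integrable_measurable]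
  have "integrable cube (\<lambda>x. (cmod (f x))\<^sup>2 + (cmod (g x))\<^sup>2)"
    using assms by (auto simp: square_integrable_def)
  then show ?thesis
  proof (rule Bochner_Integration.integrable_bound)
    have "cmod (f x) * cmod (g x) \<le> (cmod (f x))\<^sup>2 + (cmod (g x))\<^sup>2" for x
      using sum_squares_bound[of "cmod (f x)" "cmod (g x)"] mult_nonneg_nonneg[OF norm_ge_zero[of "f x"] norm_ge_zero[of "g x"]]
      by linarith
    then show "AE x in cube. norm (f x * g x) \<le> norm ((cmod (f x))\<^sup>2 + (cmod (g x))\<^sup>2)"
      by (intro AE_I2) (simp add: norm_mult)
  qed measurable
qed

lemma square_integrable_cnj: "square_integrable f \<Longrightarrow> square_integrable (\<lambda>x. cnj (f x))"
  unfolding square_integrable_def by (auto simp: measurable_compose[OF _ measurable_cnj])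

lemma square_integrable_const: "square_integrable (\<lambda>_. c)"
  by (rule square_integrable_continuous) simp

lemma square_integrable_integrable:
  assumes "square_integrable f" shows "integrable cube f"
  using square_integrable_mult_integrable[OF assms square_integrable_const[of 1]] by simp

lemma square_integrable_mult_cnj:
  "square_integrable f \<Longrightarrow> square_integrable g \<Longrightarrow> integrable cube (\<lambda>x. f x * cnj (g x))"
  by (intro square_integrable_mult_integrable square_integrable_cnj)

lemma represents_square_integrable: "represents F f \<Longrightarrow> square_integrable F"
  by transfer auto

lemma represents_add: "represents F f \<Longrightarrow> represents G g \<Longrightarrow> represents (\<lambda>x. F x + G x) (f + g)"
  by transfer (auto simp: square_integrable_add elim: AE_mp)

lemma represents_diff: "represents F f \<Longrightarrow> represents G g \<Longrightarrow> represents (\<lambda>x. F x - G x) (f - g)"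
  by transfer (auto simp: square_integrable_diff elim: AE_mp)

lemma represents_zero: "represents (\<lambda>_. 0) 0"
  by transfer (auto simp: square_integrable_zero)

lemma represents_AE_cong:
  assumes "represents F f" "square_integrable G" "AE x in cube. F x = G x"
  shows "represents G f"
  using assms by transfer (auto elim: AE_mp)

lemma represents_unique_AE: "represents F f \<Longrightarrow> represents G f \<Longrightarrow> AE x in cube. F x = G x"
  by transfer (auto elim: AE_mp)

lemma represents_eq: "represents F f \<Longrightarrow> represents F g \<Longrightarrow> f = g"
  by transfer (auto elim: AE_mp)

lemma cinner_add_left: "cinner (f + g) h = cinner f h + cinner g h"
proof -
  obtain F G H where *: "represents F f" "represents G g" "represents H h"
    using representative_exists by metis
  then show ?thesis
    by (simp add: cinner_eq[OF represents_add[OF *(1,2)] *(3)] cinner_eq[OF *(1,3)] cinner_eq[OF *(2,3)] distrib_right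
        square_integrable_mult_cnj represents_square_integrable)
qed

lemma cinner_scaleC_left: "cinner (c *\<^sub>C f) h = c * cinner f h"
proof -
  obtain F H where *: "represents F f" "represents H h"
    using representative_exists by metis
  then show ?thesis
    by (simp add: cinner_eq[OF represents_scaleC[OF *(1)] *(2)] cinner_eq[OF *] mult.assoc)
qed

lemma cinner_commute: "cinner g f = cnj (cinner f g)"
proof -
  obtain F G where *: "represents F f" "represents G g"
    using representative_exists by metis
  show ?thesis
    by (simp add: cinner_eq[OF *] cinner_eq[OF *(2,1)] mult.commute flip: Bochner_Integration.integral_cnj)
qed

lemma cinner_add_right: "cinner h (f + g) = cinner h f + cinner h g"
  by (subst (1 2 3) cinner_commute) (simp add: cinner_add_left)

lemma cinner_scaleC_right: "cinner h (c *\<^sub>C f) = cnj c * cinner h f"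
  by (subst (1 2) cinner_commute) (simp add: cinner_scaleC_left)

lemma cinner_self:
  assumes "represents F f"
  shows "cinner f f = of_real (LINT x|cube. (cmod (F x))\<^sup>2)"
proof -
  have "(LINT x|cube. F x * cnj (F x)) = (LINT x|cube. of_real ((cmod (F x))\<^sup>2))"
    by (intro Bochner_Integration.integral_cong) (auto simp: complex_norm_square[symmetric] simp del: of_real_power)
  then show ?thesis by (simp add: cinner_eq[OF assms assms] del: of_real_power)
qed

lemma scaleC_add_right: "c *\<^sub>C (f + g) = c *\<^sub>C f + c *\<^sub>C g"
  by transfer (auto simp: algebra_simps intro!: square_integrable_add square_integrable_scale)

lemma scaleC_add_left: "(c + d) *\<^sub>C f = c *\<^sub>C f + d *\<^sub>C f"
  by transfer (auto simp: algebra_simps intro!: square_integrable_add square_integrable_scale)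

text \<open>Passing to the real part of \<open>cinner\<close> loses nothing: the complex structure
  returns as the operator \<open>imag\<close>, which plays the part of \<open>J\<close> in the
  theory above.\<close>

instantiation cube_L2 :: (euclidean_space) real_inner
begin
definition scaleR_cube_L2 :: "real \<Rightarrow> 'a cube_L2 \<Rightarrow> 'a cube_L2" where "scaleR_cube_L2 r f = complex_of_real r *\<^sub>C f"
definition inner_cube_L2 :: "'a cube_L2 \<Rightarrow> 'a cube_L2 \<Rightarrow> real" where "inner_cube_L2 f g = Re (cinner f g)"
definition norm_cube_L2 :: "'a cube_L2 \<Rightarrow> real" where "norm_cube_L2 f = sqrt (inner f f)"
definition sgn_cube_L2 :: "'a cube_L2 \<Rightarrow> 'a cube_L2" where "sgn_cube_L2 f = scaleR (inverse (norm f)) f"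
definition dist_cube_L2 :: "'a cube_L2 \<Rightarrow> 'a cube_L2 \<Rightarrow> real" where "dist_cube_L2 f g = norm (f - g)"
definition [code del]: "(uniformity :: ('a cube_L2 \<times> 'a cube_L2) filter) = (INF e\<in>{0 <..}. principal {(x, y). dist x y < e})"
definition [code del]: "open (S :: 'a cube_L2 set) = (\<forall>x\<in>S. \<forall>\<^sub>F (x', y) in uniformity. x' = x \<longrightarrow> y \<in> S)"
instance
proof
  fix x y z :: "'a cube_L2" and a b :: real and S :: "'a cube_L2 set"
  show "a *\<^sub>R (x + y) = a *\<^sub>R x + a *\<^sub>R y" "(a + b) *\<^sub>R x = a *\<^sub>R x + b *\<^sub>R x" "a *\<^sub>R b *\<^sub>R x = (a * b) *\<^sub>R x" "1 *\<^sub>R x = x"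
    by (simp_all add: scaleR_cube_L2_def scaleC_add_right scaleC_add_left scaleC_scaleC scaleC_one)
  show "sgn x = inverse (norm x) *\<^sub>R x" "dist x y = norm (x - y)" "norm x = sqrt (inner x x)"
    "(uniformity :: ('a cube_L2 \<times> 'a cube_L2) filter) = (INF e\<in>{0 <..}. principal {(x, y). dist x y < e})"
    "open S = (\<forall>x\<in>S. \<forall>\<^sub>F (x', y) in uniformity. x' = x \<longrightarrow> y \<in> S)"
    by (simp_all only: sgn_cube_L2_def dist_cube_L2_def norm_cube_L2_def uniformity_cube_L2_def open_cube_L2_def)
  show "inner x y = inner y x"
    unfolding inner_cube_L2_def by (subst cinner_commute) simp
  show "inner (x + y) z = inner x z + inner y z" "inner (a *\<^sub>R x) y = a * inner x y"
    by (simp_all add: inner_cube_L2_def cinner_add_left cinner_scaleC_left scaleR_cube_L2_def)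
  obtain F where F: "represents F x" using representative_exists by metis
  have xx: "inner x x = (LINT t|cube. (cmod (F t))\<^sup>2)"
    by (simp add: inner_cube_L2_def cinner_self[OF F])
  show "0 \<le> inner x x" unfolding xx by (rule integral_nonneg_AE) auto
  show "inner x x = 0 \<longleftrightarrow> x = 0"
  proof
    assume "inner x x = 0"
    then have "AE t in cube. (cmod (F t))\<^sup>2 = 0"
      unfolding xx using represents_square_integrable[OF F]
      by (subst (asm) integral_nonneg_eq_0_iff_AE) (auto simp: square_integrable_def)
    then have "AE t in cube. F t = 0" by simp
    then have "represents (\<lambda>_. 0) x" by (rule represents_AE_cong[OF F square_integrable_zero])
    then show "x = 0" using represents_eq represents_zero by blast
  next
    assume "x = 0"
    then have "represents (\<lambda>_. 0) x" using represents_zero by simp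
    then show "inner x x = 0" by (simp add: inner_cube_L2_def cinner_self)
  qed
qed
end

lemma norm_cube_L2_power2:
  assumes "represents F f"
  shows "(norm f)\<^sup>2 = (LINT x|cube. (cmod (F x))\<^sup>2)"
  by (simp add: power2_norm_eq_inner inner_cube_L2_def cinner_self[OF assms])

lemma nn_integral_eq_norm:
  assumes "represents F f"
  shows "(\<integral>\<^sup>+x. ennreal ((cmod (F x))\<^sup>2) \<partial>cube) = ennreal ((norm f)\<^sup>2)"
  unfolding norm_cube_L2_power2[OF assms] using represents_square_integrable[OF assms]
  by (intro nn_integral_eq_integral) (auto simp: square_integrable_def)

lemma represents_exists_of_nn_integral:
  assumes "F \<in> borel_measurable cube" "(\<integral>\<^sup>+x. ennreal ((cmod (F x))\<^sup>2) \<partial>cube) \<le> ennreal (b\<^sup>2)" "0 \<le> b"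
  obtains f where "represents F f" "norm f \<le> b"
proof -
  have "integrable cube (\<lambda>x. (cmod (F x))\<^sup>2)"
    using assms(1,2) by (intro integrableI_bounded) (auto intro: le_less_trans ennreal_less_top)
  then have "square_integrable F" using assms(1) by (simp add: square_integrable_def)
  then obtain f where f: "represents F f" using represents_exists by blast
  have "(norm f)\<^sup>2 \<le> b\<^sup>2" using assms(2) unfolding nn_integral_eq_norm[OF f] by simp
  then have "norm f \<le> b" using assms(3) by (rule power2_le_imp_le)
  then show ?thesis using that f by blast
qed

text \<open>Riesz-Fischer: a subsequence with steps at most \<open>1 / 2 ^ k\<close> has absolutely
  summable increments at almost every point, and Fatou's lemma turns the pointwise limit into a
  limit in norm.\<close>

instance cube_L2 :: (euclidean_space) banach
proof
  fix X :: "nat \<Rightarrow> 'a cube_L2" assume X: "Cauchy X"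
  have "\<exists>r::nat \<Rightarrow> nat. strict_mono r \<and> (\<forall>k. \<forall>n\<ge>r k. norm (X n - X (r k)) \<le> 1 / 2 ^ k)"
  proof -
    have "\<exists>M. \<forall>m\<ge>M. \<forall>n\<ge>M. norm (X m - X n) < 1 / 2 ^ k" for k :: nat
      using CauchyD[OF X, of "1 / 2 ^ k"] by simp
    then obtain M where M: "\<And>k m n. m \<ge> M k \<Longrightarrow> n \<ge> M k \<Longrightarrow> norm (X m - X n) < 1 / 2 ^ k" by metis
    define r where "r = rec_nat (M 0) (\<lambda>k s. max (Suc s) (M (Suc k)))"
    have r: "r 0 = M 0" "r (Suc k) = max (Suc (r k)) (M (Suc k))" for k by (simp_all add: r_def)
    have "strict_mono r" by (intro strict_monoI_Suc) (simp add: r)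
    moreover have "M k \<le> r k" for k by (cases k) (simp_all add: r)
    ultimately show ?thesis using M by (intro exI[of _ r]) (meson less_imp_le order_trans order_refl)
  qed
  then obtain r where r: "strict_mono r" "\<And>k n. n \<ge> r k \<Longrightarrow> norm (X n - X (r k)) \<le> 1 / 2 ^ k" by blast
  have "\<forall>k. \<exists>F. represents F (X (r k))" using representative_exists by blast
  then obtain G where G: "\<And>k. represents (G k) (X (r k))" by metis
  note [measurable] = square_integrable_measurable[OF represents_square_integrable[OF G]]
  have step: "norm (X (r n) - X (r k)) \<le> 1 / 2 ^ k" if "k \<le> n" for n k
    using r(2)[of k "r n"] that r(1) by (simp add: strict_mono_leD)
  define \<mu> where "\<mu> = emeasure (cube :: 'a measure) (space cube)"
  have \<mu>: "\<mu> < \<infinity>" unfolding \<mu>_def by (rule emeasure_cube)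
  have d: "(\<integral>\<^sup>+x. ennreal (cmod (G (Suc k) x - G k x)) \<partial>cube) \<le> ennreal ((1/2)^k) * (\<mu> + 1)" for k
  proof -
    \<comment> \<open>By cases whether \<open>cmod z\<close> is at most \<open>(1/2)^k\<close>. It
      trades the integral of the modulus for that of its square, and the squared step (1/4)^k times
      2^k leaves the summable (1/2)^k.\<close>
    have "ennreal (cmod z) \<le> ennreal ((1/2)^k) + ennreal (2 ^ k) * ennreal ((cmod z)\<^sup>2)" for z
    proof -
      define p where "p = (1/2::real)^k"
      have p: "p * 2 ^ k = 1" "p > 0" by (simp_all add: p_def power_mult_distrib[symmetric])
      have "cmod z \<le> p + 2 ^ k * (cmod z)\<^sup>2"
      proof (cases "cmod z \<le> p")
        case False
        then have "1 \<le> 2 ^ k * cmod z" using p mult_left_mono[of p "cmod z" "2^k"] by (simp add: mult.commute)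
        then have "1 * cmod z \<le> 2 ^ k * cmod z * cmod z" by (intro mult_right_mono) auto
        then show ?thesis using p by (simp add: power2_eq_square mult.assoc)
      qed (simp add: add_increasing2)
      then show ?thesis by (simp add: p_def ennreal_mult[symmetric] ennreal_plus[symmetric] del: ennreal_plus)
    qed
    then have "(\<integral>\<^sup>+x. ennreal (cmod (G (Suc k) x - G k x)) \<partial>cube) \<le>
        (\<integral>\<^sup>+x. ennreal ((1/2)^k) + ennreal (2 ^ k) * ennreal ((cmod (G (Suc k) x - G k x))\<^sup>2) \<partial>cube)"
      by (intro nn_integral_mono) auto
    also have "\<dots> = ennreal ((1/2)^k) * \<mu> + ennreal (2 ^ k) * ennreal ((norm (X (r (Suc k)) - X (r k)))\<^sup>2)"
      by (simp add: nn_integral_add nn_integral_cmult nn_integral_eq_norm[OF represents_diff[OF G G]] \<mu>_def)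
    also have "\<dots> \<le> ennreal ((1/2)^k) * \<mu> + ennreal (2 ^ k) * ennreal ((1 / 2 ^ k)\<^sup>2)"
      by (intro add_left_mono mult_left_mono ennreal_leI power_mono step) auto
    also have "ennreal (2 ^ k) * ennreal ((1 / 2 ^ k)\<^sup>2) = ennreal ((1/2)^k)"
      by (subst ennreal_mult[symmetric]) (auto simp: power2_eq_square power_one_over)
    finally show ?thesis by (simp add: distrib_left)
  qed
  have "(\<integral>\<^sup>+x. (\<Sum>k. ennreal (cmod (G (Suc k) x - G k x))) \<partial>cube) = (\<Sum>k. \<integral>\<^sup>+x. ennreal (cmod (G (Suc k) x - G k x)) \<partial>cube)"
    by (rule nn_integral_suminf) measurable
  also have "\<dots> \<le> (\<Sum>k. ennreal ((1/2)^k) * (\<mu> + 1))"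
    by (intro suminf_le d) auto
  also have "\<dots> = (\<Sum>k. ennreal ((1/2)^k)) * (\<mu> + 1)" by simp
  also have "(\<Sum>k. ennreal ((1/2)^k)) = ennreal (\<Sum>k. (1/2)^k)"
    by (intro suminf_ennreal2) (auto simp: summable_geometric)
  finally have "(\<integral>\<^sup>+x. (\<Sum>k. ennreal (cmod (G (Suc k) x - G k x))) \<partial>cube) \<noteq> \<infinity>"
    using \<mu> by (auto simp: ennreal_mult_eq_top_iff top_unique)
  then have "AE x in cube. (\<Sum>k. ennreal (cmod (G (Suc k) x - G k x))) \<noteq> \<infinity>"
    by (intro nn_integral_PInf_AE) measurable
  then have conv: "AE x in cube. (\<lambda>n. G n x) \<longlonglongrightarrow> lim (\<lambda>n. G n x)"
  proof (rule AE_mp, intro AE_I2 impI)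
    fix x assume "(\<Sum>k. ennreal (cmod (G (Suc k) x - G k x))) \<noteq> \<infinity>"
    then have "summable (\<lambda>k. cmod (G (Suc k) x - G k x))"
      by (intro summable_suminf_not_top) auto
    then have "summable (\<lambda>k. G (Suc k) x - G k x)" by (rule summable_norm_cancel)
    then have "convergent (\<lambda>n. \<Sum>k<n. G (Suc k) x - G k x)" by (simp only: summable_iff_convergent)
    then have "convergent (\<lambda>n. G n x)"
      unfolding sum_lessThan_telescope[of "\<lambda>n. G n x"] by (simp only: convergent_diff_const_right_iff)
    then show "(\<lambda>n. G n x) \<longlonglongrightarrow> lim (\<lambda>n. G n x)" by (simp add: convergent_LIMSEQ_iff)
  qed
  define L where "L = (\<lambda>x. lim (\<lambda>n. G n x))"
  have [measurable]: "L \<in> borel_measurable cube" unfolding L_def by measurable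
  have fatou: "(\<integral>\<^sup>+x. ennreal ((cmod (L x - G k x))\<^sup>2) \<partial>cube) \<le> ennreal ((1 / 2 ^ k)\<^sup>2)" for k
  proof -
    have "(\<integral>\<^sup>+x. ennreal ((cmod (L x - G k x))\<^sup>2) \<partial>cube) = (\<integral>\<^sup>+x. liminf (\<lambda>n. ennreal ((cmod (G n x - G k x))\<^sup>2)) \<partial>cube)"
    proof (rule nn_integral_cong_AE, rule AE_mp[OF conv], intro AE_I2 impI)
      fix x assume "(\<lambda>n. G n x) \<longlonglongrightarrow> lim (\<lambda>n. G n x)"
      then have "(\<lambda>n. ennreal ((cmod (G n x - G k x))\<^sup>2)) \<longlonglongrightarrow> ennreal ((cmod (L x - G k x))\<^sup>2)"
        unfolding L_def by (intro tendsto_intros)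
      from lim_imp_Liminf[OF _ this]
      show "ennreal ((cmod (L x - G k x))\<^sup>2) = liminf (\<lambda>n. ennreal ((cmod (G n x - G k x))\<^sup>2))" by simp
    qed
    also have "\<dots> \<le> liminf (\<lambda>n. \<integral>\<^sup>+x. ennreal ((cmod (G n x - G k x))\<^sup>2) \<partial>cube)"
      by (rule nn_integral_liminf) measurable
    also have "\<dots> \<le> limsup (\<lambda>n. \<integral>\<^sup>+x. ennreal ((cmod (G n x - G k x))\<^sup>2) \<partial>cube)"
      by (rule Liminf_le_Limsup) simp
    also have "\<dots> \<le> ennreal ((1 / 2 ^ k)\<^sup>2)"
    proof (rule Limsup_bounded)
      show "\<forall>\<^sub>F n in sequentially. (\<integral>\<^sup>+x. ennreal ((cmod (G n x - G k x))\<^sup>2) \<partial>cube) \<le> ennreal ((1 / 2 ^ k)\<^sup>2)"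
        using eventually_ge_at_top[of k]
        by eventually_elim (unfold nn_integral_eq_norm[OF represents_diff[OF G G]], intro ennreal_leI power_mono step, auto)
    qed
    finally show ?thesis .
  qed
  have "\<exists>h. represents (\<lambda>x. L x - G k x) h \<and> norm h \<le> 1 / 2 ^ k" for k
  proof -
    have m: "(\<lambda>x. L x - G k x) \<in> borel_measurable cube" by measurable
    show ?thesis
      by (rule represents_exists_of_nn_integral[OF m fatou[of k]]) auto
  qed
  then obtain h where h: "\<And>k. represents (\<lambda>x. L x - G k x) (h k)" "\<And>k. norm (h k) \<le> 1 / 2 ^ k" by metis
  define l where "l = h 0 + X (r 0)"
  have l: "represents L l" unfolding l_def using represents_add[OF h(1)[of 0] G[of 0]] by simp
  have hk: "h k = l - X (r k)" for k
    using represents_eq[OF h(1) represents_diff[OF l G]] by simp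
  have "norm (X (r k) - l) \<le> (1/2) ^ k" for k
    using h(2)[of k] by (simp add: hk norm_minus_commute power_one_over)
  then have "(\<lambda>k. X (r k) - l) \<longlonglongrightarrow> 0"
    by (intro Lim_null_comparison[OF always_eventually LIMSEQ_power_zero[of "1/2"]]) auto
  then have "(X \<circ> r) \<longlonglongrightarrow> l" by (simp add: LIM_zero_iff o_def)
  then have "X \<longlonglongrightarrow> l" by (rule Cauchy_converges_subseq[OF X r(1)])
  then show "convergent X" by (auto simp: convergent_def)
qed

lemma cube_L2_one:
  obtains v :: "'a::euclidean_space cube_L2" where "v \<noteq> 0"
proof -
  obtain v :: "'a cube_L2" where v: "represents (\<lambda>_. 1) v" using represents_exists[OF square_integrable_const] by blast
  have "(norm v)\<^sup>2 = measure (cube :: 'a measure) (space cube)"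
    unfolding norm_cube_L2_power2[OF v] by simp
  also have "\<dots> = measure lborel (cbox 0 (One :: 'a))"
    by (subst measure_restrict_space) (auto simp: space_restrict_space)
  also have "\<dots> = 1" by (subst measure_lborel_cbox_eq) auto
  finally have "v \<noteq> 0" by auto
  then show ?thesis by (rule that)
qed

text \<open>Every ball contains a second point because the space is not zero; this instance makes
  the operators on the space a unital Banach algebra.\<close>

instance cube_L2 :: (euclidean_space) perfect_space
proof
  fix x :: "'a cube_L2"
  show "\<not> open {x}"
  proof
    assume "open {x}"
    then obtain e where e: "e > 0" "ball x e \<subseteq> {x}" by (meson open_contains_ball singletonI)
    obtain v :: "'a cube_L2" where v: "v \<noteq> 0" by (rule cube_L2_one)
    define y where "y = x + (e / (2 * norm v)) *\<^sub>R v"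
    have "dist x y = e / 2" using v e(1) by (simp add: y_def dist_norm)
    then have "y \<in> ball x e" using e(1) by simp
    then have "y = x" using e(2) by blast
    then show False using \<open>dist x y = e/2\<close> e(1) by simp
  qed
qed

section \<open>The unit square as a product\<close>

text \<open>Otherwise simplification rewrites \<^term>\<open>cube :: real measure\<close> to a restriction to \<open>{0..1}\<close>.\<close>

declare box_real [simp del] Basis_real_def [simp del]

lemma cbox_0_One_real: "cbox 0 (One :: real) = {0..1}"
  by (simp add: box_real Basis_real_def)

lemma cbox_0_One_prod: "cbox 0 (One :: real \<times> real) = {0..1} \<times> {0..1}"
proof -
  have "(One :: real \<times> real) = (1, 1)"
    by (simp add: Basis_prod_def Basis_real_def sum.union_disjoint sum.reindex inj_on_def zero_prod_def)
  then show ?thesis by (simp add: zero_prod_def cbox_Pair_eq box_real)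
qed

lemma space_cube: "space (cube :: 'a::euclidean_space measure) = cbox 0 One"
  by (simp add: space_restrict_space)

lemma space_cube_real: "space (cube :: real measure) = {0..1}"
  by (simp add: space_cube cbox_0_One_real)

lemma emeasure_cube_eq_1: "emeasure (cube :: 'a::euclidean_space measure) (space cube) = 1"
  by (simp add: space_restrict_space emeasure_restrict_space emeasure_lborel_cbox_eq)

interpretation unit_interval: finite_measure "cube :: real measure"
  by (rule finite_measureI, rule less_imp_neq, rule emeasure_cube)

interpretation unit_square: pair_sigma_finite "cube :: real measure" "cube :: real measure" ..

text \<open>Both measures live on the same sigma-algebra and agree on rectangles. All Fubini
  arguments on the square pass through this identity.\<close>

lemma cube_real_prod: "(cube :: (real \<times> real) measure) = cube \<Otimes>\<^sub>M cube"
proof (rule pair_measure_eqI[symmetric])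
  have sp: "space (cube :: (real \<times> real) measure) = {0..1} \<times> {0..1}"
    by (rule trans[OF space_cube cbox_0_One_prod])
  show sf: "sigma_finite_measure (cube :: real measure)" "sigma_finite_measure (cube :: real measure)"
    by (rule unit_interval.sigma_finite_measure_axioms)+
  have ab: "A \<times> B \<in> sets (cube :: (real \<times> real) measure)" "A \<in> sets borel" "B \<in> sets borel" "A \<subseteq> {0..1}" "B \<subseteq> {0..1}"
    if "A \<in> sets (cube :: real measure)" "B \<in> sets (cube :: real measure)" for A B
  proof -
    show *: "A \<in> sets borel" "B \<in> sets borel" "A \<subseteq> {0..1}" "B \<subseteq> {0..1}"
      using that by (auto simp: sets_restrict_space_iff cbox_0_One_real)
    then have "A \<times> B \<in> sets (borel :: (real \<times> real) measure)"
      by (simp add: borel_prod[symmetric])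
    moreover have "A \<times> B \<subseteq> cbox 0 One" using * sp by (auto simp: space_cube)
    ultimately show "A \<times> B \<in> sets (cube :: (real \<times> real) measure)"
      by (simp add: sets_restrict_space_iff)
  qed
  show "sets (cube \<Otimes>\<^sub>M cube) = sets (cube :: (real \<times> real) measure)"
  proof
    show "sets (cube \<Otimes>\<^sub>M cube) \<subseteq> sets (cube :: (real \<times> real) measure)"
      unfolding sets_pair_measure
    proof (rule sets.sigma_sets_subset')
      show "space cube \<times> space cube \<in> sets (cube :: (real \<times> real) measure)" by (intro ab(1) sets.top)
    qed (use ab(1) in auto)
    show "sets (cube :: (real \<times> real) measure) \<subseteq> sets (cube \<Otimes>\<^sub>M cube)"
    proof
      fix X assume X: "X \<in> sets (cube :: (real \<times> real) measure)"
      then have Xb: "X \<in> sets borel" "X \<subseteq> cbox 0 One" by (auto simp: sets_restrict_space_iff)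
      have "(\<lambda>x. x) \<in> (cube :: real measure) \<rightarrow>\<^sub>M borel"
        by (intro measurable_restrict_space1) simp
      then have "fst \<in> cube \<Otimes>\<^sub>M (cube :: real measure) \<rightarrow>\<^sub>M (borel :: real measure)" "snd \<in> (cube :: real measure) \<Otimes>\<^sub>M cube \<rightarrow>\<^sub>M (borel :: real measure)"
        using measurable_compose[OF measurable_fst] measurable_compose[OF measurable_snd] by blast+
      then have "(\<lambda>p. (fst p, snd p)) \<in> cube \<Otimes>\<^sub>M cube \<rightarrow>\<^sub>M (borel :: real measure) \<Otimes>\<^sub>M (borel :: real measure)"
        by (rule measurable_Pair)
      then have "(\<lambda>p. p) \<in> cube \<Otimes>\<^sub>M cube \<rightarrow>\<^sub>M (borel :: (real \<times> real) measure)"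
        by (simp add: borel_prod)
      from measurable_sets[OF this Xb(1)]
      have "X \<inter> space (cube \<Otimes>\<^sub>M cube) \<in> sets (cube \<Otimes>\<^sub>M cube :: (real \<times> real) measure)" by simp
      moreover have "X \<inter> space (cube \<Otimes>\<^sub>M cube) = X"
        using Xb(2) sp by (auto simp: space_pair_measure space_cube cbox_0_One_real)
      ultimately show "X \<in> sets (cube \<Otimes>\<^sub>M cube)" by simp
    qed
  qed
  fix A B assume AB: "A \<in> sets (cube :: real measure)" "B \<in> sets (cube :: real measure)"
  note * = ab[OF this]
  have "emeasure cube A * emeasure cube B = emeasure lborel A * emeasure lborel B"
    using * by (simp add: emeasure_restrict_space cbox_0_One_real)
  also have "\<dots> = emeasure (lborel \<Otimes>\<^sub>M lborel) (A \<times> B)"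
    using * by (subst lborel.emeasure_pair_measure_Times) auto
  also have "\<dots> = emeasure cube (A \<times> B)"
  proof -
    have "cbox 0 One \<inter> space lborel \<in> sets (lborel :: (real \<times> real) measure)" by simp
    moreover have "A \<times> B \<subseteq> cbox 0 One" using *(4,5) by (auto simp: cbox_0_One_prod)
    ultimately show ?thesis by (simp only: emeasure_restrict_space lborel_prod)
  qed
  finally show "emeasure cube A * emeasure cube B = emeasure cube (A \<times> B)" .
qed

lemma AE_cube_snd:
  assumes "AE p in (cube :: (real \<times> real) measure). P p"
  shows "AE y in cube. AE x in cube. P (x, y)"
proof -
  have "AE p in distr (cube \<Otimes>\<^sub>M cube) (cube \<Otimes>\<^sub>M cube) (\<lambda>(x, y). (y, x)). P p"
    using assms unfolding cube_real_prod unit_square.distr_pair_swap[symmetric] .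
  from AE_distrD[OF measurable_pair_swap' this]
  have "AE p in (cube \<Otimes>\<^sub>M cube). P (case p of (x, y) \<Rightarrow> (y, x))" .
  from unit_square.AE_pair[OF this] show ?thesis by simp
qed

lemma AE_cube_compose_fst:
  assumes "AE x in (cube :: real measure). P x"
  shows "AE p in (cube :: (real \<times> real) measure). P (fst p)" "AE p in (cube :: (real \<times> real) measure). P (snd p)"
proof -
  obtain N where N: "{x \<in> space cube. \<not> P x} \<subseteq> N" "emeasure cube N = 0" "N \<in> sets (cube :: real measure)"
    by (rule AE_E[OF assms]) (rule that, assumption+)
  note top = sets.top[of "cube :: real measure"]
  show "AE p in (cube :: (real \<times> real) measure). P (fst p)"
    unfolding cube_real_prod
  proof (rule AE_I)
    show "{p \<in> space (cube \<Otimes>\<^sub>M cube) :: (real \<times> real) set. \<not> P (fst p)} \<subseteq> N \<times> space cube"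
      using N(1) unfolding space_pair_measure by auto
    show "emeasure (cube \<Otimes>\<^sub>M cube) (N \<times> space (cube :: real measure)) = 0"
      using unit_interval.emeasure_pair_measure_Times[OF N(3) top] N(2) by (simp only: mult_zero_left)
  qed (intro pair_measureI N top)
  show "AE p in (cube :: (real \<times> real) measure). P (snd p)"
    unfolding cube_real_prod
  proof (rule AE_I)
    show "{p \<in> space (cube \<Otimes>\<^sub>M cube) :: (real \<times> real) set. \<not> P (snd p)} \<subseteq> space cube \<times> N"
      using N(1) unfolding space_pair_measure by auto
    show "emeasure (cube \<Otimes>\<^sub>M cube) (space (cube :: real measure) \<times> N) = 0"
      using unit_interval.emeasure_pair_measure_Times[OF top N(3)] N(2) by (simp only: mult_zero_right)
  qed (intro pair_measureI N top)
qed

lemma integral_cube: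
  fixes f :: "real \<times> real \<Rightarrow> complex"
  assumes "integrable cube f"
  shows "(LINT p|cube. f p) = (LINT y|cube. LINT x|cube. f (x, y))"
    "(LINT p|cube. f p) = (LINT x|cube. LINT y|cube. f (x, y))"
  using unit_square.integral_snd[of "\<lambda>x y. f (x, y)"] unit_square.integral_fst[of "\<lambda>x y. f (x, y)"] assms
  unfolding cube_real_prod by auto

lemma integrable_cube_slices:
  fixes f :: "real \<times> real \<Rightarrow> 'b::{banach, second_countable_topology}"
  assumes "integrable cube f"
  shows "AE y in cube. integrable cube (\<lambda>x. f (x, y))" "AE x in cube. integrable cube (\<lambda>y. f (x, y))"
    "integrable cube (\<lambda>y. LINT x|cube. f (x, y))" "integrable cube (\<lambda>x. LINT y|cube. f (x, y))"
  using unit_square.AE_integrable_snd[of "\<lambda>x y. f (x, y)"] unit_square.AE_integrable_fst[of "\<lambda>x y. f (x, y)"]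
   unit_square.integrable_snd[of "\<lambda>x y. f (x, y)"] unit_square.integrable_fst[of "\<lambda>x y. f (x, y)"] assms
  unfolding cube_real_prod by auto

lemma measurable_cube_slices:
  assumes "f \<in> borel_measurable (cube :: (real \<times> real) measure)"
  shows "y \<in> {0..1} \<Longrightarrow> (\<lambda>x. f (x, y)) \<in> borel_measurable cube" "x \<in> {0..1} \<Longrightarrow> (\<lambda>y. f (x, y)) \<in> borel_measurable cube"
  using assms unfolding cube_real_prod
  by (auto intro!: measurable_compose[OF measurable_Pair] simp: space_cube_real)

lemma square_integrable_slices:
  assumes "square_integrable (f :: real \<times> real \<Rightarrow> complex)"
  shows "AE y in cube. square_integrable (\<lambda>x. f (x, y))" "AE x in cube. square_integrable (\<lambda>y. f (x, y))"
proof -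
  have *: "f \<in> borel_measurable cube" "integrable cube (\<lambda>p. (cmod (f p))\<^sup>2)"
    using assms by (auto simp: square_integrable_def)
  have m: "AE y in (cube :: real measure). y \<in> {0..1}" using AE_space[of "cube :: real measure"] by (simp add: space_cube_real)
  show "AE y in cube. square_integrable (\<lambda>x. f (x, y))"
    using integrable_cube_slices(1)[OF *(2)] m
    by eventually_elim (simp add: square_integrable_def measurable_cube_slices(1)[OF *(1)])
  show "AE x in cube. square_integrable (\<lambda>y. f (x, y))"
    using integrable_cube_slices(2)[OF *(2)] m
    by eventually_elim (simp add: square_integrable_def measurable_cube_slices(2)[OF *(1)])
qed

section \<open>Elementary tensors\<close>

lemma square_integrable_tensor:
  assumes "square_integrable a" "square_integrable k"
  shows "square_integrable (\<lambda>p :: real \<times> real. a (fst p) * k (snd p))"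
proof -
  have [measurable]: "a \<in> borel_measurable cube" "k \<in> borel_measurable cube"
    and i: "integrable cube (\<lambda>x. (cmod (a x))\<^sup>2)" "integrable cube (\<lambda>x. (cmod (k x))\<^sup>2)"
    using assms by (auto simp: square_integrable_def)
  have m: "(\<lambda>p. a (fst p) * k (snd p)) \<in> borel_measurable (cube \<Otimes>\<^sub>M cube)" by measurable
  have "integrable (cube \<Otimes>\<^sub>M cube) (\<lambda>p. (cmod (a (fst p) * k (snd p)))\<^sup>2)"
  proof (rule unit_square.Fubini_integrable)
    have "(\<lambda>x. LINT y|cube. norm ((cmod (a (fst (x, y)) * k (snd (x, y))))\<^sup>2)) = (\<lambda>x. (cmod (a x))\<^sup>2 * (LINT y|cube. (cmod (k y))\<^sup>2))"
      by (simp add: norm_mult power_mult_distrib)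
    then show "integrable cube (\<lambda>x. LINT y|cube. norm ((cmod (a (fst (x, y)) * k (snd (x, y))))\<^sup>2))"
      using i by simp
    show "AE x in cube. integrable cube (\<lambda>y. (cmod (a (fst (x, y)) * k (snd (x, y))))\<^sup>2)"
      using i by (simp add: norm_mult power_mult_distrib)
  qed measurable
  with m show ?thesis by (simp add: square_integrable_def cube_real_prod)
qed

lift_definition tens :: "real cube_L2 \<Rightarrow> real cube_L2 \<Rightarrow> (real \<times> real) cube_L2"
  is "\<lambda>a k p. a (fst p) * k (snd p)"
proof (elim conjE, intro conjI square_integrable_tensor)
  fix a a' k k' :: "real \<Rightarrow> complex"
  assume "AE x in cube. a x = a' x" "AE x in cube. k x = k' x"
  from AE_cube_compose_fst(1)[OF this(1)] AE_cube_compose_fst(2)[OF this(2)]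
  show "AE p in cube. a (fst p) * k (snd p) = a' (fst p) * k' (snd p)"
    by eventually_elim simp
qed

lemma represents_tens:
  "represents A a \<Longrightarrow> represents K k \<Longrightarrow> represents (\<lambda>p. A (fst p) * K (snd p)) (tens a k)"
proof (transfer, elim conjE, intro conjI square_integrable_tensor)
  fix a a' k k' :: "real \<Rightarrow> complex"
  assume "AE x in cube. a x = a' x" "AE x in cube. k x = k' x"
  from AE_cube_compose_fst(1)[OF this(1)] AE_cube_compose_fst(2)[OF this(2)]
  show "AE p in cube. a (fst p) * k (snd p) = a' (fst p) * k' (snd p)"
    by eventually_elim simp
qed

lemma tens_add_left: "tens (a + b) k = tens a k + tens b k"
  and tens_add_right: "tens a (k + l) = tens a k + tens a l"
  and tens_scaleC_left: "tens (c *\<^sub>C a) k = c *\<^sub>C tens a k"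
  and tens_scaleC_right: "tens a (c *\<^sub>C k) = c *\<^sub>C tens a k"
  by (transfer; auto intro!: square_integrable_tensor square_integrable_add square_integrable_scale simp: algebra_simps)+

lemma cinner_tens_eq:
  assumes f: "represents F f" and a: "represents A a" and k: "represents K k"
  shows "cinner f (tens a k) = (LINT x|cube. (LINT y|cube. F (x, y) * cnj (K y)) * cnj (A x))"
proof -
  have "cinner f (tens a k) = (LINT p|cube. F p * cnj (A (fst p) * K (snd p)))"
    by (rule cinner_eq[OF f represents_tens[OF a k]])
  also have "\<dots> = (LINT x|cube. LINT y|cube. F (x, y) * cnj (A x * K y))"
    using integral_cube(2)[OF square_integrable_mult_cnj[OF represents_square_integrable[OF f] represents_square_integrable[OF represents_tens[OF a k]]]]
    by simp
  also have "\<dots> = (LINT x|cube. (LINT y|cube. F (x, y) * cnj (K y)) * cnj (A x))"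
  proof (rule Bochner_Integration.integral_cong[OF refl])
    fix x
    have "(LINT y|cube. F (x, y) * cnj (A x * K y)) = (LINT y|cube. (F (x, y) * cnj (K y)) * cnj (A x))"
      by (simp add: mult_ac)
    then show "(LINT y|cube. F (x, y) * cnj (A x * K y)) = (LINT y|cube. F (x, y) * cnj (K y)) * cnj (A x)"
      by simp
  qed
  finally show ?thesis .
qed

lemma cinner_tens_tens: "cinner (tens a k) (tens b l) = cinner a b * cinner k l"
proof -
  obtain A B K L where r: "represents A a" "represents B b" "represents K k" "represents L l"
    using representative_exists by metis
  show ?thesis
    unfolding cinner_tens_eq[OF represents_tens[OF r(1,3)] r(2,4)] cinner_eq[OF r(1,2)] cinner_eq[OF r(3,4)]
    by (simp add: mult.assoc) (simp add: mult.left_commute mult.commute mult.assoc[symmetric])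
qed

lemma norm_eq_cinner: "cinner f f = of_real ((norm f)\<^sup>2)"
  using representative_exists[of f] cinner_self norm_cube_L2_power2 by metis

lemma norm_tens: "norm (tens a k) = norm a * norm k"
proof -
  have "complex_of_real ((norm (tens a k))\<^sup>2) = of_real ((norm a * norm k)\<^sup>2)"
    by (simp only: norm_eq_cinner[symmetric] cinner_tens_tens) (simp add: norm_eq_cinner power_mult_distrib)
  then show ?thesis by (simp only: of_real_eq_iff) simp
qed

lemma bounded_bilinear_tens: "bounded_bilinear tens"
proof (rule bounded_bilinear.intro)
  show "\<exists>K. \<forall>a b. norm (tens a b) \<le> norm a * norm b * K" by (intro exI[of _ 1]) (simp add: norm_tens)
qed (simp_all add: tens_add_left tens_add_right scaleR_cube_L2_def tens_scaleC_left tens_scaleC_right)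

lemma norm_scaleC: "norm (c *\<^sub>C f) = cmod c * norm f"
proof -
  have "complex_of_real ((norm (c *\<^sub>C f))\<^sup>2) = of_real ((cmod c * norm f)\<^sup>2)"
    by (simp only: norm_eq_cinner[symmetric] cinner_scaleC_left cinner_scaleC_right)
      (simp add: norm_eq_cinner power_mult_distrib mult.assoc[symmetric] mult.commute[of "cnj c" c] flip: complex_norm_square)
  then show ?thesis by (simp only: of_real_eq_iff) simp
qed

lemma norm_cinner_le: "cmod (cinner f g) \<le> norm f * norm g"
proof (cases "cinner f g = 0")
  case False
  define c where "c = cnj (cinner f g) / cmod (cinner f g)"
  have "cmod c = 1" using False by (simp add: c_def norm_divide)
  have "c * cinner f g = cmod (cinner f g)"
    using False by (simp add: c_def mult.commute[of "cnj _"] complex_norm_square[symmetric] power2_eq_square)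
  then have "cmod (cinner f g) = inner (c *\<^sub>C f) g"
    by (simp add: inner_cube_L2_def cinner_scaleC_left)
  also have "\<dots> \<le> norm (c *\<^sub>C f) * norm g" by (rule norm_cauchy_schwarz)
  finally show ?thesis using \<open>cmod c = 1\<close> by (simp add: norm_scaleC)
qed simp

text \<open>Cauchy-Schwarz on almost every vertical slice bounds the squared modulus by
  \<open>(norm k)\<^sup>2\<close> times the integral of the squared slice, which is integrable in x
  by Fubini.\<close>

lemma square_integrable_partial_inner:
  assumes f: "represents F (f :: (real \<times> real) cube_L2)" and k: "represents K k"
  shows "square_integrable (\<lambda>x. LINT y|cube. F (x, y) * cnj (K y))"
proof -
  note si = represents_square_integrable[OF f] represents_square_integrable[OF k]
  have m[measurable]: "F \<in> borel_measurable (cube \<Otimes>\<^sub>M cube)" "K \<in> borel_measurable cube"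
    using si unfolding square_integrable_def cube_real_prod by auto
  have mg: "(\<lambda>x. LINT y|cube. F (x, y) * cnj (K y)) \<in> borel_measurable cube" by measurable
  have iF: "integrable cube (\<lambda>p. (cmod (F p))\<^sup>2)" using si by (simp add: square_integrable_def)
  have "integrable cube (\<lambda>x. (LINT y|cube. (cmod (F (x, y)))\<^sup>2) * (norm k)\<^sup>2)"
    using integrable_cube_slices(4)[OF iF] by simp
  then have "integrable cube (\<lambda>x. (cmod (LINT y|cube. F (x, y) * cnj (K y)))\<^sup>2)"
  proof (rule Bochner_Integration.integrable_bound)
    show "AE x in cube. norm ((cmod (LINT y|cube. F (x, y) * cnj (K y)))\<^sup>2) \<le> norm ((LINT y|cube. (cmod (F (x, y)))\<^sup>2) * (norm k)\<^sup>2)"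
      using square_integrable_slices(2)[OF si(1)]
    proof eventually_elim
      case (elim x)
      then obtain h where h: "represents (\<lambda>y. F (x, y)) h" using represents_exists by blast
      have "(cmod (cinner h k))\<^sup>2 \<le> (norm h * norm k)\<^sup>2" by (intro power_mono norm_cinner_le) simp
      then show ?case
        by (simp add: cinner_eq[OF h k] power_mult_distrib norm_cube_L2_power2[OF h])
    qed
  qed (use mg in measurable)
  with mg show ?thesis by (simp add: square_integrable_def)
qed

text \<open>An unspecified class when \<open>F\<close> is not square integrable.\<close>

definition cls :: "('a::euclidean_space \<Rightarrow> complex) \<Rightarrow> 'a cube_L2"
  where "cls F = (SOME f. represents F f)"

lemma represents_cls: "square_integrable F \<Longrightarrow> represents F (cls F)"
  unfolding cls_def by (rule someI_ex) (rule represents_exists)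

lemma represents_cls_continuous: "continuous_on UNIV F \<Longrightarrow> represents F (cls F)"
  by (rule represents_cls[OF square_integrable_continuous])

section \<open>Smooth functions with support in the open unit interval\<close>

text \<open>The one-variable counterpart of \<open>k_smooth\<close>. Derivatives are existential
  witnesses, which products, affine substitutions and antiderivatives supply directly.\<close>

primrec smooth_upto :: "nat \<Rightarrow> (real \<Rightarrow> complex) \<Rightarrow> bool" where
  "smooth_upto 0 a \<longleftrightarrow> continuous_on UNIV a"
| "smooth_upto (Suc k) a \<longleftrightarrow> (\<exists>a'. (\<forall>x. (a has_vector_derivative a' x) (at x)) \<and> smooth_upto k a')"

lemma smooth_upto_continuous: "smooth_upto k a \<Longrightarrow> continuous_on UNIV a"
  by (cases k) (auto intro!: continuous_at_imp_continuous_on intro: has_vector_derivative_continuous)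

lemma smooth_upto_SucI:
  "(\<And>x. (a has_vector_derivative a' x) (at x)) \<Longrightarrow> smooth_upto k a' \<Longrightarrow> smooth_upto (Suc k) a"
  by auto

lemma smooth_upto_mono: "smooth_upto (Suc k) a \<Longrightarrow> smooth_upto k a"
proof (induction k arbitrary: a)
  case 0
  then show ?case using smooth_upto_continuous[of "Suc 0"] by simp
next
  case (Suc k)
  then obtain a' where "\<forall>x. (a has_vector_derivative a' x) (at x)" "smooth_upto (Suc k) a'"
    by (simp only: smooth_upto.simps(2)[of "Suc k"]) blast
  with Suc.IH[of a'] show ?case by auto
qed

lemma smooth_upto_lincomb:
  "smooth_upto k a \<Longrightarrow> smooth_upto k b \<Longrightarrow> smooth_upto k (\<lambda>x. c * a x + d * b x)"
proof (induction k arbitrary: a b)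
  case 0
  then show ?case by (auto intro!: continuous_intros)
next
  case (Suc k)
  then obtain a' b' where "\<forall>x. (a has_vector_derivative a' x) (at x)" "smooth_upto k a'"
    "\<forall>x. (b has_vector_derivative b' x) (at x)" "smooth_upto k b'" by auto
  then show ?case using Suc.IH[of a' b']
    by (auto intro!: exI[of _ "\<lambda>x. c * a' x + d * b' x"] derivative_eq_intros)
qed

lemma smooth_upto_mult:
  "smooth_upto k a \<Longrightarrow> smooth_upto k b \<Longrightarrow> smooth_upto k (\<lambda>x. a x * b x)"
proof (induction k arbitrary: a b)
  case 0
  then show ?case by (auto intro!: continuous_intros)
next
  case (Suc k)
  then obtain a' b' where *: "\<forall>x. (a has_vector_derivative a' x) (at x)" "smooth_upto k a'"
    "\<forall>x. (b has_vector_derivative b' x) (at x)" "smooth_upto k b'" by auto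
  have "smooth_upto k (\<lambda>x. 1 * (a x * b' x) + 1 * (a' x * b x))"
    using Suc.prems[THEN smooth_upto_mono] * by (intro smooth_upto_lincomb Suc.IH) auto
  moreover have "\<forall>x. ((\<lambda>x. a x * b x) has_vector_derivative a x * b' x + a' x * b x) (at x)"
    using * by (auto intro: has_vector_derivative_mult)
  ultimately show ?case by auto
qed

lemma smooth_upto_affine:
  "smooth_upto k a \<Longrightarrow> smooth_upto k (\<lambda>x. a (c * x + d))"
proof (induction k arbitrary: a)
  case 0
  then show ?case by (auto intro!: continuous_on_compose2[of UNIV a] continuous_intros)
next
  case (Suc k)
  then obtain a' where *: "\<forall>x. (a has_vector_derivative a' x) (at x)" "smooth_upto k a'" by auto
  have "((\<lambda>x. a (c * x + d)) has_vector_derivative of_real c * a' (c * x + d) + 0 * a' (c * x + d)) (at x)" for x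
  proof -
    have "((\<lambda>x. c * x + d) has_vector_derivative c) (at x)"
      unfolding has_real_derivative_iff_has_vector_derivative[symmetric] by (auto intro!: derivative_eq_intros)
    from vector_diff_chain_at[OF this, of a "a' (c * x + d)"] *(1)
    show ?thesis by (simp add: o_def scaleR_conv_of_real)
  qed
  moreover have "smooth_upto k (\<lambda>x. of_real c * a' (c * x + d) + 0 * a' (c * x + d))"
    using Suc.IH[OF *(2)] by (intro smooth_upto_lincomb)
  ultimately show ?case by (rule smooth_upto_SucI)
qed

text \<open>The span of this family is closed under differentiation, so every derivative of the
  standard flat function \<open>flat 0\<close> stays inside it.\<close>

definition flat :: "nat \<Rightarrow> real \<Rightarrow> real"
  where "flat j s = (if 0 < s then (1 / s) ^ j * exp (- (1 / s)) else 0)"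

text \<open>A single term of the exponential series at y = 1 / s, of degree j + 1, is at most exp y.
  The factor \<open>\<bar>s\<bar>\<close> gained in this way is what makes the difference quotients
  at 0 tend to 0.\<close>

lemma flat_bound: "flat j s \<le> fact (Suc j) * \<bar>s\<bar>"
proof (cases "0 < s")
  case True
  define y where "y = 1 / s"
  have y: "y > 0" using True by (simp add: y_def)
  have "y ^ Suc j / fact (Suc j) \<le> exp y"
  proof -
    have s: "(\<lambda>n. y ^ n /\<^sub>R fact n) sums exp y" by (rule exp_converges)
    have "sum (\<lambda>n. y ^ n /\<^sub>R fact n) {Suc j} \<le> exp y"
      unfolding sums_unique[OF s] using y by (intro sum_le_suminf sums_summable[OF s]) auto
    then show ?thesis by (simp add: divide_inverse mult.commute)
  qed
  then have "y ^ j * exp (- y) \<le> fact (Suc j) / y"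
    using y by (simp add: exp_minus field_simps del: fact_Suc)
  then show ?thesis using True by (simp add: flat_def y_def del: fact_Suc)
next
  case False
  have "0 \<le> fact (Suc j) * \<bar>s\<bar>" by (intro mult_nonneg_nonneg) auto
  then show ?thesis using False by (simp only: flat_def if_False)
qed

lemma flat_has_derivative:
  "(flat j has_real_derivative flat (j + 2) s - real j * flat (j + 1) s) (at s)"
proof (cases s "0 :: real" rule: linorder_cases)
  case less
  have "((\<lambda>_. 0) has_real_derivative 0) (at s)" by simp
  then have "(flat j has_real_derivative 0) (at s)"
    by (rule has_field_derivative_transform_within_open[where S = "{..<0}"]) (use less in \<open>auto simp: flat_def\<close>)
  then show ?thesis using less by (simp add: flat_def)
next
  case equal
  have "\<bar>(flat j h - flat j 0) / (h - 0)\<bar> \<le> fact (Suc (Suc j)) * \<bar>h\<bar>" for h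
  proof -
    have "\<bar>(flat j h - flat j 0) / (h - 0)\<bar> = flat (Suc j) h"
      by (auto simp: flat_def abs_mult)
    then show ?thesis using flat_bound[of "Suc j" h] by simp
  qed
  then have bd: "norm ((flat j h - flat j 0) / (h - 0)) \<le> fact (Suc (Suc j)) * \<bar>h\<bar>" for h
    by simp
  have "((\<lambda>h. fact (Suc (Suc j)) * \<bar>h\<bar>) \<longlongrightarrow> (0::real)) (at 0)"
    by (auto intro!: tendsto_eq_intros)
  then have "((\<lambda>h. (flat j h - flat j 0) / (h - 0)) \<longlongrightarrow> 0) (at 0)"
    by (rule Lim_null_comparison[OF always_eventually[OF allI[OF bd]]])
  then show ?thesis using equal by (simp add: has_field_derivative_iff flat_def)
next
  case greater
  have "((\<lambda>s. (1 / s) ^ j * exp (- (1 / s))) has_real_derivative (1 / s) ^ (j + 2) * exp (- (1 / s)) - real j * ((1 / s) ^ (j + 1) * exp (- (1 / s)))) (at s)"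
  proof -
    have "((\<lambda>s. 1 / s) has_real_derivative - ((1 / s)\<^sup>2)) (at s)"
      using greater by (auto intro!: derivative_eq_intros simp: power2_eq_square field_simps)
    note d = this DERIV_power[OF this, of j] DERIV_fun_exp[OF DERIV_minus[OF this]]
    have "real j * (- (y\<^sup>2) * y ^ (j - Suc 0)) * E + E * y\<^sup>2 * y ^ j = y ^ (j + 2) * E - real j * (y ^ (j + 1) * E)"
      for y E :: real by (cases j) (simp_all add: power2_eq_square algebra_simps)
    then show ?thesis
      by (intro DERIV_cong[OF DERIV_mult[OF d(2,3)]]) (simp add: mult.assoc)
  qed
  then have "(flat j has_real_derivative (1 / s) ^ (j + 2) * exp (- (1 / s)) - real j * ((1 / s) ^ (j + 1) * exp (- (1 / s)))) (at s)"
    by (rule has_field_derivative_transform_within_open[where S = "{0<..}"]) (use greater in \<open>auto simp: flat_def\<close>)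
  then show ?thesis using greater by (simp add: flat_def)
qed

lemma smooth_upto_flat: "smooth_upto k (\<lambda>s. of_real (flat j s))"
proof (induction k arbitrary: j)
  case 0
  have "continuous_on UNIV (flat j)"
    using flat_has_derivative by (intro continuous_at_imp_continuous_on ballI DERIV_isCont)
  then show ?case by (auto intro!: continuous_intros)
next
  case (Suc k)
  have "((\<lambda>s. complex_of_real (flat j s)) has_vector_derivative 1 * of_real (flat (j + 2) x) + - of_nat j * of_real (flat (j + 1) x)) (at x)" for x
    using bounded_linear.has_vector_derivative[OF bounded_linear_of_real flat_has_derivative[unfolded has_real_derivative_iff_has_vector_derivative], of j x]
    by simp
  moreover have "smooth_upto k (\<lambda>x. 1 * of_real (flat (j + 2) x) + - of_nat j * of_real (flat (j + 1) x))"
    by (intro smooth_upto_lincomb Suc)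
  ultimately show ?case by (rule smooth_upto_SucI)
qed

text \<open>The arguments are n (x - p) - 1 and n (1 - x) - 1. For positive n both are positive
  exactly when p + 1/n < x < 1 - 1/n, and for p < x < 1 both tend to infinity; so the bumps
  approximate the indicator of (p, 1) from inside.\<close>

definition bump :: "real \<Rightarrow> nat \<Rightarrow> real \<Rightarrow> complex"
  where "bump p n x = of_real (flat 0 (real n * x + (- real n * p - 1))) * of_real (flat 0 (- real n * x + (real n - 1)))"

definition smooth_supported :: "(real \<Rightarrow> complex) \<Rightarrow> bool"
  where "smooth_supported a \<longleftrightarrow> (\<forall>k. smooth_upto k a) \<and> (\<exists>\<delta>>0. \<forall>x. a x \<noteq> 0 \<longrightarrow> \<delta> \<le> x \<and> x \<le> 1 - \<delta>)"

lemma smooth_supported_bump: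
  assumes p: "0 \<le> p" and n: "0 < n"
  shows "smooth_supported (bump p n)"
  unfolding smooth_supported_def
proof (intro conjI allI)
  show "smooth_upto k (bump p n)" for k
    unfolding bump_def by (intro smooth_upto_mult smooth_upto_affine smooth_upto_flat)
  show "\<exists>\<delta>>0. \<forall>x. bump p n x \<noteq> 0 \<longrightarrow> \<delta> \<le> x \<and> x \<le> 1 - \<delta>"
  proof (intro exI[of _ "1 / real n"] conjI allI impI)
    fix x assume "bump p n x \<noteq> 0"
    then have *: "0 < real n * x + (- real n * p - 1)" "0 < - real n * x + (real n - 1)"
      by (auto simp: bump_def flat_def split: if_splits)
    have "0 \<le> real n * p" using p by simp
    then have "1 < x * real n" using *(1) by (simp add: mult.commute)
    then show "1 / real n \<le> x" using n by (simp add: pos_divide_le_eq)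
    have "1 < (1 - x) * real n" using *(2) by (simp add: algebra_simps)
    then have "1 / real n < 1 - x" using n by (simp add: pos_divide_less_eq)
    then show "x \<le> 1 - 1 / real n" by simp
  qed (use n in simp)
qed

lemma bump_bound: "cmod (bump p n x) \<le> 1"
proof -
  have "\<bar>flat 0 s\<bar> \<le> 1" for s by (simp add: flat_def)
  from mult_mono[OF this this] show ?thesis by (simp add: bump_def norm_mult)
qed

lemma bump_tendsto: "(\<lambda>n. bump p n x) \<longlonglongrightarrow> indicator {p<..<1} x"
proof (cases "p < x \<and> x < 1")
  case False
  have "bump p n x = 0" for n
  proof -
    from False consider "x \<le> p" | "1 \<le> x" by force
    then show ?thesis
    proof cases
      case 1
      then have "real n * x \<le> real n * p" by (simp add: mult_left_mono)
      then show ?thesis by (simp add: bump_def flat_def)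
    next
      case 2
      then have "real n * 1 \<le> real n * x" by (intro mult_left_mono) auto
      then show ?thesis by (simp add: bump_def flat_def)
    qed
  qed
  moreover have "indicator {p<..<1} x = (0::complex)" using False by (simp add: indicator_def)
  ultimately show ?thesis by simp
next
  case True
  have lim: "(\<lambda>n. flat 0 (real n * c + - 1)) \<longlonglongrightarrow> 1" if c: "0 < c" for c
  proof -
    have *: "filterlim (\<lambda>n. real n * c + - 1) at_top sequentially"
      using filterlim_tendsto_add_at_top[OF tendsto_const filterlim_at_top_mult_tendsto_pos[OF tendsto_const c filterlim_real_sequentially], of "-1"]
      by (simp add: add.commute)
    have "(\<lambda>n. exp (- (1 / (real n * c + - 1)))) \<longlonglongrightarrow> exp (- 0)"
      by (intro tendsto_intros real_tendsto_divide_at_top[OF tendsto_const *])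
    moreover have "\<forall>\<^sub>F n in sequentially. exp (- (1 / (real n * c + - 1))) = flat 0 (real n * c + - 1)"
      using filterlim_at_top_dense[THEN iffD1, OF *, rule_format, of 0]
      by eventually_elim (simp add: flat_def)
    ultimately show ?thesis by (simp add: tendsto_cong)
  qed
  have "(\<lambda>n. complex_of_real (flat 0 (real n * (x - p) + - 1)) * of_real (flat 0 (real n * (1 - x) + - 1))) \<longlonglongrightarrow> of_real 1 * of_real 1"
    using True by (intro tendsto_intros lim) auto
  moreover have "bump p n x = of_real (flat 0 (real n * (x - p) + - 1)) * of_real (flat 0 (real n * (1 - x) + - 1))" for n
  proof -
    have "real n * (x - p) + - 1 = real n * x + (- real n * p - 1)"
      "real n * (1 - x) + - 1 = - real n * x + (real n - 1)" by (simp_all add: algebra_simps)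
    then show ?thesis unfolding bump_def by (simp only:)
  qed
  ultimately show ?thesis using True by (simp add: indicator_def)
qed

lemma smooth_supported_continuous: "smooth_supported a \<Longrightarrow> continuous_on UNIV a"
  unfolding smooth_supported_def by (blast intro: smooth_upto_continuous[of 0])

text \<open>After extension by 0 to the whole line, the positive and the negative part are densities
  of finite measures that agree on all rays, and such measures coincide.\<close>

lemma AE_zero_if_integrals_zero:
  fixes u :: "real \<Rightarrow> real"
  assumes u: "integrable cube u"
    and 0: "\<And>p. 0 \<le> p \<Longrightarrow> p < 1 \<Longrightarrow> (LINT x|cube. indicator {p<..<1} x * u x) = 0"
  shows "AE x in cube. u x = 0"
proof -
  have cb: "cbox 0 (One :: real) \<inter> space lborel \<in> sets lborel" by simp
  define v where "v = (\<lambda>x. indicator {0..1} x * u x)"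
  have v: "integrable lborel v"
    using u integrable_restrict_space[OF cb, of u] unfolding v_def by (simp add: cbox_0_One_real)
  then have [measurable]: "v \<in> borel_measurable borel" by auto
  have v0: "(LINT x|lborel. indicator {y<..} x * v x) = 0" for y
  proof (cases "y < 1")
    case True
    define p where "p = max y 0"
    have p: "0 \<le> p" "p < 1" using True by (auto simp: p_def)
    have "(LINT x|lborel. indicator {y<..} x * v x) = (LINT x|lborel. indicator {0..1} x *\<^sub>R (indicator {p<..<1} x * u x))"
    proof (rule integral_cong_AE)
      have "(\<lambda>x. indicator {0..1} x *\<^sub>R (indicator {p<..<1} x * u x)) = (\<lambda>x. indicator {p<..<1} x * v x)"
        by (auto simp: v_def)
      then show "(\<lambda>x. indicator {0..1} x *\<^sub>R (indicator {p<..<1} x * u x)) \<in> borel_measurable lborel" by simp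
      have "AE x in lborel. x \<noteq> 0 \<and> x \<noteq> (1::real)" using AE_lborel_singleton[of "0::real"] AE_lborel_singleton[of "1::real"] by eventually_elim simp
      then show "AE x in lborel. indicator {y<..} x * v x = indicator {0..1} x *\<^sub>R (indicator {p<..<1} x * u x)"
        by eventually_elim (auto simp: v_def p_def indicator_def split: if_splits)
    qed simp
    also have "\<dots> = 0"
      using 0[OF p] integral_restrict_space[OF cb, of "\<lambda>x. indicator {p<..<1} x * u x"]
      by (simp add: cbox_0_One_real)
    finally show ?thesis .
  next
    case False
    then have "(\<lambda>x. indicator {y<..} x * v x) = (\<lambda>_. 0)" by (auto simp: v_def indicator_def)
    then show ?thesis by simp
  qed
  define vp where "vp = (\<lambda>x. max 0 (v x))"
  define vm where "vm = (\<lambda>x. max 0 (- v x))"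
  have vpm: "integrable lborel vp" "integrable lborel vm" unfolding vp_def vm_def using v by auto
  have [measurable]: "vp \<in> borel_measurable borel" "vm \<in> borel_measurable borel" using vpm by auto
  have nn: "emeasure (density lborel (\<lambda>x. ennreal (w x))) {y<..} = ennreal (LINT x|lborel. indicator {y<..} x * w x)"
    if "integrable lborel w" "\<And>x. 0 \<le> w x" for w and y :: real
  proof -
    have "emeasure (density lborel (\<lambda>x. ennreal (w x))) {y<..} = (\<integral>\<^sup>+x. ennreal (w x) * indicator {y<..} x \<partial>lborel)"
      using that by (intro emeasure_density) auto
    also have "\<dots> = (\<integral>\<^sup>+x. ennreal (indicator {y<..} x * w x) \<partial>lborel)"
      by (intro nn_integral_cong) (auto simp: indicator_def)
    also have "\<dots> = ennreal (LINT x|lborel. indicator {y<..} x * w x)"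
      using that integrable_real_mult_indicator[OF _ that(1), of "{y<..}"]
      by (intro nn_integral_eq_integral) (auto simp: mult.commute)
    finally show ?thesis .
  qed
  have eq: "density lborel (\<lambda>x. ennreal (vp x)) = density lborel (\<lambda>x. ennreal (vm x))"
  proof (rule measure_eqI_lessThan)
    fix y
    have "(LINT x|lborel. indicator {y<..} x * vp x) - (LINT x|lborel. indicator {y<..} x * vm x) = (LINT x|lborel. indicator {y<..} x * vp x - indicator {y<..} x * vm x)"
      using vpm by (intro Bochner_Integration.integral_diff[symmetric]) (auto simp: mult.commute intro: integrable_real_mult_indicator)
    also have "(\<lambda>x. indicator {y<..} x * vp x - indicator {y<..} x * vm x) = (\<lambda>x. indicator {y<..} x * v x)"
      by (rule ext) (simp add: vp_def vm_def indicator_def max_def)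
    finally show "emeasure (density lborel (\<lambda>x. ennreal (vp x))) {y<..} = emeasure (density lborel (\<lambda>x. ennreal (vm x))) {y<..}"
      using v0[of y] vpm by (simp add: nn vp_def vm_def)
    show "emeasure (density lborel (\<lambda>x. ennreal (vp x))) {y<..} < \<infinity>"
      using vpm by (simp add: nn vp_def)
  qed auto
  have "AE x in lborel. ennreal (vp x) = ennreal (vm x)"
    using sigma_finite_measure.density_unique[OF sigma_finite_lborel _ _ eq] by auto
  then have "AE x in lborel. v x = 0"
    by eventually_elim (auto simp: vp_def vm_def max_def split: if_splits)
  then have "AE x in lborel. x \<in> cbox 0 One \<longrightarrow> u x = 0"
    by eventually_elim (auto simp: v_def cbox_0_One_real)
  then show ?thesis by (simp only: AE_restrict_space_iff[OF cb])
qed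

text \<open>Bumps converge boundedly to indicators of intervals (p, 1), so by dominated convergence
  the integrals of \<open>w\<close> over all these intervals vanish.\<close>

lemma total_bump:
  fixes w :: "real cube_L2"
  assumes "\<And>p n. 0 \<le> p \<Longrightarrow> 0 < n \<Longrightarrow> cinner w (cls (bump p n)) = 0"
  shows "w = 0"
proof -
  obtain W where W: "represents W w" using representative_exists by metis
  have iW: "integrable cube W" by (rule square_integrable_integrable[OF represents_square_integrable[OF W]])
  have [measurable]: "W \<in> borel_measurable cube" using iW by auto
  have cb: "cnj (bump p n x) = bump p n x" for p n x by (simp add: bump_def)
  have im[measurable]: "(\<lambda>x. indicator {p<..<1} x :: complex) \<in> borel_measurable cube" for p :: real
    by (intro measurable_restrict_space1) simp
  have ind: "(LINT x|cube. W x * indicator {p<..<1} x) = 0" if p: "0 \<le> p" for p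
  proof -
    have rep: "represents (bump p (Suc n)) (cls (bump p (Suc n)))" for n
      by (rule represents_cls_continuous[OF smooth_supported_continuous[OF smooth_supported_bump[OF p]]]) simp
    have [measurable]: "bump p (Suc n) \<in> borel_measurable cube" for n
      using square_integrable_measurable[OF represents_square_integrable[OF rep]] .
    have "(\<lambda>n. LINT x|cube. W x * bump p (Suc n) x) \<longlonglongrightarrow> (LINT x|cube. W x * indicator {p<..<1} x)"
    proof (rule integral_dominated_convergence[where w = "\<lambda>x. cmod (W x)"])
      show "AE x in cube. (\<lambda>n. W x * bump p (Suc n) x) \<longlonglongrightarrow> W x * indicator {p<..<1} x"
        by (intro AE_I2 tendsto_intros LIMSEQ_Suc bump_tendsto)
      show "AE x in cube. norm (W x * bump p (Suc n) x) \<le> cmod (W x)" for n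
        by (intro AE_I2) (simp add: norm_mult mult_left_le bump_bound)
      show "(\<lambda>x. W x * indicator {p<..<1} x) \<in> borel_measurable cube" by (intro borel_measurable_times im) measurable
      show "(\<lambda>x. W x * bump p (Suc n) x) \<in> borel_measurable cube" for n by measurable
      show "integrable cube (\<lambda>x. cmod (W x))" using iW by simp
    qed
    moreover have "(LINT x|cube. W x * bump p (Suc n) x) = 0" for n
      using assms[OF p, of "Suc n"] cinner_eq[OF W rep] by (simp add: cb)
    ultimately show ?thesis by (simp add: LIMSEQ_const_iff)
  qed
  have i: "integrable cube (\<lambda>x. W x * indicator {p<..<1} x)" for p
  proof (rule Bochner_Integration.integrable_bound[OF iW])
    show "(\<lambda>x. W x * indicator {p<..<1} x) \<in> borel_measurable cube" by (intro borel_measurable_times im) measurable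
    show "AE x in cube. norm (W x * indicator {p<..<1} x) \<le> norm (W x)"
      by (intro AE_I2) (simp add: norm_mult mult_left_le indicator_def)
  qed
  have "AE x in cube. Re (W x) = 0"
  proof (rule AE_zero_if_integrals_zero)
    show "integrable cube (\<lambda>x. Re (W x))" using iW by simp
    fix p :: real assume "0 \<le> p"
    have "(LINT x|cube. indicator {p<..<1} x * Re (W x)) = (LINT x|cube. Re (W x * indicator {p<..<1} x))"
      by (intro Bochner_Integration.integral_cong) (auto simp: indicator_def)
    also have "\<dots> = 0" unfolding integral_Re[OF i] ind[OF \<open>0 \<le> p\<close>] by simp
    finally show "(LINT x|cube. indicator {p<..<1} x * Re (W x)) = 0" .
  qed
  moreover have "AE x in cube. Im (W x) = 0"
  proof (rule AE_zero_if_integrals_zero)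
    show "integrable cube (\<lambda>x. Im (W x))" using iW by simp
    fix p :: real assume "0 \<le> p"
    have "(LINT x|cube. indicator {p<..<1} x * Im (W x)) = (LINT x|cube. Im (W x * indicator {p<..<1} x))"
      by (intro Bochner_Integration.integral_cong) (auto simp: indicator_def)
    also have "\<dots> = 0" unfolding integral_Im[OF i] ind[OF \<open>0 \<le> p\<close>] by simp
    finally show "(LINT x|cube. indicator {p<..<1} x * Im (W x)) = 0" .
  qed
  ultimately have "AE x in cube. W x = 0" by eventually_elim (simp add: complex_eq_iff)
  from represents_AE_cong[OF W square_integrable_zero this]
  show ?thesis using represents_zero represents_eq by blast
qed

section \<open>Completeness of the trigonometric system\<close>

definition fexp :: "int \<Rightarrow> real \<Rightarrow> complex"
  where "fexp n x = cis (2 * pi * of_int n * x)"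

lemma continuous_fexp: "continuous_on S (fexp n)"
  unfolding fexp_def by (intro continuous_intros)

lemma fexp_mult: "fexp m x * fexp n x = fexp (m + n) x"
  by (simp add: fexp_def cis_mult algebra_simps)

lemma fexp_has_vector_derivative:
  "(fexp n has_vector_derivative (\<i> * of_real (2 * pi * of_int n)) * fexp n x) (at x)"
proof -
  have "((\<lambda>x. exp ((\<i> * of_real (2 * pi * of_int n)) * of_real x)) has_vector_derivative
      (\<i> * of_real (2 * pi * of_int n)) * exp ((\<i> * of_real (2 * pi * of_int n)) * of_real x)) (at x)"
    by (rule has_vector_derivative_real_field) (auto intro!: derivative_eq_intros)
  then show ?thesis by (simp add: fexp_def[abs_def] cis_conv_exp mult.assoc)
qed

lemma cnj_fexp: "cnj (fexp n x) = fexp (- n) x"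
  by (simp add: fexp_def cis_cnj)

lemma norm_fexp: "cmod (fexp n x) = 1"
  by (simp add: fexp_def)

lemma fexp_0_1: "fexp n 0 = 1" "fexp n 1 = 1"
  using cis_multiple_2pi[of "of_int n"] by (simp_all add: fexp_def)

inductive trig_poly :: "(real \<Rightarrow> complex) \<Rightarrow> bool" where
  mono: "trig_poly (\<lambda>x. c * fexp n x)"
| plus: "trig_poly f \<Longrightarrow> trig_poly g \<Longrightarrow> trig_poly (\<lambda>x. f x + g x)"

lemma trig_poly_term_mult:
  assumes "trig_poly g"
  shows "trig_poly (\<lambda>x. c * fexp n x * g x)"
  using assms
proof induction
  case (mono d m)
  have "trig_poly (\<lambda>x. (c * d) * fexp (n + m) x)" by (rule trig_poly.mono)
  then show ?case by (simp add: fexp_mult[symmetric] mult_ac)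
next
  case (plus f g)
  then have "trig_poly (\<lambda>x. c * fexp n x * f x + c * fexp n x * g x)" by (intro trig_poly.plus)
  then show ?case by (simp add: distrib_left)
qed

lemma trig_poly_mult:
  assumes "trig_poly f" "trig_poly g"
  shows "trig_poly (\<lambda>x. f x * g x)"
  using assms(1)
proof induction
  case (mono c n)
  then show ?case by (rule trig_poly_term_mult[OF assms(2)])
next
  case (plus f f')
  then have "trig_poly (\<lambda>x. f x * g x + f' x * g x)" by (intro trig_poly.plus)
  then show ?case by (simp add: distrib_right)
qed

text \<open>A real linear functional of \<open>fexp 1 x\<close> is a combination of
  \<open>fexp 1 x\<close> and its conjugate \<open>fexp (-1) x\<close>, and products of exponentials
  are exponentials.\<close>

lemma trig_poly_real_polynomial:
  assumes "real_polynomial_function p"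
  shows "trig_poly (\<lambda>x. of_real (p (fexp 1 x)))"
  using assms
proof induction
  case (linear f)
  interpret bounded_linear f by fact
  have "complex_of_real (f (fexp 1 x)) = ((of_real (f 1) - \<i> * of_real (f \<i>)) / 2) * fexp 1 x + ((of_real (f 1) + \<i> * of_real (f \<i>)) / 2) * fexp (-1) x" for x
  proof -
    define z where "z = fexp 1 x"
    have "z = Re z *\<^sub>R 1 + Im z *\<^sub>R \<i>" by (simp add: complex_eq_iff)
    then have fz: "f z = Re z * f 1 + Im z * f \<i>" by (metis add scaleR real_scaleR_def)
    have "fexp (-1) x = cnj z" by (simp add: z_def cnj_fexp)
    then show ?thesis unfolding z_def[symmetric] fz by (simp add: complex_eq_iff field_simps)
  qed
  then show ?case by (simp only:) (intro trig_poly.intros)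
next
  case (const c)
  show ?case using trig_poly.mono[of "of_real c" 0] by (simp add: fexp_def)
next
  case (add f g)
  then show ?case by (simp add: trig_poly.plus)
next
  case (mult f g)
  then show ?case by (simp add: trig_poly_mult)
qed

lemma trig_poly_approx:
  assumes b: "continuous_on {0..1} b" "b 0 = b (1::real)" and e: "0 < e"
  obtains t where "trig_poly t" "\<And>x. 0 \<le> x \<Longrightarrow> x \<le> 1 \<Longrightarrow> cmod (b x - t x) < e"
proof -
  have "path b" using b by (simp add: path_def)
  \<comment> \<open>The trivial homotopy of the loop \<open>b\<close> to itself transports
    continuity from [0,1] to the induced function on the circle, where polynomial approximation is
    available.\<close>
  then have "homotopic_loops UNIV b b"
    using b(2) by (simp add: homotopic_loops_refl pathstart_def pathfinish_def)
  from homotopic_loops_imp_homotopic_circlemaps[OF this]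
  have "continuous_on (sphere 0 1) (b \<circ> (\<lambda>z. Arg2pi z / (2 * pi)))"
    using homotopic_with_imp_continuous by blast
  from Stone_Weierstrass_polynomial_function[OF compact_sphere this e]
  obtain g where g: "polynomial_function g"
    "\<And>z. z \<in> sphere 0 1 \<Longrightarrow> cmod ((b \<circ> (\<lambda>z. Arg2pi z / (2 * pi))) z - g z) < e" by blast
  have "real_polynomial_function (Re \<circ> g)" "real_polynomial_function (Im \<circ> g)"
    using g(1) bounded_linear_Re bounded_linear_Im unfolding polynomial_function_def by blast+
  from this[THEN trig_poly_real_polynomial]
  have "trig_poly (\<lambda>x. of_real (Re (g (fexp 1 x))) + \<i> * fexp 0 x * of_real (Im (g (fexp 1 x))))"
    by (intro trig_poly.plus trig_poly_term_mult) simp_all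
  moreover have "of_real (Re (g (fexp 1 x))) + \<i> * fexp 0 x * of_real (Im (g (fexp 1 x))) = g (fexp 1 x)" for x
    by (simp add: complex_eq_iff fexp_def)
  ultimately have "trig_poly (\<lambda>x. g (fexp 1 x))" by simp
  moreover have "cmod (b x - g (fexp 1 x)) < e" if x: "0 \<le> x" "x \<le> 1" for x
  proof -
    have less: "cmod (b y - g (fexp 1 y)) < e" if y: "0 \<le> y" "y < 1" for y
    proof -
      have "Arg2pi (fexp 1 y) = 2 * pi * y"
        using y by (intro Arg2pi_unique[of 1]) (auto simp: fexp_def cis_conv_exp)
      then show ?thesis using g(2)[of "fexp 1 y"] by (simp add: norm_fexp)
    qed
    show ?thesis
    proof (cases "x = 1")
      case True
      then show ?thesis using less[of 0] b(2) by (simp add: fexp_0_1)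
    next
      case False
      then show ?thesis using less x by simp
    qed
  qed
  ultimately show ?thesis by (rule that)
qed

lemma measure_cube: "measure (cube :: 'a::euclidean_space measure) (cbox 0 One) = 1"
  using emeasure_cube_eq_1[where 'a='a] by (simp add: measure_def space_cube)

definition fbasis :: "int \<Rightarrow> real cube_L2"
  where "fbasis n = cls (fexp n)"

lemma represents_fbasis: "represents (fexp n) (fbasis n)"
  unfolding fbasis_def by (rule represents_cls_continuous[OF continuous_fexp])

lemma norm_le_of_bound:
  assumes F: "represents F (f :: real cube_L2)" and e: "0 \<le> e" "\<And>x. x \<in> {0..1} \<Longrightarrow> cmod (F x) \<le> e"
  shows "norm f \<le> e"
proof -
  have "(norm f)\<^sup>2 \<le> (LINT x|(cube :: real measure). e\<^sup>2)"
    unfolding norm_cube_L2_power2[OF F]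
  proof (rule integral_mono)
    show "integrable cube (\<lambda>x. (cmod (F x))\<^sup>2)"
      using represents_square_integrable[OF F] by (simp add: square_integrable_def)
    show "(cmod (F x))\<^sup>2 \<le> e\<^sup>2" if "x \<in> space cube" for x
      using that e(2) by (intro power_mono) (auto simp: space_cube_real simp del: space_restrict_space)
  qed simp
  also have "\<dots> = e\<^sup>2" by (simp add: measure_cube)
  finally show ?thesis using e(1) by (rule power2_le_imp_le)
qed

text \<open>A bump vanishes near both ends of the interval, so it closes up to a continuous periodic
  function and is a uniform limit of trigonometric polynomials.\<close>

lemma fourier_total:
  fixes w :: "real cube_L2"
  assumes w: "\<And>n. cinner w (fbasis n) = 0"
  shows "w = 0"
proof (rule total_bump)
  fix p :: real and n :: nat assume p: "0 \<le> p" and n: "0 < n"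
  have b: "continuous_on UNIV (bump p n)" "smooth_supported (bump p n)"
    using smooth_supported_bump[OF p n] smooth_supported_continuous by auto
  have b01: "bump p n 0 = bump p n 1"
  proof -
    obtain \<delta> where "\<delta> > 0" "\<And>x. bump p n x \<noteq> 0 \<Longrightarrow> \<delta> \<le> x \<and> x \<le> 1 - \<delta>"
      using b(2) unfolding smooth_supported_def by blast
    from this(1) this(2)[of 0] this(2)[of 1] show ?thesis by force
  qed
  have rb: "represents (bump p n) (cls (bump p n))" by (rule represents_cls_continuous[OF b(1)])
  have tp: "\<exists>f. represents t f \<and> cinner w f = 0" if "trig_poly t" for t
    using that
  proof induction
    case (mono c m)
    show ?case
      using represents_scaleC[OF represents_fbasis, of c m] w by (auto simp: cinner_scaleC_right)
  next
    case (plus f g)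
    then show ?case using represents_add by (fastforce simp: cinner_add_right)
  qed
  have "cmod (cinner w (cls (bump p n))) \<le> norm w * e" if e: "0 < e" for e
  proof -
    obtain t where t: "trig_poly t" "\<And>x. 0 \<le> x \<Longrightarrow> x \<le> 1 \<Longrightarrow> cmod (bump p n x - t x) < e"
      by (rule trig_poly_approx[OF continuous_on_subset[OF b(1) subset_UNIV] b01 e]) (rule that, assumption+)
    obtain f where f: "represents t f" "cinner w f = 0" using tp[OF t(1)] by blast
    have "cinner w (cls (bump p n)) = cinner w ((cls (bump p n) - f) + f)" by simp
    also have "\<dots> = cinner w (cls (bump p n) - f)" by (simp only: cinner_add_right f(2)) simp
    finally have "cmod (cinner w (cls (bump p n))) \<le> norm w * norm (cls (bump p n) - f)"
      by (simp add: norm_cinner_le)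
    also have "\<dots> \<le> norm w * e"
      using t(2) e by (intro mult_left_mono norm_le_of_bound[OF represents_diff[OF rb f(1)]]) (auto intro: less_imp_le)
    finally show ?thesis .
  qed
  then have "cmod (cinner w (cls (bump p n))) \<le> 0 + e" if "0 < e" for e
  proof -
    define d where "d = e / (norm w + 1)"
    have d: "0 < d" using that by (simp add: d_def add_nonneg_pos)
    have "norm w * d \<le> (norm w + 1) * d" using d by (intro mult_right_mono) auto
    also have "\<dots> = e" by (simp add: d_def add_nonneg_eq_0_iff)
    finally show ?thesis using \<open>\<And>e. 0 < e \<Longrightarrow> cmod (cinner w (cls (bump p n))) \<le> norm w * e\<close>[OF d] by simp
  qed
  then have "cmod (cinner w (cls (bump p n))) \<le> 0" by (rule field_le_epsilon)
  then show "cinner w (cls (bump p n)) = 0" by simp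
qed

lemma integral_cube_FTC:
  fixes a a' :: "real \<Rightarrow> complex"
  assumes s: "s \<in> {0..1}" and a: "\<And>x. (a has_vector_derivative a' x) (at x)" and a': "continuous_on UNIV a'"
  shows "(LINT x|cube. indicator {s..} x *\<^sub>R a' x) = a 1 - a s"
proof -
  have cb: "cbox 0 (One :: real) \<inter> space lborel \<in> sets lborel" by simp
  have "(LINT x|cube. indicator {s..} x *\<^sub>R a' x) = (LINT x|lborel. indicator {0..1} x *\<^sub>R (indicator {s..} x *\<^sub>R a' x))"
    using integral_restrict_space[OF cb, of "\<lambda>x. indicator {s..} x *\<^sub>R a' x"] by (simp add: cbox_0_One_real)
  also have "\<dots> = (LINT x|lborel. indicator {s..1} x *\<^sub>R a' x)"
    using s by (intro Bochner_Integration.integral_cong) (auto simp: indicator_def)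
  also have "\<dots> = a 1 - a s"
  proof (rule integral_FTC_atLeastAtMost)
    show "continuous_on {s..1} a'" by (rule continuous_on_subset[OF a' subset_UNIV])
    show "(a has_vector_derivative a' x) (at x within {s..1})" for x
      by (rule has_vector_derivative_at_within[OF a])
  qed (use s in simp)
  finally show ?thesis .
qed

lemma cinner_fbasis: "cinner (fbasis m) (fbasis n) = (if m = n then 1 else 0)"
proof -
  define k where "k = m - n"
  have "cinner (fbasis m) (fbasis n) = (LINT x|cube. fexp k x)"
    unfolding cinner_eq[OF represents_fbasis represents_fbasis] by (simp add: cnj_fexp fexp_mult k_def)
  also have "\<dots> = (if k = 0 then 1 else 0)"
  proof (cases "k = 0")
    case True
    then show ?thesis by (simp add: fexp_def measure_cube)
  next
    case False
    define F where "F = (\<lambda>x. fexp k x / (\<i> * of_real (2 * pi * of_int k)))"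
    have "(F has_vector_derivative fexp k x) (at x)" for x
      using has_vector_derivative_divide[OF fexp_has_vector_derivative[of k x], where a = "\<i> * of_real (2 * pi * of_int k)"] False
      by (simp add: F_def)
    from integral_cube_FTC[OF _ this continuous_fexp, of 0]
    have "(LINT x|cube. indicator {0..} x *\<^sub>R fexp k x) = F 1 - F 0" by simp
    moreover have "(LINT x|cube. indicator {0..} x *\<^sub>R fexp k x) = (LINT x|cube. fexp k x)"
      by (intro Bochner_Integration.integral_cong) (auto simp: space_cube_real indicator_def)
    ultimately show ?thesis using False by (simp add: F_def fexp_0_1)
  qed
  finally show ?thesis by (simp add: k_def)
qed

text \<open>Testing with \<open>k = fbasis m\<close> shows that for each m the m-th Fourier
  coefficient of the vertical slices vanishes for almost every x. There are countably many m, so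
  almost every slice has all its coefficients equal to 0.\<close>

lemma tensor_total:
  fixes f :: "(real \<times> real) cube_L2"
  assumes f: "\<And>n k. cinner f (tens (fbasis n) k) = 0"
  shows "f = 0"
proof -
  obtain F where F: "represents F f" using representative_exists by metis
  have z: "AE x in cube. (LINT y|cube. F (x, y) * cnj (fexp m y)) = 0" for m
  proof -
    have si: "square_integrable (\<lambda>x. LINT y|cube. F (x, y) * cnj (fexp m y))"
      by (rule square_integrable_partial_inner[OF F represents_fbasis])
    note r = represents_cls[OF si]
    have "cls (\<lambda>x. LINT y|cube. F (x, y) * cnj (fexp m y)) = 0"
    proof (rule fourier_total)
      show "cinner (cls (\<lambda>x. LINT y|cube. F (x, y) * cnj (fexp m y))) (fbasis n) = 0" for n
        unfolding cinner_eq[OF r represents_fbasis]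
        using f[of n "fbasis m"] cinner_tens_eq[OF F represents_fbasis represents_fbasis] by simp
    qed
    then show ?thesis using represents_unique_AE[OF r] represents_zero by force
  qed
  then have "AE x in cube. \<forall>m. (LINT y|cube. F (x, y) * cnj (fexp m y)) = 0"
    by (simp add: AE_all_countable)
  then have ae: "AE x in cube. AE y in cube. F (x, y) = 0"
    using square_integrable_slices(2)[OF represents_square_integrable[OF F]]
  proof eventually_elim
    case (elim x)
    note r = represents_cls[OF elim(2)]
    have "cls (\<lambda>y. F (x, y)) = 0"
      by (rule fourier_total) (use elim(1) in \<open>simp add: cinner_eq[OF r represents_fbasis]\<close>)
    then show ?case using represents_unique_AE[OF r] represents_zero by force
  qed
  have m: "{p \<in> space cube. F p = 0} \<in> sets cube"
    using square_integrable_measurable[OF represents_square_integrable[OF F]] by measurable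
  have "AE p in cube. F p = 0"
    using m ae unfolding cube_real_prod by (rule unit_square.AE_pair_measure)
  from represents_AE_cong[OF F square_integrable_zero this]
  show ?thesis using represents_zero represents_eq by blast
qed

section \<open>Primitives in the first variable\<close>

lemma measurable_ident_cube [measurable]: "(\<lambda>x. x) \<in> borel_measurable (cube :: 'a::euclidean_space measure)"
  by (intro measurable_restrict_space1) simp

lemma AE_cube_neq: "AE s in (cube :: real measure). s \<noteq> t"
proof -
  have cb: "cbox 0 (One :: real) \<inter> space lborel \<in> sets lborel" by simp
  have "AE s in lborel. s \<in> cbox 0 One \<longrightarrow> s \<noteq> t"
    using AE_lborel_singleton[of t] by eventually_elim simp
  then show ?thesis by (simp only: AE_restrict_space_iff[OF cb])
qed

lemma integral_power2_le:
  assumes "square_integrable (f :: real \<Rightarrow> complex)"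
  shows "(LINT x|cube. cmod (f x))\<^sup>2 \<le> (LINT x|cube. (cmod (f x))\<^sup>2)"
proof -
  have "square_integrable (\<lambda>x. of_real (cmod (f x)))"
    using assms by (auto simp: square_integrable_def)
  note r = represents_cls[OF this]
  have "norm (fbasis 0) \<le> 1" by (rule norm_le_of_bound[OF represents_fbasis]) (auto simp: norm_fexp)
  then have "cmod (cinner (cls (\<lambda>x. of_real (cmod (f x)))) (fbasis 0)) \<le> norm (cls (\<lambda>x. complex_of_real (cmod (f x)))) * 1"
    by (intro order_trans[OF norm_cinner_le] mult_left_mono) auto
  then have "(cmod (cinner (cls (\<lambda>x. of_real (cmod (f x)))) (fbasis 0)))\<^sup>2 \<le> (norm (cls (\<lambda>x. complex_of_real (cmod (f x)))))\<^sup>2"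
    by (intro power_mono) auto
  then show ?thesis
    unfolding cinner_eq[OF r represents_fbasis] norm_cube_L2_power2[OF r]
    by (simp add: fexp_def)
qed

text \<open>The primitive in x from 0. The upper limit sits in the integrand while the domain stays
  fixed, which gives joint measurability and makes dominated convergence and Fubini directly
  applicable.\<close>

definition prim :: "(real \<times> real \<Rightarrow> complex) \<Rightarrow> real \<times> real \<Rightarrow> complex"
  where "prim G p = (LINT s|cube. (if s \<le> fst p then G (s, snd p) else 0))"

lemma prim_Pair: "prim G (x, y) = (LINT s|cube. (if s \<le> x then G (s, y) else 0))"
  by (simp only: prim_def fst_conv snd_conv)

definition integral_x :: "(real \<times> real \<Rightarrow> complex) \<Rightarrow> real \<Rightarrow> complex"
  where "integral_x G y = (LINT s|cube. G (s, y))"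

lemma integrable_cube_compose_snd:
  fixes h :: "real \<Rightarrow> real"
  assumes "integrable cube h"
  shows "integrable cube (\<lambda>p :: real \<times> real. h (snd p))"
proof -
  have [measurable]: "h \<in> borel_measurable cube" using assms by auto
  have "integrable (cube \<Otimes>\<^sub>M cube) (\<lambda>p :: real \<times> real. h (snd p))"
  proof (rule unit_square.Fubini_integrable)
    show "integrable (cube :: real measure) (\<lambda>x. LINT y|cube. norm (h (snd (x, y))))" by simp
    show "AE x in (cube :: real measure). integrable cube (\<lambda>y. h (snd (x, y)))" using assms by simp
  qed measurable
  then show ?thesis by (simp only: cube_real_prod)
qed

lemma square_integrable_prim:
  assumes G: "square_integrable G"
  shows "square_integrable (prim G)"
proof -
  have m[measurable]: "G \<in> borel_measurable (cube \<Otimes>\<^sub>M cube)"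
    using G unfolding square_integrable_def cube_real_prod by auto
  have mp: "prim G \<in> borel_measurable (cube \<Otimes>\<^sub>M cube)"
    unfolding prim_def[abs_def] by measurable
  have iG: "integrable cube (\<lambda>p. (cmod (G p))\<^sup>2)" using G by (simp add: square_integrable_def)
  have "integrable cube (\<lambda>p :: real \<times> real. LINT x|cube. (cmod (G (x, snd p)))\<^sup>2)"
    using integrable_cube_compose_snd[OF integrable_cube_slices(3)[OF iG]] .
  then have "integrable cube (\<lambda>p. (cmod (prim G p))\<^sup>2)"
  proof (rule Bochner_Integration.integrable_bound)
    show "(\<lambda>p. (cmod (prim G p))\<^sup>2) \<in> borel_measurable cube" using mp unfolding cube_real_prod by measurable
    have "AE p in (cube :: (real \<times> real) measure). square_integrable (\<lambda>x. G (x, snd p))"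
      by (rule AE_cube_compose_fst(2)[OF square_integrable_slices(1)[OF G]])
    then show "AE p in cube. norm ((cmod (prim G p))\<^sup>2) \<le> norm (LINT x|cube. (cmod (G (x, snd p)))\<^sup>2)"
    proof eventually_elim
      case (elim p)
      have "cmod (prim G p) \<le> (LINT s|cube. cmod (if s \<le> fst p then G (s, snd p) else 0))"
        unfolding prim_def by (rule integral_norm_bound)
      also have "\<dots> \<le> (LINT s|cube. cmod (G (s, snd p)))"
        by (rule integral_mono_AE') (use square_integrable_integrable[OF elim] in auto)
      finally have "(cmod (prim G p))\<^sup>2 \<le> (LINT s|cube. cmod (G (s, snd p)))\<^sup>2" by (intro power_mono) auto
      also have "\<dots> \<le> (LINT x|cube. (cmod (G (x, snd p)))\<^sup>2)" by (rule integral_power2_le[OF elim])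
      finally show ?case by simp
    qed
  qed
  with mp show ?thesis by (simp add: square_integrable_def cube_real_prod)
qed

lemma prim_1: "prim G (1, y) = integral_x G y"
  unfolding prim_Pair integral_x_def
  by (intro Bochner_Integration.integral_cong) (auto simp: space_cube_real)

lemma prim_0: "prim G (0, y) = 0"
proof -
  have "AE s in cube. (if s \<le> 0 then G (s, y) else 0) = 0"
    using AE_cube_neq[of 0] AE_space[of "cube :: real measure"]
    by eventually_elim (auto simp: cbox_0_One_real)
  then show ?thesis unfolding prim_Pair by (rule integral_eq_zero_AE)
qed

lemma continuous_on_indefinite_integral:
  fixes \<gamma> :: "real \<Rightarrow> complex"
  assumes \<gamma>: "integrable cube \<gamma>"
  shows "continuous_on S (\<lambda>x. LINT s|cube. (if s \<le> x then \<gamma> s else 0))"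
  unfolding continuous_on_sequentially
proof (intro allI ballI impI, elim conjE)
  fix u :: "nat \<Rightarrow> real" and x assume u: "u \<longlonglongrightarrow> x"
  have [measurable]: "\<gamma> \<in> borel_measurable cube" using \<gamma> by auto
  show "((\<lambda>x. LINT s|cube. (if s \<le> x then \<gamma> s else 0)) \<circ> u) \<longlonglongrightarrow> (LINT s|cube. (if s \<le> x then \<gamma> s else 0))"
    unfolding o_def
  proof (rule integral_dominated_convergence[where w = "\<lambda>s. cmod (\<gamma> s)"])
    show "(\<lambda>s. if s \<le> x then \<gamma> s else 0) \<in> borel_measurable cube" by measurable
    show "(\<lambda>s. if s \<le> u n then \<gamma> s else 0) \<in> borel_measurable cube" for n by measurable
    show "integrable cube (\<lambda>s. cmod (\<gamma> s))" using \<gamma> by simp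
    show "AE s in cube. norm (if s \<le> u n then \<gamma> s else 0) \<le> cmod (\<gamma> s)" for n by simp
    show "AE s in cube. (\<lambda>n. if s \<le> u n then \<gamma> s else 0) \<longlonglongrightarrow> (if s \<le> x then \<gamma> s else 0)"
      using AE_cube_neq[of x]
    proof eventually_elim
      case (elim s)
      then consider "s < x" | "x < s" by linarith
      then have "\<forall>\<^sub>F n in sequentially. (if s \<le> u n then \<gamma> s else 0) = (if s \<le> x then \<gamma> s else 0)"
      proof cases
        case 1
        show ?thesis using order_tendstoD(1)[OF u 1] by (rule eventually_mono) (use 1 in simp)
      next
        case 2
        show ?thesis using order_tendstoD(2)[OF u 2] by (rule eventually_mono) (use 2 in simp)
      qed
      then show ?case by (rule tendsto_eventually)
    qed
  qed
qed

text \<open>Multipliers without any condition at 0 and 1. Unlike test functions they keep the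
  boundary terms, from which traces are read off.\<close>

definition C1_pair :: "(real \<Rightarrow> complex) \<Rightarrow> (real \<Rightarrow> complex) \<Rightarrow> bool"
  where "C1_pair a a' \<longleftrightarrow> (\<forall>x. (a has_vector_derivative a' x) (at x)) \<and> continuous_on UNIV a'"

lemma C1_pair_continuous: "C1_pair a a' \<Longrightarrow> continuous_on UNIV a" "C1_pair a a' \<Longrightarrow> continuous_on UNIV a'"
  by (auto simp: C1_pair_def intro!: continuous_at_imp_continuous_on intro: has_vector_derivative_continuous)

lemma C1_pair_cnj: "C1_pair a a' \<Longrightarrow> C1_pair (\<lambda>x. cnj (a x)) (\<lambda>x. cnj (a' x))"
  unfolding C1_pair_def
  by (auto intro!: bounded_linear.has_vector_derivative[OF bounded_linear_cnj] continuous_intros)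

lemma C1_pair_integral: "C1_pair a a' \<Longrightarrow> (LINT x|cube. a' x) = a 1 - a 0"
proof -
  assume "C1_pair a a'"
  then have "(LINT x|cube. indicator {0..} x *\<^sub>R a' x) = a 1 - a 0"
    unfolding C1_pair_def by (intro integral_cube_FTC) auto
  moreover have "(LINT x|cube. indicator {0..} x *\<^sub>R a' x) = (LINT x|cube. a' x)"
    by (intro Bochner_Integration.integral_cong) (auto simp: space_cube_real indicator_def)
  ultimately show ?thesis by simp
qed

text \<open>Fubini on the triangle s \<le> x, the integral of \<open>a'\<close> over [s, 1] being
  \<open>a 1 - a s\<close>. Integrability of \<gamma> suffices, and this holds for almost every
  horizontal line of a square integrable function.\<close>

lemma integration_by_parts_line:
  assumes \<gamma>: "integrable cube \<gamma>" and a: "C1_pair a a'"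
  shows "(LINT x|cube. (LINT s|cube. (if s \<le> x then \<gamma> s else 0)) * a' x) =
    (LINT s|cube. \<gamma> s) * a 1 - (LINT s|cube. \<gamma> s * a s)"
proof -
  have m[measurable]: "\<gamma> \<in> borel_measurable cube" "a' \<in> borel_measurable cube"
    using \<gamma> square_integrable_measurable[OF square_integrable_continuous[OF C1_pair_continuous(2)[OF a]]] by auto
  have "compact (a' ` {0..1})"
    using C1_pair_continuous(2)[OF a] by (intro compact_continuous_image) (auto intro: continuous_on_subset)
  then obtain B where B: "\<And>x. x \<in> {0..1} \<Longrightarrow> cmod (a' x) \<le> B" by (metis compact_imp_bounded bounded_iff imageI)
  define f where "f = (\<lambda>x s. (if s \<le> x then \<gamma> s else 0) * a' x)"
  have "integrable (cube :: (real \<times> real) measure) (\<lambda>p. cmod (\<gamma> (snd p)) * B)"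
    using integrable_cube_compose_snd[of "\<lambda>s. cmod (\<gamma> s)"] \<gamma> by simp
  then have "integrable (cube \<Otimes>\<^sub>M cube) (\<lambda>p :: real \<times> real. cmod (\<gamma> (snd p)) * B)" by (simp only: cube_real_prod)
  then have fi: "integrable (cube \<Otimes>\<^sub>M cube) (case_prod f)"
  proof (rule Bochner_Integration.integrable_bound)
    show "case_prod f \<in> borel_measurable (cube \<Otimes>\<^sub>M cube)" unfolding f_def by measurable
    have B0: "0 \<le> B" using order_trans[OF norm_ge_zero B[of 0]] by simp
    show "AE p in cube \<Otimes>\<^sub>M cube. norm (case_prod f p) \<le> norm (cmod (\<gamma> (snd p)) * B)"
    proof (rule AE_I2)
      fix p assume "p \<in> space (cube \<Otimes>\<^sub>M cube :: (real \<times> real) measure)"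
      then have "fst p \<in> {0..1}" by (auto simp: space_pair_measure space_cube_real cbox_0_One_real)
      from B[OF this] B0 show "norm (case_prod f p) \<le> norm (cmod (\<gamma> (snd p)) * B)"
        by (auto simp: f_def norm_mult split_beta abs_mult intro!: mult_left_mono)
    qed
  qed
  have "(LINT x|cube. (LINT s|cube. (if s \<le> x then \<gamma> s else 0)) * a' x) = (LINT x|cube. LINT s|cube. f x s)"
    unfolding f_def by simp
  also have "\<dots> = (LINT s|cube. LINT x|cube. f x s)"
    by (rule unit_square.Fubini_integral[OF fi, symmetric])
  also have "\<dots> = (LINT s|cube. \<gamma> s * a 1 - \<gamma> s * a s)"
  proof (rule Bochner_Integration.integral_cong[OF refl])
    fix s :: real assume "s \<in> space cube"
    then have s: "s \<in> {0..1}" by (simp add: cbox_0_One_real)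
    have "(LINT x|cube. f x s) = (LINT x|cube. \<gamma> s * (indicator {s..} x *\<^sub>R a' x))"
      by (intro Bochner_Integration.integral_cong) (auto simp: f_def)
    also have "\<dots> = \<gamma> s * (LINT x|cube. indicator {s..} x *\<^sub>R a' x)"
      by (rule integral_mult_right_zero)
    also have "\<dots> = \<gamma> s * (a 1 - a s)"
      using integral_cube_FTC[OF s, of a a'] a by (simp add: C1_pair_def)
    finally show "(LINT x|cube. f x s) = \<gamma> s * a 1 - \<gamma> s * a s" by (simp add: right_diff_distrib)
  qed
  also have "\<dots> = (LINT s|cube. \<gamma> s * a 1) - (LINT s|cube. \<gamma> s * a s)"
  proof (rule Bochner_Integration.integral_diff)
    have "compact (a ` {0..1})"
      using C1_pair_continuous(1)[OF a] by (intro compact_continuous_image) (auto intro: continuous_on_subset)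
    then obtain C where C: "\<And>x. x \<in> {0..1} \<Longrightarrow> cmod (a x) \<le> C" by (metis compact_imp_bounded bounded_iff imageI)
    have [measurable]: "a \<in> borel_measurable cube"
      using square_integrable_measurable[OF square_integrable_continuous[OF C1_pair_continuous(1)[OF a]]] .
    have "integrable cube (\<lambda>s. C *\<^sub>R cmod (\<gamma> s))" using \<gamma> by simp
    then show "integrable cube (\<lambda>s. \<gamma> s * a s)"
    proof (rule Bochner_Integration.integrable_bound)
      show "AE s in cube. norm (\<gamma> s * a s) \<le> norm (C *\<^sub>R cmod (\<gamma> s))"
      proof (rule AE_I2)
        fix s :: real assume "s \<in> space cube"
        then have "cmod (a s) \<le> C" by (intro C) (simp add: cbox_0_One_real)
        then show "norm (\<gamma> s * a s) \<le> norm (C *\<^sub>R cmod (\<gamma> s))"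
          using mult_left_mono[of "cmod (a s)" "\<bar>C\<bar>" "cmod (\<gamma> s)"] by (simp add: norm_mult abs_mult mult.commute)
      qed
    qed measurable
  qed (use \<gamma> in simp)
  finally show ?thesis by simp
qed

text \<open>The function with trace \<open>C\<close> at \<open>x = 0\<close> and derivative \<open>G\<close>.\<close>

context
  fixes C :: "real \<Rightarrow> complex" and c :: "real cube_L2" and G :: "real \<times> real \<Rightarrow> complex" and g :: "(real \<times> real) cube_L2"
  assumes C: "represents C c" and G: "represents G g"
begin

definition F0 :: "real \<times> real \<Rightarrow> complex" where "F0 p = C (snd p) + prim G p"

lemma represents_F0: "represents F0 (cls F0)"
proof (rule represents_cls)
  have "square_integrable (\<lambda>p :: real \<times> real. 1 * C (snd p))"
    by (rule square_integrable_tensor[OF square_integrable_const represents_square_integrable[OF C]])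
  then show "square_integrable F0"
    unfolding F0_def[abs_def] using square_integrable_prim[OF represents_square_integrable[OF G]]
    by (intro square_integrable_add) simp_all
qed

lemma AE_slice_G: "AE y in cube. integrable cube (\<lambda>x. G (x, y))"
  using square_integrable_slices(1)[OF represents_square_integrable[OF G]]
  by eventually_elim (rule square_integrable_integrable)

lemma F0_line:
  assumes G1: "integrable cube (\<lambda>x. G (x, y))" and a: "C1_pair a a'"
  shows "(LINT x|cube. F0 (x, y) * a' x) = (C y + integral_x G y) * a 1 - C y * a 0 - (LINT x|cube. G (x, y) * a x)"
proof -
  have ia': "integrable cube a'"
    by (rule square_integrable_integrable[OF square_integrable_continuous[OF C1_pair_continuous(2)[OF a]]])
  define h where "h = (\<lambda>x. LINT s|cube. (if s \<le> x then G (s, y) else 0))"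
  have "continuous_on UNIV h" unfolding h_def by (rule continuous_on_indefinite_integral[OF G1])
  then have ih: "integrable cube (\<lambda>x. h x * a' x)"
    using C1_pair_continuous(2)[OF a]
    by (intro square_integrable_integrable square_integrable_continuous continuous_intros)
  have "(LINT x|cube. F0 (x, y) * a' x) = (LINT x|cube. C y * a' x + h x * a' x)"
    by (simp add: F0_def prim_Pair h_def distrib_right)
  also have "\<dots> = C y * (LINT x|cube. a' x) + (LINT x|cube. h x * a' x)"
    using ia' ih by simp
  also have "(LINT x|cube. h x * a' x) = integral_x G y * a 1 - (LINT x|cube. G (x, y) * a x)"
    unfolding h_def integration_by_parts_line[OF G1 a] integral_x_def ..
  finally show ?thesis by (simp add: C1_pair_integral[OF a] algebra_simps)
qed

lemma F0_continuous: "AE y in cube. continuous_on {0..1} (\<lambda>x. F0 (x, y))"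
  using AE_slice_G
proof eventually_elim
  case (elim y)
  show ?case unfolding F0_def prim_Pair snd_conv
    by (intro continuous_intros continuous_on_indefinite_integral[OF elim])
qed

lemma F0_0: "F0 (0, y) = C y" and F0_1: "F0 (1, y) = C y + integral_x G y"
  by (simp_all add: F0_def prim_0 prim_1)

lemma represents_integral_x: "represents (integral_x G) (cls (integral_x G))"
proof (rule represents_cls)
  have m[measurable]: "G \<in> borel_measurable (cube \<Otimes>\<^sub>M cube)"
    using represents_square_integrable[OF G] unfolding square_integrable_def cube_real_prod by auto
  have "(\<lambda>p. G (snd p, fst p)) \<in> borel_measurable (cube \<Otimes>\<^sub>M cube)" by measurable
  then have mt: "integral_x G \<in> borel_measurable cube"
    unfolding integral_x_def[abs_def]
    by (intro unit_interval.borel_measurable_lebesgue_integral) (simp add: split_beta')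
  have "integrable cube (\<lambda>y. LINT x|cube. (cmod (G (x, y)))\<^sup>2)"
    using represents_square_integrable[OF G] by (intro integrable_cube_slices(3)) (simp add: square_integrable_def)
  then have "integrable cube (\<lambda>y. (cmod (integral_x G y))\<^sup>2)"
  proof (rule Bochner_Integration.integrable_bound)
    show "AE y in cube. norm ((cmod (integral_x G y))\<^sup>2) \<le> norm (LINT x|cube. (cmod (G (x, y)))\<^sup>2)"
      using square_integrable_slices(1)[OF represents_square_integrable[OF G]]
    proof eventually_elim
      case (elim y)
      have "cmod (integral_x G y) \<le> (LINT s|cube. cmod (G (s, y)))"
        unfolding integral_x_def by (rule integral_norm_bound)
      then have "(cmod (integral_x G y))\<^sup>2 \<le> (LINT s|cube. cmod (G (s, y)))\<^sup>2" by (intro power_mono) auto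
      also have "\<dots> \<le> (LINT x|cube. (cmod (G (x, y)))\<^sup>2)" by (rule integral_power2_le[OF elim])
      finally show ?case by simp
    qed
  qed (use mt in measurable)
  with mt show "square_integrable (integral_x G)" by (simp add: square_integrable_def)
qed

lemma has_trace_F0: "has_trace 0 (cls F0) c" "has_trace 1 (cls F0) (c + cls (integral_x G))"
  unfolding has_trace_def
  using represents_F0 F0_continuous C represents_add[OF C represents_integral_x]
  by (auto intro!: exI[of _ F0] simp: F0_0 F0_1)

lemma cinner_tens_eq':
  assumes f: "represents F f" and a: "represents A a" and k: "represents K k"
  shows "cinner f (tens a k) = (LINT y|cube. (LINT x|cube. F (x, y) * cnj (A x)) * cnj (K y))"
    "integrable cube (\<lambda>y. (LINT x|cube. F (x, y) * cnj (A x)) * cnj (K y))"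
proof -
  note i = square_integrable_mult_cnj[OF represents_square_integrable[OF f] represents_square_integrable[OF represents_tens[OF a k]]]
  have eq: "(LINT x|cube. F (x, y) * cnj (A x * K y)) = (LINT x|cube. F (x, y) * cnj (A x)) * cnj (K y)" for y
  proof -
    have "(LINT x|cube. F (x, y) * cnj (A x * K y)) = (LINT x|cube. (F (x, y) * cnj (A x)) * cnj (K y))"
      by (simp add: mult_ac)
    then show ?thesis by simp
  qed
  have "cinner f (tens a k) = (LINT p|cube. F p * cnj (A (fst p) * K (snd p)))"
    by (rule cinner_eq[OF f represents_tens[OF a k]])
  also have "\<dots> = (LINT y|cube. LINT x|cube. F (x, y) * cnj (A x * K y))"
    using integral_cube(1)[OF i] by simp
  finally show "cinner f (tens a k) = (LINT y|cube. (LINT x|cube. F (x, y) * cnj (A x)) * cnj (K y))"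
    by (simp only: eq)
  show "integrable cube (\<lambda>y. (LINT x|cube. F (x, y) * cnj (A x)) * cnj (K y))"
    using integrable_cube_slices(3)[OF i] by (simp add: eq[simplified])
qed

text \<open>Integration by parts on almost every horizontal line, followed by integration against
  \<open>k\<close> across the lines. The boundary terms show the traces at 1 and 0 as vectors paired
  with \<open>k\<close>.\<close>

lemma F0_green:
  assumes a: "C1_pair a a'"
  shows "cinner g (tens (cls a) k) + cinner (cls F0) (tens (cls a') k) =
    cnj (a 1) * cinner (c + cls (integral_x G)) k - cnj (a 0) * cinner c k"
proof -
  obtain K where K: "represents K k" using representative_exists by metis
  note ra = represents_cls_continuous[OF C1_pair_continuous(1)[OF a]]
  note ra' = represents_cls_continuous[OF C1_pair_continuous(2)[OF a]]
  note ct = represents_add[OF C represents_integral_x]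
  note i = cinner_tens_eq'(2)[OF G ra K] square_integrable_mult_cnj[OF represents_square_integrable[OF C] represents_square_integrable[OF K]]
    square_integrable_mult_cnj[OF represents_square_integrable[OF ct] represents_square_integrable[OF K]]
  have "cinner (cls F0) (tens (cls a') k) = (LINT y|cube. (LINT x|cube. F0 (x, y) * cnj (a' x)) * cnj (K y))"
    by (rule cinner_tens_eq'(1)[OF represents_F0 ra' K])
  also have "\<dots> = (LINT y|cube. cnj (a 1) * ((C y + integral_x G y) * cnj (K y)) - cnj (a 0) * (C y * cnj (K y)) -
      (LINT x|cube. G (x, y) * cnj (a x)) * cnj (K y))"
  proof (rule integral_cong_AE)
    show "(\<lambda>y. (LINT x|cube. F0 (x, y) * cnj (a' x)) * cnj (K y)) \<in> borel_measurable cube"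
      using cinner_tens_eq'(2)[OF represents_F0 ra' K] by auto
    show "(\<lambda>y. cnj (a 1) * ((C y + integral_x G y) * cnj (K y)) - cnj (a 0) * (C y * cnj (K y)) -
      (LINT x|cube. G (x, y) * cnj (a x)) * cnj (K y)) \<in> borel_measurable cube"
      using i by (intro borel_measurable_integrable Bochner_Integration.integrable_diff) auto
    show "AE y in cube. (LINT x|cube. F0 (x, y) * cnj (a' x)) * cnj (K y) =
       cnj (a 1) * ((C y + integral_x G y) * cnj (K y)) - cnj (a 0) * (C y * cnj (K y)) - (LINT x|cube. G (x, y) * cnj (a x)) * cnj (K y)"
      using AE_slice_G
    proof eventually_elim
      case (elim y)
      show ?case unfolding F0_line[OF elim C1_pair_cnj[OF a]] by (simp add: algebra_simps)
    qed
  qed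
  also have "\<dots> = cnj (a 1) * cinner (c + cls (integral_x G)) k - cnj (a 0) * cinner c k - cinner g (tens (cls a) k)"
    unfolding cinner_eq[OF C K] cinner_eq[OF ct K] cinner_tens_eq'(1)[OF G ra K]
    using i by simp
  finally show ?thesis by simp
qed

text \<open>A test function restricted to a horizontal line is C1 and vanishes at both ends, so
  integration by parts leaves no boundary term.\<close>

lemma has_weak_dx_F0: "has_weak_dx (cls F0) g"
  unfolding has_weak_dx_eq[OF represents_F0 G]
proof (intro allI impI)
  fix \<phi> :: "real \<times> real \<Rightarrow> complex" assume t: "test_function \<phi>"
  note si = test_function_square_integrable[OF t]
  have i: "integrable cube (\<lambda>p. F0 p * partial_x \<phi> p)" "integrable cube (\<lambda>p. G p * \<phi> p)"
    using si represents_square_integrable[OF represents_F0] represents_square_integrable[OF G]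
    by (auto intro: square_integrable_mult_integrable)
  have C1: "C1_pair (\<lambda>x. \<phi> (x, y)) (\<lambda>x. partial_x \<phi> (x, y))" for y
    unfolding C1_pair_def
  proof (intro conjI allI)
    fix x
    have "k_smooth (Suc 0) \<phi>" using t unfolding test_function_def by blast
    then have d: "\<phi> differentiable at (x, y)" by simp
    have "((\<lambda>x. (x, y)) has_derivative (\<lambda>h. (h, 0))) (at x)"
      by (auto intro!: derivative_eq_intros)
    from has_derivative_compose[OF this frechet_derivative_works[THEN iffD1, OF d]]
    have "((\<lambda>x. \<phi> (x, y)) has_derivative (\<lambda>h. frechet_derivative \<phi> (at (x, y)) (h, 0))) (at x)" .
    moreover have "frechet_derivative \<phi> (at (x, y)) (h, 0) = h *\<^sub>R partial_x \<phi> (x, y)" for h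
      using linear_scale[OF linear_frechet_derivative[OF d], of h "(1, 0)"] by (simp add: partial_x_def)
    ultimately show "((\<lambda>x. \<phi> (x, y)) has_vector_derivative partial_x \<phi> (x, y)) (at x)"
      by (simp add: has_vector_derivative_def)
  next
    have "continuous_on UNIV (partial_x \<phi>)"
      using t k_smooth_partial_x[of 0 \<phi>] unfolding test_function_def by simp
    then show "continuous_on UNIV (\<lambda>x. partial_x \<phi> (x, y))"
      by (rule continuous_on_compose2) (auto intro!: continuous_intros)
  qed
  have z: "\<phi> (0, y) = 0" "\<phi> (1, y) = 0" for y
  proof -
    have "\<phi> p = 0" if "p \<notin> box 0 One" for p
    proof (rule ccontr)
      assume "\<phi> p \<noteq> 0"
      then have "p \<in> closure {x. \<phi> x \<noteq> 0}" by (intro closure_subset[THEN subsetD]) simp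
      then show False using t that unfolding test_function_def by blast
    qed
    moreover have "(0, y) \<notin> box 0 (One :: real \<times> real)" "(1, y) \<notin> box 0 (One :: real \<times> real)"
      by (auto simp: box_def Basis_prod_def Basis_real_def)
    ultimately show "\<phi> (0, y) = 0" "\<phi> (1, y) = 0" by simp_all
  qed
  have "(LINT p|cube. F0 p * partial_x \<phi> p) = (LINT y|cube. LINT x|cube. F0 (x, y) * partial_x \<phi> (x, y))"
    by (rule integral_cube(1)[OF i(1)])
  also have "\<dots> = (LINT y|cube. - (LINT x|cube. G (x, y) * \<phi> (x, y)))"
  proof (rule integral_cong_AE)
    show "AE y in cube. (LINT x|cube. F0 (x, y) * partial_x \<phi> (x, y)) = - (LINT x|cube. G (x, y) * \<phi> (x, y))"
      using AE_slice_G by eventually_elim (simp add: F0_line[OF _ C1] z)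
  qed (use integrable_cube_slices(3)[OF i(1)] integrable_cube_slices(3)[OF i(2)] in auto)
  also have "\<dots> = - (LINT p|cube. G p * \<phi> p)" using integral_cube(1)[OF i(2)] by simp
  finally show "(LINT p|cube. F0 p * partial_x \<phi> p) = - (LINT p|cube. G p * \<phi> p)" .
qed

end

section \<open>Weak derivatives and traces\<close>

lemma cinner_ext: "(\<And>x. cinner f x = cinner g x) \<Longrightarrow> f = g"
proof -
  assume *: "\<And>x. cinner f x = cinner g x"
  have "inner (f - g) (f - g) = 0"
    using *[of "f - g"] unfolding inner_diff_left by (simp add: inner_cube_L2_def)
  then show ?thesis by simp
qed

lemma Im_cinner: "Im (cinner f g) = inner f (\<i> *\<^sub>C g)"
  by (simp add: inner_cube_L2_def cinner_scaleC_right)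

text \<open>The adjoint for the real inner product already works: testing it with
  \<open>\<i> *\<^sub>C x\<close> recovers the imaginary part.\<close>

lemma cinner_adjoint_exists:
  fixes T :: "'a::euclidean_space cube_L2 \<Rightarrow> 'b::euclidean_space cube_L2"
  assumes T: "bounded_linear T" and TC: "\<And>x. T (\<i> *\<^sub>C x) = \<i> *\<^sub>C T x"
  obtains S where "bounded_linear S" "\<And>f x. cinner f (T x) = cinner (S f) x"
proof -
  obtain S where S: "bounded_linear S" "\<And>x y. inner (T x) y = inner x (S y)"
    by (rule adjoint_exists[OF T]) (rule that, assumption+)
  have "cinner f (T x) = cinner (S f) x" for f x
  proof (rule complex_eqI)
    show "Re (cinner f (T x)) = Re (cinner (S f) x)"
      using S(2)[of x f] by (simp add: inner_cube_L2_def[symmetric] inner_commute)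
    show "Im (cinner f (T x)) = Im (cinner (S f) x)"
      unfolding Im_cinner TC[symmetric] using S(2)[of "\<i> *\<^sub>C x" f] by (simp add: inner_commute)
  qed
  with S(1) show ?thesis by (rule that)
qed

text \<open>\<open>v\<close> is the partial inner product of \<open>f\<close> with \<open>k\<close>
  over the second variable, obtained as an adjoint instead of an integral.\<close>

lemma tens_adjoint_left:
  obtains v where "\<And>a. cinner f (tens a k) = cinner v a"
proof -
  have "bounded_linear (\<lambda>a. tens a k)" by (rule bounded_bilinear.bounded_linear_left[OF bounded_bilinear_tens])
  then obtain S where "\<And>f x. cinner f (tens x k) = cinner (S f) x"
    by (rule cinner_adjoint_exists) (simp_all add: tens_scaleC_left)
  then show ?thesis by (rule that)
qed

lemma tens_adjoint_right:
  obtains v where "\<And>k. cinner f (tens a k) = cinner v k"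
proof -
  have "bounded_linear (tens a)" by (rule bounded_bilinear.bounded_linear_right[OF bounded_bilinear_tens])
  then obtain S where "\<And>f x. cinner f (tens a x) = cinner (S f) x"
    by (rule cinner_adjoint_exists) (simp_all add: tens_scaleC_right)
  then show ?thesis by (rule that)
qed

lemma k_smooth_lincomb:
  "k_smooth k f \<Longrightarrow> k_smooth k g \<Longrightarrow> k_smooth k (\<lambda>x. c * f x + d * g x)"
proof (induction k arbitrary: f g)
  case 0
  then show ?case by (auto intro!: continuous_intros)
next
  case (Suc k)
  have d: "((\<lambda>x. c * f x + d * g x) has_derivative (\<lambda>v. c * frechet_derivative f (at x) v + d * frechet_derivative g (at x) v)) (at x)" for x
    using Suc.prems by (auto intro!: derivative_intros simp: frechet_derivative_works[symmetric])
  have e: "frechet_derivative (\<lambda>x. c * f x + d * g x) (at x) = (\<lambda>v. c * frechet_derivative f (at x) v + d * frechet_derivative g (at x) v)" for x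
    using frechet_derivative_at[OF d] by simp
  have "k_smooth k (\<lambda>x. c * frechet_derivative f (at x) v + d * frechet_derivative g (at x) v)" for v
    using Suc.prems by (intro Suc.IH) auto
  then show ?case using d unfolding k_smooth.simps(2) e differentiable_def by blast
qed

lemma tensor_has_derivative:
  assumes "(a has_vector_derivative a') (at (fst p))" "(b has_vector_derivative b') (at (snd p))"
  shows "((\<lambda>p :: real \<times> real. a (fst p) * b (snd p) :: complex) has_derivative
    (\<lambda>v. of_real (fst v) * (a' * b (snd p)) + of_real (snd v) * (a (fst p) * b'))) (at p)"
proof -
  have 1: "((\<lambda>p. a (fst p)) has_derivative (\<lambda>v. fst v *\<^sub>R a')) (at p)"
    using has_derivative_compose[OF has_derivative_fst[OF has_derivative_ident] assms(1)[unfolded has_vector_derivative_def]] by simp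
  have 2: "((\<lambda>p. b (snd p)) has_derivative (\<lambda>v. snd v *\<^sub>R b')) (at p)"
    using has_derivative_compose[OF has_derivative_snd[OF has_derivative_ident] assms(2)[unfolded has_vector_derivative_def]] by simp
  from has_derivative_mult[OF 1 2] show ?thesis
    by (rule has_derivative_eq_rhs) (auto simp: scaleR_conv_of_real algebra_simps)
qed

lemma k_smooth_tensor:
  "smooth_upto k a \<Longrightarrow> smooth_upto k b \<Longrightarrow> k_smooth k (\<lambda>p :: real \<times> real. a (fst p) * b (snd p))"
proof (induction k arbitrary: a b)
  case 0
  then show ?case
    by (auto intro!: continuous_intros continuous_on_compose2[of UNIV a] continuous_on_compose2[of UNIV b])
next
  case (Suc k)
  then obtain a' b' where *: "\<forall>x. (a has_vector_derivative a' x) (at x)" "smooth_upto k a'"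
    "\<forall>x. (b has_vector_derivative b' x) (at x)" "smooth_upto k b'" by auto
  have d: "((\<lambda>p :: real \<times> real. a (fst p) * b (snd p)) has_derivative
    (\<lambda>v. of_real (fst v) * (a' (fst p) * b (snd p)) + of_real (snd v) * (a (fst p) * b' (snd p)))) (at p)" for p
    using * by (intro tensor_has_derivative) auto
  have e: "frechet_derivative (\<lambda>p :: real \<times> real. a (fst p) * b (snd p)) (at p) =
    (\<lambda>v. of_real (fst v) * (a' (fst p) * b (snd p)) + of_real (snd v) * (a (fst p) * b' (snd p)))" for p
    using frechet_derivative_at[OF d] by simp
  have "k_smooth k (\<lambda>p. of_real (fst v) * (a' (fst p) * b (snd p)) + of_real (snd v) * (a (fst p) * b' (snd p)))" for v :: "real \<times> real"
    using Suc.prems[THEN smooth_upto_mono] * by (intro k_smooth_lincomb Suc.IH) auto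
  then show ?case using d unfolding k_smooth.simps(2) e differentiable_def by blast
qed

lemma test_function_tensor:
  assumes a: "smooth_supported a" and b: "smooth_supported b"
  shows "test_function (\<lambda>p :: real \<times> real. a (fst p) * b (snd p))"
  unfolding test_function_def
proof (intro conjI allI)
  show "k_smooth k (\<lambda>p :: real \<times> real. a (fst p) * b (snd p))" for k
    using a b by (intro k_smooth_tensor) (auto simp: smooth_supported_def)
  obtain d e where d: "d > 0" "\<And>x. a x \<noteq> 0 \<Longrightarrow> d \<le> x \<and> x \<le> 1 - d"
    and e: "e > 0" "\<And>x. b x \<noteq> 0 \<Longrightarrow> e \<le> x \<and> x \<le> 1 - e"
    using a b unfolding smooth_supported_def by metis
  have "closure {p :: real \<times> real. a (fst p) * b (snd p) \<noteq> 0} \<subseteq> cbox (d, e) (1 - d, 1 - e)"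
  proof (rule closure_minimal)
    show "{p :: real \<times> real. a (fst p) * b (snd p) \<noteq> 0} \<subseteq> cbox (d, e) (1 - d, 1 - e)"
      using d(2) e(2) by (auto simp: cbox_Pair_eq box_real)
  qed (rule closed_cbox)
  also have "\<dots> \<subseteq> box 0 One"
    using d(1) e(1) by (auto simp: box_def cbox_def Basis_prod_def Basis_real_def)
  finally show "closure {p :: real \<times> real. a (fst p) * b (snd p) \<noteq> 0} \<subseteq> box 0 One" .
qed

lemma partial_x_tensor:
  assumes "\<And>x. (a has_vector_derivative a' x) (at x)" "smooth_supported b"
  shows "partial_x (\<lambda>p. a (fst p) * b (snd p)) p = a' (fst p) * b (snd p)"
proof -
  have "smooth_upto (Suc 0) b" using assms(2) by (simp only: smooth_supported_def)
  then obtain b' where "(b has_vector_derivative b') (at (snd p))" by auto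
  from frechet_derivative_at[OF tensor_has_derivative[OF assms(1) this], symmetric]
  show ?thesis by (simp add: partial_x_def)
qed

lemma smooth_supported_lincomb:
  assumes "smooth_supported a" "smooth_supported b"
  shows "smooth_supported (\<lambda>x. c * a x + d * b x)"
proof -
  obtain \<delta> \<epsilon> where d: "\<delta> > 0" "\<And>x. a x \<noteq> 0 \<Longrightarrow> \<delta> \<le> x \<and> x \<le> 1 - \<delta>"
    and e: "\<epsilon> > 0" "\<And>x. b x \<noteq> 0 \<Longrightarrow> \<epsilon> \<le> x \<and> x \<le> 1 - \<epsilon>"
    using assms unfolding smooth_supported_def by metis
  have "min \<delta> \<epsilon> \<le> x \<and> x \<le> 1 - min \<delta> \<epsilon>" if "c * a x + d * b x \<noteq> 0" for x
    using d(2)[of x] e(2)[of x] that by (cases "a x = 0") fastforce+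
  then show ?thesis
    using assms d(1) e(1) unfolding smooth_supported_def
    by (auto intro!: smooth_upto_lincomb exI[of _ "min \<delta> \<epsilon>"])
qed

text \<open>The vanishing mean makes the primitive from 0 vanish to the right of the support of
  \<eta> as well as to the left.\<close>

lemma smooth_supported_antiderivative:
  assumes \<eta>: "smooth_supported \<eta>" and 0: "(LINT x|cube. \<eta> x) = 0"
  obtains a where "smooth_supported a" "\<And>x. (a has_vector_derivative \<eta> x) (at x)"
proof -
  have c: "continuous_on S \<eta>" for S
    using smooth_supported_continuous[OF \<eta>] continuous_on_subset by blast
  obtain \<delta> where d: "\<delta> > 0" "\<And>x. \<eta> x \<noteq> 0 \<Longrightarrow> \<delta> \<le> x \<and> x \<le> 1 - \<delta>"
    using \<eta> unfolding smooth_supported_def by blast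
  define J where "J = (\<lambda>x. integral {0..x} \<eta>)"
  have J': "(J has_vector_derivative \<eta> x) (at x within {0..1})" if "x \<in> {0..1}" for x
    unfolding J_def by (rule integral_has_vector_derivative[OF c that])
  have "(LINT x|lborel. indicator {0..1} x *\<^sub>R \<eta> x) = integral {0..1} \<eta>"
    using set_borel_integral_eq_integral(2)[of "{0..1}" \<eta>] borel_integrable_atLeastAtMost'[OF c]
    by (simp add: set_lebesgue_integral_def)
  moreover have "(LINT x|cube. \<eta> x) = (LINT x|lborel. indicator {0..1} x *\<^sub>R \<eta> x)"
  proof -
    have cb: "cbox 0 (One :: real) \<inter> space lborel \<in> sets lborel" by simp
    show ?thesis using integral_restrict_space[OF cb, of \<eta>] by (simp add: cbox_0_One_real)
  qed
  ultimately have J1: "J 1 = 0" using 0 by (simp add: J_def)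
  have Jl: "J x = 0" if "x < \<delta>" for x
  proof -
    have "J x = integral {0..x} (\<lambda>_. 0)"
      unfolding J_def using that d(2) by (intro integral_cong) force
    then show ?thesis by simp
  qed
  have Jr: "J x = 0" if "1 - \<delta> < x" "0 \<le> x" "x \<le> 1" for x
  proof -
    have "J 1 = J x + integral {x..1} \<eta>"
      unfolding J_def using that by (intro Henstock_Kurzweil_Integration.integral_combine[symmetric] integrable_continuous_interval c) auto
    also have "integral {x..1} \<eta> = integral {x..1} (\<lambda>_. 0)"
      using that d(2) by (intro integral_cong) force
    finally show ?thesis using J1 by simp
  qed
  \<comment> \<open>\<open>J\<close> is known to be a primitive on [0,1] only; since it vanishes
    near both ends, its extension by 0 is differentiable everywhere.\<close>
  define a where "a = (\<lambda>x. if 0 < x \<and> x < 1 then J x else 0)"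
  have a': "(a has_vector_derivative \<eta> x) (at x)" for x
  proof -
    consider "0 < x" "x < 1" | "x < \<delta>" | "1 - \<delta> < x" using d(1) by linarith
    then show ?thesis
    proof cases
      case 1
      have "(J has_vector_derivative \<eta> x) (at x)"
        using J'[of x] 1 by (simp add: at_within_Icc_at)
      then show ?thesis
        by (rule has_vector_derivative_transform_within_open[where S = "{0<..<1}"]) (use 1 in \<open>auto simp: a_def\<close>)
    next
      case 2
      have z: "\<eta> x = 0" using d(2)[of x] 2 by force
      have "((\<lambda>_. 0) has_vector_derivative \<eta> x) (at x)" unfolding z by simp
      then show ?thesis
        by (rule has_vector_derivative_transform_within_open[where S = "{..<\<delta>}"]) (use 2 Jl in \<open>auto simp: a_def\<close>)
    next
      case 3
      have z: "\<eta> x = 0" using d(2)[of x] 3 by force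
      have "((\<lambda>_. 0) has_vector_derivative \<eta> x) (at x)" unfolding z by simp
      then show ?thesis
        by (rule has_vector_derivative_transform_within_open[where S = "{1 - \<delta><..}"]) (use 3 Jr in \<open>auto simp: a_def\<close>)
    qed
  qed
  have "smooth_upto k a" for k
  proof (cases k)
    case 0
    then show ?thesis using a' by (auto intro!: continuous_at_imp_continuous_on intro: has_vector_derivative_continuous)
  next
    case (Suc m)
    then show ?thesis using a' \<eta> smooth_upto_SucI[of a \<eta> m] by (simp only: smooth_supported_def)
  qed
  moreover have "\<delta> \<le> x \<and> x \<le> 1 - \<delta>" if "a x \<noteq> 0" for x
    using that Jl[of x] Jr[of x] by (force simp: a_def split: if_splits)
  ultimately have "smooth_supported a" using d(1) unfolding smooth_supported_def by blast
  then show ?thesis using a' by (rule that)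
qed

lemma cnj_smooth_supported: "smooth_supported a \<Longrightarrow> smooth_supported (\<lambda>x. cnj (a x))"
proof -
  have "smooth_upto k a \<Longrightarrow> smooth_upto k (\<lambda>x. cnj (a x))" for k a
  proof (induction k arbitrary: a)
    case 0
    then show ?case by (auto intro!: continuous_intros)
  next
    case (Suc k)
    then obtain a' where "\<forall>x. (a has_vector_derivative a' x) (at x)" "smooth_upto k a'" by auto
    then show ?case
      using Suc.IH by (intro smooth_upto_SucI[of _ "\<lambda>x. cnj (a' x)"] bounded_linear.has_vector_derivative[OF bounded_linear_cnj]) auto
  qed
  then show "smooth_supported a \<Longrightarrow> smooth_supported (\<lambda>x. cnj (a x))" by (simp add: smooth_supported_def)
qed

text \<open>One bump of nonzero mean is fixed. Any other bump, corrected by a multiple of it, has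
  mean 0 and is therefore the derivative of a smooth supported function. So \<open>w\<close> pairs
  with bumps as a constant does, and bumps are total.\<close>

lemma du_bois_reymond:
  fixes w :: "real cube_L2"
  assumes w: "\<And>a a'. smooth_supported a \<Longrightarrow> smooth_supported a' \<Longrightarrow> (\<And>x. (a has_vector_derivative a' x) (at x)) \<Longrightarrow> cinner w (cls a') = 0"
  shows "w = cinner w (fbasis 0) *\<^sub>C fbasis 0"
proof -
  have one: "represents (\<lambda>_. 1) (fbasis 0)" using represents_fbasis[of 0] by (simp add: fexp_def[abs_def])
  have rep: "represents (bump p n) (cls (bump p n))" if "0 \<le> p" "0 < n" for p n
    by (rule represents_cls_continuous[OF smooth_supported_continuous[OF smooth_supported_bump[OF that]]])
  have integ: "(LINT x|cube. bump p n x) = cinner (cls (bump p n)) (fbasis 0)" if "0 \<le> p" "0 < n" for p n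
    using cinner_eq[OF rep[OF that] one] by simp
  obtain q m where q: "0 \<le> q" "0 < m" "cinner (cls (bump q m)) (fbasis 0) \<noteq> 0"
  proof (rule ccontr)
    assume "\<not> thesis"
    then have "cinner (fbasis 0) (cls (bump p n)) = 0" if "0 \<le> p" "0 < n" for p n
      using that \<open>\<And>q m. 0 \<le> q \<Longrightarrow> 0 < m \<Longrightarrow> cinner (cls (bump q m)) (fbasis 0) \<noteq> 0 \<Longrightarrow> thesis\<close>
      by (subst cinner_commute) auto
    then have "fbasis 0 = 0" by (rule total_bump)
    then show False using cinner_fbasis[of 0 0] inner_cube_L2_def[of "fbasis 0" "fbasis 0"] by simp
  qed
  define I where "I = (\<lambda>p n. cinner (cls (bump p n)) (fbasis 0))"
  have key: "I q m * cinner (cls (bump p n)) w = I p n * cinner (cls (bump q m)) w" if p: "0 \<le> p" "0 < n" for p n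
  proof -
    define \<eta> where "\<eta> = (\<lambda>x. I q m * bump p n x + - I p n * bump q m x)"
    have sm: "smooth_supported \<eta>" unfolding \<eta>_def
      using p q by (intro smooth_supported_lincomb smooth_supported_bump)
    have i: "integrable cube (bump p n)" "integrable cube (bump q m)"
      using rep[OF p] rep[OF q(1,2)] by (auto intro: square_integrable_integrable represents_square_integrable)
    have "(LINT x|cube. \<eta> x) = I q m * (LINT x|cube. bump p n x) + - I p n * (LINT x|cube. bump q m x)"
      unfolding \<eta>_def using i by (simp del: mult_minus_left)
    also have "\<dots> = 0" using integ p q by (simp add: I_def)
    finally obtain a where "smooth_supported a" "\<And>x. (a has_vector_derivative \<eta> x) (at x)"
      by (rule smooth_supported_antiderivative[OF sm]) (rule that, assumption+)
    from w[OF this(1) sm this(2)] have "cinner (cls \<eta>) w = 0" by (subst cinner_commute) simp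
    moreover have "cls \<eta> = I q m *\<^sub>C cls (bump p n) + (- I p n) *\<^sub>C cls (bump q m)"
      by (rule represents_eq[OF represents_cls_continuous[OF smooth_supported_continuous[OF sm]]])
        (unfold \<eta>_def, intro represents_add represents_scaleC rep p q)
    ultimately show ?thesis by (simp add: cinner_add_left cinner_scaleC_left)
  qed
  have I: "cinner (cls (bump p n)) (fbasis 0) = I p n" for p n by (simp add: I_def)
  have Iq: "I q m \<noteq> 0" using q(3) by (simp add: I)
  define \<kappa> where "\<kappa> = cnj (cinner (cls (bump q m)) w / I q m)"
  have wk: "w - \<kappa> *\<^sub>C fbasis 0 = 0"
  proof (rule total_bump)
    fix p n assume p: "(0::real) \<le> p" "(0::nat) < n"
    have "cinner (cls (bump p n)) (w + (- \<kappa>) *\<^sub>C fbasis 0) = 0"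
      using key[OF p] Iq by (simp add: cinner_add_right cinner_scaleC_right \<kappa>_def I field_simps)
    then have "cinner (w + (- \<kappa>) *\<^sub>C fbasis 0) (cls (bump p n)) = 0" by (subst cinner_commute) simp
    moreover have "w + (- \<kappa>) *\<^sub>C fbasis 0 = w - \<kappa> *\<^sub>C fbasis 0"
    proof -
      have "(- \<kappa>) *\<^sub>C fbasis 0 + \<kappa> *\<^sub>C fbasis 0 = 0 *\<^sub>C fbasis 0" by (simp only: scaleC_add_left[symmetric]) simp
      also have "\<dots> = 0" using scaleC_add_left[of 0 0 "fbasis 0"] by simp
      finally show ?thesis by (simp add: algebra_simps eq_neg_iff_add_eq_0)
    qed
    ultimately show "cinner (w - \<kappa> *\<^sub>C fbasis 0) (cls (bump p n)) = 0" by simp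
  qed
  then have "w = \<kappa> *\<^sub>C fbasis 0" by simp
  then show ?thesis by (metis cinner_scaleC_left cinner_fbasis mult.right_neutral)
qed

text \<open>Testing with products of a smooth supported function of x and a bump in y separates the
  variables: for each \<open>k\<close> the partial inner product of \<open>u\<close> with
  \<open>k\<close> falls under the one-variable lemma and is constant in x.\<close>

lemma weak_dx_zero_constant:
  assumes U: "represents U u"
    and 0: "\<And>\<phi>. test_function \<phi> \<Longrightarrow> (LINT p|cube. U p * partial_x \<phi> p) = 0"
  obtains c where "u = tens (fbasis 0) c"
proof -
  have z: "cinner u (tens (cls a') k) = 0"
    if a: "smooth_supported a" "smooth_supported a'" "\<And>x. (a has_vector_derivative a' x) (at x)" for a a' k
  proof -
    obtain v where v: "\<And>k. cinner u (tens (cls a') k) = cinner v k" by (rule tens_adjoint_right) (rule that, assumption+)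
    have "v = 0"
    proof (rule total_bump)
      fix p :: real and n :: nat assume p: "0 \<le> p" "0 < n"
      note b = smooth_supported_bump[OF p]
      note ca = cnj_smooth_supported[OF a(1)] cnj_smooth_supported[OF b]
      have d: "((\<lambda>x. cnj (a x)) has_vector_derivative cnj (a' x)) (at x)" for x
        by (rule bounded_linear.has_vector_derivative[OF bounded_linear_cnj a(3)])
      have "cinner v (cls (bump p n)) = cinner u (tens (cls a') (cls (bump p n)))" by (simp add: v)
      also have "\<dots> = (LINT q|cube. U q * cnj (a' (fst q) * bump p n (snd q)))"
        by (rule cinner_eq[OF U represents_tens]) (intro represents_cls_continuous smooth_supported_continuous a(2) b)+
      also have "\<dots> = (LINT q|cube. U q * partial_x (\<lambda>q. cnj (a (fst q)) * cnj (bump p n (snd q))) q)"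
        by (simp add: partial_x_tensor[OF d ca(2)])
      also have "\<dots> = 0" by (rule 0[OF test_function_tensor[OF ca]])
      finally show "cinner v (cls (bump p n)) = 0" .
    qed
    then show ?thesis using v[of k] cinner_scaleC_left[of 0 0 k] by (simp add: scaleC_add_left cinner_add_left[of 0 0 k, simplified])
  qed
  obtain c where c: "\<And>k. cinner u (tens (fbasis 0) k) = cinner c k" by (rule tens_adjoint_right) (rule that, assumption+)
  have "cinner u (tens x k) = cinner (tens (fbasis 0) c) (tens x k)" for x k
  proof -
    obtain w where w: "\<And>x. cinner u (tens x k) = cinner w x" by (rule tens_adjoint_left) (rule that, assumption+)
    have "w = cinner w (fbasis 0) *\<^sub>C fbasis 0"
      by (rule du_bois_reymond) (rule trans[OF w[symmetric] z])
    from arg_cong[OF this, of "\<lambda>v. cinner v x"]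
    have "cinner w x = cinner w (fbasis 0) * cinner (fbasis 0) x" by (simp only: cinner_scaleC_left)
    also have "cinner w (fbasis 0) = cinner c k" by (simp only: w[symmetric] c)
    finally show ?thesis by (simp only: w cinner_tens_tens mult.commute)
  qed
  then have "cinner (u - tens (fbasis 0) c) (tens x k) = 0" for x k
    using cinner_add_left[of "u - tens (fbasis 0) c" "tens (fbasis 0) c" "tens x k"] by simp
  then have "u - tens (fbasis 0) c = 0" by (intro tensor_total)
  then show ?thesis using that by simp
qed

text \<open>Around a point where the two differ, they differ on an interval of positive length
  inside [0,1], even if the point is an endpoint. Endpoints are the case of interest, as traces are
  taken there.\<close>

lemma continuous_AE_eq:
  fixes u v :: "real \<Rightarrow> complex"
  assumes u: "continuous_on {0..1} u" and v: "continuous_on {0..1} v" and ae: "AE x in cube. u x = v x"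
    and x: "x \<in> {0..1}"
  shows "u x = v x"
proof (rule ccontr)
  assume "u x \<noteq> v x"
  then have ne: "u x - v x \<noteq> 0" by simp
  have c: "continuous_on {0..1} (\<lambda>x. u x - v x)" by (intro continuous_intros u v)
  obtain e where e: "e > 0" "\<And>y. y \<in> {0..1} \<Longrightarrow> dist x y < e \<Longrightarrow> u y - v y \<noteq> 0"
    using continuous_on_avoid[OF c x ne] by blast
  define l r where "l = max 0 (x - e)" and "r = min 1 (x + e)"
  have lr: "l < r" using x e(1) by (auto simp: l_def r_def)
  have cb: "cbox 0 (One :: real) \<inter> space lborel \<in> sets lborel" by simp
  have "AE y in lborel. y \<in> cbox 0 One \<longrightarrow> u y = v y"
    using ae by (simp only: AE_restrict_space_iff[OF cb])
  then have "AE y in lborel. y \<notin> {l<..<r}"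
  proof eventually_elim
    case (elim y)
    show ?case
    proof
      assume y: "y \<in> {l<..<r}"
      then have "y \<in> {0..1}" "dist x y < e" by (auto simp: l_def r_def dist_real_def)
      with e(2) elim show False by (auto simp: cbox_0_One_real)
    qed
  qed
  then have "emeasure lborel {l<..<r} = 0"
    by (subst (asm) AE_iff_measurable[where N = "{l<..<r}"]) auto
  then show False using lr by simp
qed

section \<open>Green's identity as a description of the extensions, and operators on the tensor
  product\<close>

section \<open>The selfadjoint extensions in weak form\<close>

lemma has_trace_unique:
  assumes F: "represents F f" "AE y in cube. continuous_on {0..1} (\<lambda>x. F (x, y))"
    and tr: "has_trace t f h" and t: "t \<in> {0..1}" and h': "represents (\<lambda>y. F (t, y)) h'"
  shows "h = h'"
proof -
  obtain F1 where F1: "represents F1 f" "AE y in cube. continuous_on {0..1} (\<lambda>x. F1 (x, y))" "represents (\<lambda>y. F1 (t, y)) h"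
    using tr unfolding has_trace_def by blast
  have "AE y in cube. AE x in cube. F1 (x, y) = F (x, y)"
    by (rule AE_cube_snd[OF represents_unique_AE[OF F1(1) F(1)]])
  with F1(2) F(2) have "AE y in cube. F1 (t, y) = F (t, y)"
  proof eventually_elim
    case (elim y)
    show ?case by (rule continuous_AE_eq[OF elim t])
  qed
  from represents_AE_cong[OF F1(3) represents_square_integrable[OF h'] this]
  show ?thesis using h' by (rule represents_eq)
qed

text \<open>Green's identity against tensors encodes the derivative and both traces at once,
  \<open>c\<close> being the trace at 0 and \<open>V c\<close> the trace at 1. It holds on the
  domain because such an \<open>f\<close> is rebuilt from its derivative and its trace at 0.
  Conversely, multipliers that vanish at 1 identify \<open>f\<close>, and the multiplier x then
  isolates the trace at 1. Only inner products occur, so this form is compatible with adjoints and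
  convergent series.\<close>

lemma P_ext_iff:
  "(f, g) \<in> P_ext V \<longleftrightarrow> (\<exists>c. \<forall>a a' k. C1_pair a a' \<longrightarrow>
    cinner ((\<i> * (2 * pi)) *\<^sub>C g) (tens (cls a) k) + cinner f (tens (cls a') k) =
    cnj (a 1) * cinner (V c) k - cnj (a 0) * cinner c k)"
  (is "_ \<longleftrightarrow> ?R")
proof -
  define g' where "g' = (\<i> * (2 * pi)) *\<^sub>C g"
  obtain G where G: "represents G g'" using representative_exists by metis
  show ?thesis
  proof
    assume "(f, g) \<in> P_ext V"
    then obtain h where wd: "has_weak_dx f g'" and h: "has_trace 0 f h" "has_trace 1 f (V h)"
      unfolding P_ext_def by (auto simp: in_P_max_iff g'_def)
    obtain F where F: "represents F f" using representative_exists by metis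
    \<comment> \<open>The function with the given derivative and trace 0 at x = 0. Its difference
      from \<open>f\<close> has weak derivative 0, hence is constant in x, and the constant is the
      trace \<open>c\<close>.\<close>
    note r0 = represents_F0[OF represents_zero G]
    have z: "(LINT p|cube. (F p - F0 (\<lambda>_. 0) G p) * partial_x \<phi> p) = 0" if t: "test_function \<phi>" for \<phi>
    proof -
      note si = test_function_square_integrable(2)[OF t]
      have "integrable cube (\<lambda>p. F p * partial_x \<phi> p)" "integrable cube (\<lambda>p. F0 (\<lambda>_. 0) G p * partial_x \<phi> p)"
        using F r0 si by (auto intro: square_integrable_mult_integrable represents_square_integrable)
      then have "(LINT p|cube. (F p - F0 (\<lambda>_. 0) G p) * partial_x \<phi> p) =
          (LINT p|cube. F p * partial_x \<phi> p) - (LINT p|cube. F0 (\<lambda>_. 0) G p * partial_x \<phi> p)"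
        by (simp add: left_diff_distrib)
      also have "\<dots> = 0"
        using wd has_weak_dx_F0[OF represents_zero G] t
        unfolding has_weak_dx_eq[OF F G] has_weak_dx_eq[OF r0 G] by simp
      finally show ?thesis .
    qed
    obtain c where c: "f - cls (F0 (\<lambda>_. 0) G) = tens (fbasis 0) c"
      by (rule weak_dx_zero_constant[OF represents_diff[OF F r0] z]) (assumption | rule that)+
    obtain C where C: "represents C c" using representative_exists by metis
    note rF = represents_F0[OF C G]
    have fF: "f = cls (F0 C G)"
    proof -
      have "represents (\<lambda>p. fexp 0 (fst p) * C (snd p) + F0 (\<lambda>_. 0) G p) (tens (fbasis 0) c + cls (F0 (\<lambda>_. 0) G))"
        by (intro represents_add represents_tens represents_fbasis C r0)
      moreover have "(\<lambda>p. fexp 0 (fst p) * C (snd p) + F0 (\<lambda>_. 0) G p) = F0 C G"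
        by (auto simp: F0_def[OF C G] F0_def[OF represents_zero G] fexp_def)
      ultimately have "represents (F0 C G) f" using c by (simp add: algebra_simps)
      then show ?thesis using rF represents_eq by blast
    qed
    note cont = F0_continuous[OF C G]
    have "h = c"
      by (rule has_trace_unique[OF rF cont h(1)[unfolded fF]]) (use C in \<open>simp_all add: F0_0[OF C G]\<close>)
    moreover have "V h = c + cls (integral_x G)"
      by (rule has_trace_unique[OF rF cont h(2)[unfolded fF]])
        (use represents_add[OF C represents_integral_x[OF C G]] in \<open>simp_all add: F0_1[OF C G]\<close>)
    ultimately show ?R
      using F0_green[OF C G] unfolding fF[symmetric] g'_def[symmetric] by (intro exI[of _ c]) simp
  next
    assume ?R
    then obtain c where c: "\<And>a a' k. C1_pair a a' \<Longrightarrow>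
      cinner g' (tens (cls a) k) + cinner f (tens (cls a') k) = cnj (a 1) * cinner (V c) k - cnj (a 0) * cinner c k"
      unfolding g'_def by blast
    obtain C where C: "represents C c" using representative_exists by metis
    note gr = F0_green[OF C G]
    have "f - cls (F0 C G) = 0"
    proof (rule tensor_total)
      fix n k
      \<comment> \<open>The antiderivative of \<open>fexp n\<close> that vanishes at 1: the boundary
        terms at 1, where \<open>V c\<close> occurs, drop out, and those at 0 agree because both
        identities have the same \<open>c\<close>.\<close>
      define a where "a = (\<lambda>x. if n = 0 then of_real x - 1 else (fexp n x - 1) / (\<i> * of_real (2 * pi * of_int n)))"
      have a: "C1_pair a (fexp n)"
        unfolding C1_pair_def
      proof (intro conjI allI continuous_fexp)
        fix x
        show "(a has_vector_derivative fexp n x) (at x)"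
        proof (cases "n = 0")
          case True
          have "((\<lambda>x. complex_of_real x - 1) has_vector_derivative 1) (at x)"
            by (rule has_vector_derivative_real_field) (auto intro!: derivative_eq_intros)
          then show ?thesis using True by (simp add: a_def fexp_def)
        next
          case False
          have "((\<lambda>x. (fexp n x - 1) / (\<i> * of_real (2 * pi * of_int n))) has_vector_derivative
              ((\<i> * of_real (2 * pi * of_int n)) * fexp n x - 0) / (\<i> * of_real (2 * pi * of_int n))) (at x)"
            by (intro has_vector_derivative_divide has_vector_derivative_diff fexp_has_vector_derivative has_vector_derivative_const)
          then show ?thesis using False by (simp add: a_def)
        qed
      qed
      have "a 1 = 0" by (simp add: a_def fexp_0_1)
      then have "cinner g' (tens (cls a) k) + cinner f (tens (fbasis n) k) =
          cinner g' (tens (cls a) k) + cinner (cls (F0 C G)) (tens (fbasis n) k)"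
        unfolding fbasis_def c[OF a] gr[OF a] by simp
      then have "cinner f (tens (fbasis n) k) = cinner (cls (F0 C G)) (tens (fbasis n) k)"
        by (rule add_left_imp_eq)
      then show "cinner (f - cls (F0 C G)) (tens (fbasis n) k) = 0"
        using cinner_add_left[of "f - cls (F0 C G)" "cls (F0 C G)" "tens (fbasis n) k"] by simp
    qed
    then have fF: "f = cls (F0 C G)" by simp
    have "V c = c + cls (integral_x G)"
    proof (rule cinner_ext)
      fix k
      \<comment> \<open>The multiplier x is 0 at 0 and 1 at 1, so only the trace at 1 is
        left.\<close>
      have "C1_pair of_real (\<lambda>_. 1)"
        unfolding C1_pair_def by (auto intro!: has_vector_derivative_real_field derivative_eq_intros)
      from c[OF this, of k] gr[OF this, of k] show "cinner (V c) k = cinner (c + cls (integral_x G)) k"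
        by (simp add: fF)
    qed
    then show "(f, g) \<in> P_ext V"
      using has_weak_dx_F0[OF C G, unfolded g'_def] has_trace_F0[OF C G]
      unfolding P_ext_def fF by (auto simp: in_P_max_iff)
  qed
qed

section \<open>Bounded operators on the tensor product\<close>

definition imag :: "'a::euclidean_space cube_L2 endo"
  where "imag = (SOME T. \<forall>x. T \<cdot> x = \<i> *\<^sub>C x)"

lemma imag_app: "imag \<cdot> x = \<i> *\<^sub>C x"
proof -
  have "linear (\<lambda>x :: 'a cube_L2. \<i> *\<^sub>C x)"
    by (rule linearI) (simp_all add: scaleC_add_right scaleR_cube_L2_def scaleC_scaleC mult.commute)
  then obtain T where "\<And>x :: 'a cube_L2. T \<cdot> x = \<i> *\<^sub>C x"
    by (rule endo_exists[where C = 1]) (auto simp: norm_scaleC)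
  then have "\<forall>x :: 'a cube_L2. imag \<cdot> x = \<i> *\<^sub>C x"
    unfolding imag_def by (intro someI[of "\<lambda>T. \<forall>x. T \<cdot> x = \<i> *\<^sub>C x"]) blast
  then show ?thesis by blast
qed

lemma imag_imag: "imag * imag = (-1 :: 'a::euclidean_space cube_L2 endo)"
proof (rule endo_eqI)
  fix x :: "'a cube_L2"
  have "complex_of_real (- 1) *\<^sub>C x = - x" unfolding scaleR_cube_L2_def[symmetric] by simp
  then show "(imag * imag) \<cdot> x = - 1 \<cdot> x" by (simp add: imag_app scaleC_scaleC)
qed

lemma imag_skew: "inner (imag \<cdot> x) y = - inner x (imag \<cdot> y)"
  by (simp add: imag_app inner_cube_L2_def cinner_scaleC_left cinner_scaleC_right)

lemma scaleC_eq: "c *\<^sub>C x = Re c *\<^sub>R x + Im c *\<^sub>R (imag \<cdot> x)"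
proof -
  have "c = of_real (Re c) + of_real (Im c) * \<i>" by (simp add: complex_eq_iff)
  then have "c *\<^sub>C x = (of_real (Re c) + of_real (Im c) * \<i>) *\<^sub>C x" by (rule arg_cong)
  then show ?thesis by (simp only: scaleC_add_left scaleR_cube_L2_def imag_app scaleC_scaleC)
qed

lemma imag_commute_scaleC:
  assumes "T * imag = imag * T"
  shows "T \<cdot> (c *\<^sub>C x) = c *\<^sub>C (T \<cdot> x)"
  using arg_cong[OF assms, of "\<lambda>S. S \<cdot> x"]
  by (simp add: scaleC_eq app.add_right app.scaleR_right)

lemma cinner_eq_inner: "cinner f g = Complex (inner f g) (inner f (imag \<cdot> g))"
  by (simp add: complex_eq_iff Im_cinner[symmetric] imag_app inner_cube_L2_def[symmetric])

lemma tensor_total_inner: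
  assumes "\<And>n k. inner t (tens (fbasis n) k) = 0"
  shows "t = 0"
proof (rule tensor_total)
  fix n k
  have "imag \<cdot> tens (fbasis n) k = tens (fbasis n) (\<i> *\<^sub>C k)" by (simp add: imag_app tens_scaleC_right)
  then show "cinner t (tens (fbasis n) k) = 0" by (simp add: cinner_eq_inner assms complex_eq_iff)
qed

lemma endo_eq_on_tensors:
  assumes "\<And>n k. S \<cdot> tens (fbasis n) k = T \<cdot> tens (fbasis n) k"
  shows "S = T"
proof (rule endo_eqI)
  fix x
  have "x \<in> {x. S \<cdot> x = T \<cdot> x}"
  proof (rule closed_subspace_eq_UNIV)
    show "subspace {x. S \<cdot> x = T \<cdot> x}"
      by (auto simp: subspace_def app.zero_right app.add_right app.scaleR_right)
    show "closed {x. S \<cdot> x = T \<cdot> x}"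
      by (intro closed_Collect_eq linear_continuous_on app.bounded_linear_right)
    show "t = 0" if "\<And>y. y \<in> {x. S \<cdot> x = T \<cdot> x} \<Longrightarrow> inner t y = 0" for t
      by (rule tensor_total_inner) (use that assms in blast)
  qed
  then show "S \<cdot> x = T \<cdot> x" by simp
qed

lemma norm_fbasis: "norm (fbasis n) = 1"
proof -
  have "norm (fbasis n) = 1 \<or> norm (fbasis n) = - 1"
    using norm_eq_cinner[of "fbasis n"] by (simp add: cinner_fbasis power2_eq_1_iff flip: of_real_power)
  then show ?thesis using norm_ge_zero[of "fbasis n"] by auto
qed

text \<open>\<open>T\<close> is 1 \<otimes> B. The truncations apply \<open>B\<close> to finitely
  many Fourier coefficients in x; orthogonality of the modes and Bessel's inequality bound them by
  the norm of \<open>B\<close>, and on a tensor with a single mode they are eventually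
  constant.\<close>

lemma tensor_lift_exists:
  fixes B :: "real cube_L2 endo"
  assumes BI: "B * imag = imag * B"
  obtains T where "\<And>a k. T \<cdot> tens a k = tens a (B \<cdot> k)" "\<And>f. norm (T \<cdot> f) \<le> norm B * norm f"
    "T * imag = imag * T"
proof -
  have "\<exists>S. bounded_linear S \<and> (\<forall>f x. cinner f (tens (fbasis n) x) = cinner (S f) x)" for n
  proof -
    have "bounded_linear (tens (fbasis n))"
      by (rule bounded_bilinear.bounded_linear_right[OF bounded_bilinear_tens])
    then obtain S where "bounded_linear S" "\<And>f x. cinner f (tens (fbasis n) x) = cinner (S f) x"
      by (rule cinner_adjoint_exists) (simp_all add: tens_scaleC_right)
    then show ?thesis by blast
  qed
  then obtain S where S: "\<And>n. bounded_linear (S n)" "\<And>n f x. cinner f (tens (fbasis n) x) = cinner (S n f) x" by metis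
  have Si: "inner f (tens (fbasis n) x) = inner (S n f) x" for n f x
    using S(2) by (simp add: inner_cube_L2_def)
  have S_tens: "S n (tens a k) = cinner a (fbasis n) *\<^sub>C k" for n a k
    by (rule cinner_ext) (simp add: S(2)[symmetric] cinner_tens_tens cinner_scaleC_left)
  have pyth: "(norm (\<Sum>n\<in>F. tens (fbasis n) (x n)))\<^sup>2 = (\<Sum>n\<in>F. (norm (x n))\<^sup>2)" if "finite F" for F x
  proof -
    have "pairwise (\<lambda>i j. orthogonal (tens (fbasis i) (x i)) (tens (fbasis j) (x j))) F"
      by (auto simp: pairwise_def orthogonal_def inner_cube_L2_def cinner_tens_tens cinner_fbasis)
    from norm_sum_Pythagorean[OF that this] show ?thesis by (simp add: norm_tens norm_fbasis)
  qed
  define F where "F = (\<lambda>N. {- int N..int N})"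
  define TN where "TN = (\<lambda>N f. \<Sum>n\<in>F N. tens (fbasis n) (B \<cdot> S n f))"
  have bessel: "(\<Sum>n\<in>F N. (norm (S n f))\<^sup>2) \<le> (norm f)\<^sup>2" for N f
  proof -
    define s where "s = (\<Sum>n\<in>F N. tens (fbasis n) (S n f))"
    have s2: "(norm s)\<^sup>2 = (\<Sum>n\<in>F N. (norm (S n f))\<^sup>2)" unfolding s_def by (rule pyth) (simp add: F_def)
    also have "\<dots> = inner f s" unfolding s_def inner_sum_right by (simp add: Si power2_norm_eq_inner)
    also have "\<dots> \<le> norm f * norm s" by (rule norm_cauchy_schwarz)
    finally have "norm s * norm s \<le> norm f * norm s" by (simp add: power2_eq_square)
    then have "norm s \<le> norm f" by (cases "norm s = 0") auto
    then have "(norm s)\<^sup>2 \<le> (norm f)\<^sup>2" by (rule power_mono) simp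
    then show ?thesis by (simp only: s2)
  qed
  have TN_lin: "linear (TN N)" for N
    unfolding TN_def
    by (intro linear_compose_sum ballI bounded_linear.linear)
      (intro bounded_linear_compose[OF bounded_bilinear.bounded_linear_right[OF bounded_bilinear_tens]]
        bounded_linear_compose[OF app.bounded_linear_right S(1)])
  have TN_bound: "norm (TN N f) \<le> norm B * norm f" for N f
  proof (rule power2_le_imp_le)
    have "(norm (TN N f))\<^sup>2 = (\<Sum>n\<in>F N. (norm (B \<cdot> S n f))\<^sup>2)"
      unfolding TN_def by (rule pyth) (simp add: F_def)
    also have "\<dots> \<le> (\<Sum>n\<in>F N. (norm B)\<^sup>2 * (norm (S n f))\<^sup>2)"
      unfolding power_mult_distrib[symmetric] by (intro sum_mono power_mono norm_app) simp
    also have "\<dots> \<le> (norm B)\<^sup>2 * (norm f)\<^sup>2"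
      unfolding sum_distrib_left[symmetric] by (intro mult_left_mono bessel) simp
    finally show "(norm (TN N f))\<^sup>2 \<le> (norm B * norm f)\<^sup>2" by (simp add: power_mult_distrib)
  qed simp
  have mF: "m \<in> F N" "finite (F N)" if "nat \<bar>m\<bar> \<le> N" for m N
    using that by (auto simp: F_def)
  have TN_fix: "TN N (tens (fbasis m) k) = tens (fbasis m) (B \<cdot> k)" if "nat \<bar>m\<bar> \<le> N" for N m k
  proof -
    have "TN N (tens (fbasis m) k) = (\<Sum>n\<in>F N. if n = m then tens (fbasis m) (B \<cdot> k) else 0)"
      unfolding TN_def
    proof (rule sum.cong[OF refl])
      fix n
      have "B \<cdot> S n (tens (fbasis m) k) = cinner (fbasis m) (fbasis n) *\<^sub>C (B \<cdot> k)"
        by (simp only: S_tens imag_commute_scaleC[OF BI])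
      moreover have "0 *\<^sub>C x = 0" "1 *\<^sub>C x = x" for x :: "real cube_L2"
        using scaleR_cube_L2_def[of 0 x] scaleR_cube_L2_def[of 1 x] by simp_all
      ultimately show "tens (fbasis n) (B \<cdot> S n (tens (fbasis m) k)) = (if n = m then tens (fbasis m) (B \<cdot> k) else 0)"
        by (simp add: cinner_fbasis bounded_bilinear.zero_right[OF bounded_bilinear_tens])
    qed
    also have "\<dots> = tens (fbasis m) (B \<cdot> k)" using mF[OF that] by simp
    finally show ?thesis .
  qed
  obtain L where L: "linear L" "\<And>f. norm (L f) \<le> norm B * norm f" "\<And>f. (\<lambda>N. TN N f) \<longlonglongrightarrow> L f"
  proof (rule strong_limit_exists[OF TN_lin TN_bound])
    fix t assume t: "\<And>y. convergent (\<lambda>N. TN N y) \<Longrightarrow> inner t y = 0"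
    show "t = 0"
    proof (rule tensor_total_inner, rule t)
      fix n k
      have "\<forall>\<^sub>F N in sequentially. TN N (tens (fbasis n) k) = tens (fbasis n) (B \<cdot> k)"
        using eventually_ge_at_top[of "nat \<bar>n\<bar>"] by eventually_elim (rule TN_fix)
      then show "convergent (\<lambda>N. TN N (tens (fbasis n) k))"
        unfolding convergent_def by (intro exI tendsto_eventually)
    qed
  qed (rule that, assumption+)
  obtain T where T: "\<And>f. T \<cdot> f = L f" using endo_exists[OF L(1,2)] by blast
  \<comment> \<open>The m-th coefficient of the limit is \<open>B\<close> applied to the m-th
    coefficient of \<open>f\<close>; this yields the formula on \<open>tens a k\<close> for every
    \<open>a\<close>, not only for the modes.\<close>
  have ST: "cinner (T \<cdot> f) (tens (fbasis m) x) = cinner (B \<cdot> S m f) x" for f m x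
  proof -
    have c: "cinner (TN N f) (tens (fbasis m) x) = cinner (B \<cdot> S m f) x" if "nat \<bar>m\<bar> \<le> N" for N
    proof -
      have "cinner (sum g A) y = (\<Sum>n\<in>A. cinner (g n) y)" if "finite A" for g :: "int \<Rightarrow> (real \<times> real) cube_L2" and A y
        using that cinner_add_left[of 0 0 y] by (induction A) (simp_all add: cinner_add_left)
      then have "cinner (TN N f) (tens (fbasis m) x) = (\<Sum>n\<in>F N. cinner (fbasis n) (fbasis m) * cinner (B \<cdot> S n f) x)"
        unfolding TN_def by (simp add: F_def cinner_tens_tens)
      also have "\<dots> = (\<Sum>n\<in>F N. if n = m then cinner (B \<cdot> S m f) x else 0)"
        by (intro sum.cong) (auto simp: cinner_fbasis)
      also have "\<dots> = cinner (B \<cdot> S m f) x" using mF[OF that] by simp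
      finally show ?thesis .
    qed
    have "(\<lambda>N. cinner (TN N f) (tens (fbasis m) x)) \<longlonglongrightarrow> cinner (T \<cdot> f) (tens (fbasis m) x)"
      unfolding cinner_eq_inner T by (intro tendsto_Complex tendsto_inner tendsto_const L(3))
    moreover have "(\<lambda>N. cinner (TN N f) (tens (fbasis m) x)) \<longlonglongrightarrow> cinner (B \<cdot> S m f) x"
      using eventually_ge_at_top[of "nat \<bar>m\<bar>"] by (intro tendsto_eventually, eventually_elim) (rule c)
    ultimately show ?thesis by (rule LIMSEQ_unique)
  qed
  have eqI: "f = g" if "\<And>n k. cinner f (tens (fbasis n) k) = cinner g (tens (fbasis n) k)" for f g
  proof -
    have "f - g = 0"
      by (rule tensor_total) (use that cinner_add_left[of "f - g" g] in simp)
    then show ?thesis by simp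
  qed
  show ?thesis
  proof (rule that[of T])
    show T_tens: "T \<cdot> tens a k = tens a (B \<cdot> k)" for a k
      by (rule eqI) (simp add: ST S_tens imag_commute_scaleC[OF BI] cinner_tens_tens cinner_scaleC_left)
    show "norm (T \<cdot> f) \<le> norm B * norm f" for f by (simp add: T L(2))
    show "T * imag = imag * T"
      by (rule endo_eq_on_tensors)
        (simp add: imag_app tens_scaleC_right[symmetric] T_tens imag_commute_scaleC[OF BI])
  qed
qed

text \<open>Both sides are continuous and linear in each argument, so tensors suffice, one argument
  at a time.\<close>

lemma tensor_lift_adjoint:
  assumes T: "\<And>a k. T \<cdot> tens a k = tens a (B \<cdot> k)" and T': "\<And>a k. T' \<cdot> tens a k = tens a (B' \<cdot> k)"
    and B: "\<And>x y. inner (B \<cdot> x) y = inner x (B' \<cdot> y)" and BI: "B * imag = imag * B" and BI': "B' * imag = imag * B'"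
  shows "inner (T \<cdot> f) g = inner f (T' \<cdot> g)"
proof -
  have Bapp: "B \<cdot> imag \<cdot> x = imag \<cdot> B \<cdot> x" "B' \<cdot> imag \<cdot> x = imag \<cdot> B' \<cdot> x" for x
    using arg_cong[OF BI, of "\<lambda>S. S \<cdot> x"] arg_cong[OF BI', of "\<lambda>S. S \<cdot> x"] by simp_all
  have cB: "cinner (B \<cdot> x) y = cinner x (B' \<cdot> y)" for x y
    by (simp add: cinner_eq_inner B Bapp)
  have base: "inner (T \<cdot> tens a k) (tens b l) = inner (tens a k) (T' \<cdot> tens b l)" for a k b l
    by (simp add: inner_cube_L2_def T T' cinner_tens_tens cB)
  have closed_sub: "f \<in> {f. \<phi> f = \<psi> f}" if "bounded_linear \<phi>" "bounded_linear \<psi>" "\<And>n k. \<phi> (tens (fbasis n) k) = \<psi> (tens (fbasis n) k)"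
    for \<phi> \<psi> :: "(real \<times> real) cube_L2 \<Rightarrow> real" and f
  proof (rule closed_subspace_eq_UNIV)
    note l = bounded_linear.linear[OF that(1)] bounded_linear.linear[OF that(2)]
    show "subspace {f. \<phi> f = \<psi> f}"
      using l by (auto simp: subspace_def linear_0 linear_add linear_scale)
    show "closed {f. \<phi> f = \<psi> f}" using that by (intro closed_Collect_eq linear_continuous_on)
    show "t = 0" if "\<And>y. y \<in> {f. \<phi> f = \<psi> f} \<Longrightarrow> inner t y = 0" for t
      by (rule tensor_total_inner) (use that \<open>\<And>n k. \<phi> (tens (fbasis n) k) = \<psi> (tens (fbasis n) k)\<close> in blast)
  qed
  have 1: "inner (T \<cdot> f) (tens b l) = inner f (T' \<cdot> tens b l)" for f b l
    using closed_sub[of "\<lambda>f. inner (T \<cdot> f) (tens b l)" "\<lambda>f. inner f (T' \<cdot> tens b l)" f] base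
    by (simp add: bounded_linear_inner_left bounded_linear_compose[OF bounded_linear_inner_left app.bounded_linear_right])
  show ?thesis
    using closed_sub[of "\<lambda>g. inner (T \<cdot> f) g" "\<lambda>g. inner f (T' \<cdot> g)" g] 1
    by (simp add: bounded_linear_inner_right bounded_linear_compose[OF bounded_linear_inner_right app.bounded_linear_right])
qed

lemma space_cube_prod: "space (cube :: (real \<times> real) measure) = {0..1} \<times> {0..1}"
  by (rule trans[OF space_cube cbox_0_One_prod])

lemma square_integrable_mult_x:
  assumes "square_integrable (f :: real \<times> real \<Rightarrow> complex)"
  shows "square_integrable (\<lambda>p. of_real (fst p) * f p)"
proof -
  have m[measurable]: "f \<in> borel_measurable cube" and i: "integrable cube (\<lambda>p. (cmod (f p))\<^sup>2)"
    using assms by (auto simp: square_integrable_def)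
  have [measurable]: "(\<lambda>p :: real \<times> real. complex_of_real (fst p)) \<in> borel_measurable cube"
    by (rule square_integrable_measurable[OF square_integrable_continuous]) (intro continuous_intros)
  have "integrable cube (\<lambda>p. (cmod (of_real (fst p) * f p))\<^sup>2)"
  proof (rule Bochner_Integration.integrable_bound[OF i])
    show "AE p in cube. norm ((cmod (of_real (fst p) * f p))\<^sup>2) \<le> norm ((cmod (f p))\<^sup>2)"
    proof (rule AE_I2)
      fix p :: "real \<times> real" assume "p \<in> space cube"
      then have "\<bar>fst p\<bar> \<le> 1" by (auto simp: space_cube_prod)
      then have "cmod (of_real (fst p) * f p) \<le> cmod (f p)" by (simp add: norm_mult mult_left_le_one_le)
      then show "norm ((cmod (of_real (fst p) * f p))\<^sup>2) \<le> norm ((cmod (f p))\<^sup>2)" by (simp add: power_mono)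
    qed
  qed measurable
  then show ?thesis by (simp add: square_integrable_def)
qed

lemma mult_x_exists:
  obtains X :: "(real \<times> real) cube_L2 endo" where
    "\<And>F f. represents F f \<Longrightarrow> represents (\<lambda>p. of_real (fst p) * F p) (X \<cdot> f)"
proof -
  define \<mu> :: "(real \<times> real) cube_L2 \<Rightarrow> (real \<times> real) cube_L2"
    where "\<mu> f = cls (\<lambda>p. of_real (fst p) * (SOME F. represents F f) p)" for f
  have r: "represents (\<lambda>p. of_real (fst p) * F p) (\<mu> f)" if "represents F f" for F f
  proof -
    define F' where "F' = (SOME F. represents F f)"
    have F': "represents F' f" unfolding F'_def by (rule someI_ex[OF representative_exists])
    have "represents (\<lambda>p. of_real (fst p) * F' p) (\<mu> f)"
      unfolding \<mu>_def F'_def[symmetric]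
      by (rule represents_cls[OF square_integrable_mult_x[OF represents_square_integrable[OF F']]])
    moreover have "AE p in cube. of_real (fst p) * F' p = of_real (fst p) * F p"
      using represents_unique_AE[OF F' that] by eventually_elim simp
    ultimately show ?thesis
      by (rule represents_AE_cong[OF _ square_integrable_mult_x[OF represents_square_integrable[OF that]]])
  qed
  have "linear \<mu>"
  proof (rule linearI)
    fix f g :: "(real \<times> real) cube_L2" and c :: real
    obtain F G where FG: "represents F f" "represents G g" using representative_exists by metis
    show "\<mu> (f + g) = \<mu> f + \<mu> g"
      using represents_eq[OF r[OF represents_add[OF FG]]] represents_add[OF r[OF FG(1)] r[OF FG(2)]]
      by (simp add: distrib_left)
    show "\<mu> (c *\<^sub>R f) = c *\<^sub>R \<mu> f"
      unfolding scaleR_cube_L2_def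
      using represents_eq[OF r[OF represents_scaleC[OF FG(1), of "of_real c"]]] represents_scaleC[OF r[OF FG(1)], of "of_real c"]
      by (simp add: mult.left_commute)
  qed
  moreover have bd: "norm (\<mu> f) \<le> 1 * norm f" for f
  proof -
    obtain F where F: "represents F f" using representative_exists by metis
    have "(norm (\<mu> f))\<^sup>2 \<le> (norm f)\<^sup>2"
      unfolding norm_cube_L2_power2[OF F] norm_cube_L2_power2[OF r[OF F]]
    proof (rule integral_mono)
      show "integrable cube (\<lambda>p. (cmod (of_real (fst p) * F p))\<^sup>2)" "integrable cube (\<lambda>p. (cmod (F p))\<^sup>2)"
        using represents_square_integrable[OF F] represents_square_integrable[OF r[OF F]] by (auto simp: square_integrable_def)
      fix p :: "real \<times> real" assume "p \<in> space cube"
      then have "\<bar>fst p\<bar> \<le> 1" by (auto simp: space_cube_prod)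
      then show "(cmod (of_real (fst p) * F p))\<^sup>2 \<le> (cmod (F p))\<^sup>2"
        by (intro power_mono) (simp_all add: norm_mult mult_left_le_one_le)
    qed
    from power2_le_imp_le[OF this norm_ge_zero] show ?thesis by simp
  qed
  ultimately obtain X where X: "\<And>f. X \<cdot> f = \<mu> f" using endo_exists[of \<mu> 1] by blast
  show ?thesis by (rule that[of X]) (simp add: X r)
qed

lemma exp_adjoint:
  fixes Q Q' :: "'a::{real_inner,banach,perfect_space} endo"
  assumes Q: "\<And>x y. inner (Q \<cdot> x) y = inner x (Q' \<cdot> y)"
  shows "inner (exp Q \<cdot> x) y = inner x (exp Q' \<cdot> y)"
proof -
  have p: "inner (Q ^ n \<cdot> x) y = inner x (Q' ^ n \<cdot> y)" for n x y
    by (induction n arbitrary: x y) (simp, subst power_Suc2, simp add: Q)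
  have s: "(\<lambda>n. (R ^ n /\<^sub>R fact n) \<cdot> z) sums (exp R \<cdot> z)" for R :: "'a endo" and z
    by (rule bounded_linear.sums[OF app.bounded_linear_left exp_converges])
  have "(\<lambda>n. inner ((Q ^ n /\<^sub>R fact n) \<cdot> x) y) sums inner (exp Q \<cdot> x) y"
    by (rule bounded_linear.sums[OF bounded_linear_inner_left s])
  moreover have "(\<lambda>n. inner x ((Q' ^ n /\<^sub>R fact n) \<cdot> y)) sums inner x (exp Q' \<cdot> y)"
    by (rule bounded_linear.sums[OF bounded_linear_inner_right s])
  moreover have eq: "inner ((Q ^ n /\<^sub>R fact n) \<cdot> x) y = inner x ((Q' ^ n /\<^sub>R fact n) \<cdot> y)" for n
    using p[of n x y] by simp
  ultimately show ?thesis unfolding eq by (intro sums_unique2)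
qed

section \<open>Operators with spectra meeting only at a common non-eigenvalue\<close>

text \<open>For symmetric \<open>C\<close> the inner product of the 2M-th and the 2N-th image of
  \<open>h\<close> is the squared norm of the (M + N)-th image, a decreasing sequence; this makes
  the even powers Cauchy. Odd powers may have a different limit, since -1 can be an
  eigenvalue.\<close>

lemma contraction_powers_converge:
  fixes C :: "'a::{real_inner,banach,perfect_space} endo"
  assumes sym: "\<And>x y. inner (C \<cdot> x) y = inner x (C \<cdot> y)" and C: "norm C \<le> 1"
  obtains h0 where "(\<lambda>N. C ^ (2 * N) \<cdot> h) \<longlonglongrightarrow> h0" "C \<cdot> C \<cdot> h0 = h0"
proof -
  have symp: "inner (C ^ n \<cdot> x) y = inner x (C ^ n \<cdot> y)" for n x y
    by (induction n arbitrary: x y) (simp, subst power_Suc2, simp add: sym)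
  have Cle: "norm (C \<cdot> x) \<le> norm x" for x
    using norm_app[of C x] C by (meson mult_left_le_one_le norm_ge_zero order_trans)
  define a where "a = (\<lambda>N. (norm (C ^ N \<cdot> h))\<^sup>2)"
  have ip: "inner (C ^ (2 * M) \<cdot> h) (C ^ (2 * N) \<cdot> h) = a (M + N)" for M N
  proof -
    have "inner (C ^ (2 * M) \<cdot> h) (C ^ (2 * N) \<cdot> h) = inner h ((C ^ (2 * M) * C ^ (2 * N)) \<cdot> h)" by (simp add: symp)
    also have "C ^ (2 * M) * C ^ (2 * N) = C ^ (M + N) * C ^ (M + N)"
      by (simp only: power_add[symmetric]) (rule arg_cong[of _ _ "(^) C"], simp)
    also have "inner h ((C ^ (M + N) * C ^ (M + N)) \<cdot> h) = a (M + N)"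
      unfolding a_def power2_norm_eq_inner by (simp add: symp)
    finally show ?thesis .
  qed
  have dec: "decseq a"
    unfolding decseq_Suc_iff a_def using Cle by (auto intro!: power_mono)
  then obtain L where "a \<longlonglongrightarrow> L"
    using decseq_convergent[OF dec, of 0] by (auto simp: a_def)
  then have aC: "Cauchy a" by (auto simp: Cauchy_convergent_iff convergent_def)
  have "Cauchy (\<lambda>N. C ^ (2 * N) \<cdot> h)"
  proof (rule CauchyI)
    fix e :: real assume e: "0 < e"
    obtain N0 where N0: "\<And>m n. m \<ge> N0 \<Longrightarrow> n \<ge> N0 \<Longrightarrow> norm (a m - a n) < e\<^sup>2 / 2"
      using CauchyD[OF aC, of "e\<^sup>2 / 2"] e by auto
    have "norm (C ^ (2 * M) \<cdot> h - C ^ (2 * N) \<cdot> h) < e" if "M \<ge> N0" "N \<ge> N0" for M N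
    proof -
      have "(norm (C ^ (2 * M) \<cdot> h - C ^ (2 * N) \<cdot> h))\<^sup>2 = (a (M + M) - a (M + N)) + (a (N + N) - a (M + N))"
        unfolding power2_norm_eq_inner inner_diff_left inner_diff_right ip by (simp add: add.commute)
      also have "\<dots> < e\<^sup>2"
      proof -
        have "\<bar>a (M + M) - a (M + N)\<bar> < e\<^sup>2 / 2" "\<bar>a (N + N) - a (M + N)\<bar> < e\<^sup>2 / 2"
          using N0[of "M + M" "M + N"] N0[of "N + N" "M + N"] that by simp_all
        then show ?thesis by linarith
      qed
      finally show ?thesis using e by (simp add: power_less_imp_less_base)
    qed
    then show "\<exists>M. \<forall>m\<ge>M. \<forall>n\<ge>M. norm (C ^ (2 * m) \<cdot> h - C ^ (2 * n) \<cdot> h) < e" by blast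
  qed
  then obtain h0 where h0: "(\<lambda>N. C ^ (2 * N) \<cdot> h) \<longlonglongrightarrow> h0" by (auto simp: Cauchy_convergent_iff convergent_def)
  have "(\<lambda>N. C \<cdot> C \<cdot> C ^ (2 * N) \<cdot> h) \<longlonglongrightarrow> C \<cdot> C \<cdot> h0"
    by (intro app.tendsto tendsto_const h0)
  moreover have "(\<lambda>N. C \<cdot> C \<cdot> C ^ (2 * N) \<cdot> h) = (\<lambda>N. C ^ (2 * Suc N) \<cdot> h)" by simp
  ultimately have "C \<cdot> C \<cdot> h0 = h0"
    using LIMSEQ_Suc[OF h0] LIMSEQ_unique by metis
  with h0 show ?thesis by (rule that)
qed

text \<open>The spectra of \<open>A\<close> and \<open>B\<close> lie in \<open>[0,1]\<close> and 1 is no eigenvalue, so no nonzero operator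
  intertwines \<open>A\<close> with \<open>B + j\<close>.\<close>

lemma intertwining_form_zero:
  fixes A B :: "'a::{real_inner,banach,perfect_space} endo" and b :: "'a \<Rightarrow> 'a \<Rightarrow> real"
  assumes A: "\<And>x y. inner (A \<cdot> x) y = inner x (A \<cdot> y)" "norm (2 *\<^sub>R A - 1) \<le> 1" "\<And>x. A \<cdot> x = x \<Longrightarrow> x = 0"
    and B: "\<And>x y. inner (B \<cdot> x) y = inner x (B \<cdot> y)" "norm (2 *\<^sub>R B - 1) \<le> 1" "\<And>x. B \<cdot> x = x \<Longrightarrow> x = 0"
    and b: "bounded_bilinear b" "\<And>h k. \<bar>b h k\<bar> \<le> norm h * norm k"
    and j: "j \<noteq> 0" and com: "\<And>h k. b (A \<cdot> h) k = b h (B \<cdot> k + of_int j *\<^sub>R k)"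
  shows "b h k = 0"
proof -
  interpret b: bounded_bilinear b by fact
  \<comment> \<open>Rescaling puts the spectra into [-1, 1]. The form then intertwines
    \<open>C\<close> with \<open>Y\<close>, which is \<open>D\<close> shifted by 2 j; as the shift
    has modulus at least 2, \<open>Y\<close> has an inverse of norm at most 1.\<close>
  define C where "C = 2 *\<^sub>R A - 1"
  define D where "D = 2 *\<^sub>R B - 1"
  define Y where "Y = D + (2 * of_int j) *\<^sub>R 1"
  have bY: "b (C \<cdot> h) k = b h (Y \<cdot> k)" for h k
    by (simp add: C_def Y_def D_def b.diff_left b.scaleR_left com b.add_right b.diff_right b.scaleR_right algebra_simps)
  have j1: "1 \<le> \<bar>real_of_int j\<bar>" using j by linarith
  define X where "X = (- 1 / of_int j) *\<^sub>R D"
  have X: "norm X \<le> 1"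
  proof -
    have "norm X = norm D / \<bar>of_int j\<bar>" by (simp add: X_def)
    also have "\<dots> \<le> 1" using B(2) j1 by (simp add: D_def divide_le_eq)
    finally show ?thesis .
  qed
  \<comment> \<open>The inverse of \<open>Y\<close>, which is 2 j times 1 - X / 2: the geometric
    series at 1/2 has norm at most 2.\<close>
  define Z where "Z = (1 / (2 * of_int j)) *\<^sub>R geom_ser X (1/2)"
  have YX: "Y = (2 * of_int j) *\<^sub>R (1 - (1/2) *\<^sub>R X)"
    using j by (simp add: Y_def X_def scaleR_right_diff_distrib scaleR_add_right add.commute)
  have "geom_ser X (1/2) * (1 - (1/2) *\<^sub>R X) = 1" by (rule geom_ser_inverse[OF X]) auto
  moreover have "(1 - (1/2) *\<^sub>R X) * geom_ser X (1/2) = geom_ser X (1/2) * (1 - (1/2) *\<^sub>R X)"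
    by (rule geom_ser_commute[OF X]) (auto simp: algebra_simps)
  ultimately have YZ: "Y * Z = 1" using j by (simp add: YX Z_def)
  have "norm Z = norm (geom_ser X (1/2)) / (2 * \<bar>of_int j\<bar>)" by (simp add: Z_def abs_mult)
  also have "\<dots> \<le> 2 / (2 * \<bar>of_int j\<bar>)"
    using norm_geom_ser[OF X, of "1/2"] by (intro divide_right_mono) auto
  also have "\<dots> \<le> 1" using j1 by (simp add: divide_le_eq)
  finally have Z: "norm Z \<le> 1" .
  have Zpow: "norm (Z ^ N \<cdot> k) \<le> norm k" for N k
    using norm_app[of "Z ^ N" k] norm_power_le_1[OF Z, of N] by (meson mult_left_le_one_le norm_ge_zero order_trans)
  \<comment> \<open>Powers of \<open>C\<close> on the left are balanced by powers of
    \<open>Z\<close> on the right, which stay bounded; so the limit of the even powers of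
    \<open>C\<close> on \<open>h\<close> decides the value of the form.\<close>
  have shift: "b h k = b (C ^ N \<cdot> h) (Z ^ N \<cdot> k)" for N h k
  proof (induction N arbitrary: h k)
    case (Suc N)
    have "b h k = b h (Y \<cdot> Z \<cdot> k)" using arg_cong[OF YZ, of "\<lambda>T. T \<cdot> k"] by simp
    also have "\<dots> = b (C \<cdot> h) (Z \<cdot> k)" by (simp add: bY)
    also have "\<dots> = b (C ^ N \<cdot> C \<cdot> h) (Z ^ N \<cdot> Z \<cdot> k)" by (rule Suc)
    finally show ?case by (simp add: power_Suc2 del: power_Suc)
  qed simp
  have C_sym: "inner (C \<cdot> x) y = inner x (C \<cdot> y)" for x y
    by (simp add: C_def inner_diff_left inner_diff_right A(1))
  obtain h0 where h0: "(\<lambda>N. C ^ (2 * N) \<cdot> h) \<longlonglongrightarrow> h0" "C \<cdot> C \<cdot> h0 = h0"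
    by (rule contraction_powers_converge[OF C_sym, of h]) (use A(2) that in \<open>auto simp: C_def\<close>)
  \<comment> \<open>\<open>C * C - 1\<close> is four times \<open>A * A - A\<close>. So
    \<open>A\<close> fixes \<open>A \<cdot> h0\<close>, and the absence of the eigenvalue 1 makes
    this vector 0.\<close>
  have "A \<cdot> A \<cdot> h0 = A \<cdot> h0"
  proof -
    have "4 *\<^sub>R (A \<cdot> A \<cdot> h0 - A \<cdot> h0) = C \<cdot> C \<cdot> h0 - h0"
      by (simp add: C_def app.diff_right app.scaleR_right scaleR_right_diff_distrib algebra_simps) (simp add: scaleR_2[symmetric] scaleR_add_left[symmetric])
    then show ?thesis using h0(2) by simp
  qed
  then have Ah0: "A \<cdot> h0 = 0" by (rule A(3))
  have bh0: "b h0 k = 0" for k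
  proof -
    have "k \<in> {k. b h0 k = 0}"
    proof (rule closed_subspace_eq_UNIV)
      show "subspace {k. b h0 k = 0}" by (auto simp: subspace_def b.zero_right b.add_right b.scaleR_right)
      show "closed {k. b h0 k = 0}"
        by (intro closed_Collect_eq continuous_on_const linear_continuous_on b.bounded_linear_right)
      \<comment> \<open>Orthogonality to the range of \<open>B\<close> shifted by j makes
        \<open>t\<close> an eigenvector of \<open>B\<close> for -j unless it is 0. As j is not 0, -j
        lies in [0,1] only for j = -1, where it is the excluded eigenvalue 1.\<close>
      fix t assume t: "\<And>y. y \<in> {k. b h0 k = 0} \<Longrightarrow> inner t y = 0"
      have "inner t (B \<cdot> k + of_int j *\<^sub>R k) = 0" for k
        using t com[of h0 k] by (simp add: Ah0 b.zero_left)
      then have "inner (B \<cdot> t + of_int j *\<^sub>R t) k = 0" for k by (simp add: inner_add_left inner_add_right B(1))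
      then have Bt: "B \<cdot> t = (- of_int j) *\<^sub>R t"
        using inner_eq_zero_iff[of "B \<cdot> t + of_int j *\<^sub>R t"] by (simp add: eq_neg_iff_add_eq_0)
      show "t = 0"
      proof (cases "j = -1")
        case True
        then show ?thesis using Bt B(3) by simp
      next
        case False
        have "D \<cdot> t = (- 2 * of_int j - 1) *\<^sub>R t" by (simp add: D_def Bt algebra_simps)
        then have "\<bar>- 2 * real_of_int j - 1\<bar> * norm t \<le> norm D * norm t" using norm_app[of D t] by simp
        also have "\<dots> \<le> 1 * norm t" using B(2) by (intro mult_right_mono) (auto simp: D_def)
        finally have "(\<bar>- 2 * real_of_int j - 1\<bar> - 1) * norm t \<le> 0" by (simp add: algebra_simps)
        moreover have "0 < \<bar>- 2 * real_of_int j - 1\<bar> - 1" using j False by linarith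
        ultimately have "norm t \<le> 0" by (simp add: mult_le_0_iff)
        then show ?thesis by simp
      qed
    qed
    then show ?thesis by simp
  qed
  have "\<bar>b h k\<bar> \<le> norm (C ^ (2 * N) \<cdot> h - h0) * norm k" for N
  proof -
    have "b h k = b (C ^ (2 * N) \<cdot> h - h0) (Z ^ (2 * N) \<cdot> k)"
      using shift[of h k "2 * N"] bh0 by (simp add: b.diff_left)
    then have "\<bar>b h k\<bar> \<le> norm (C ^ (2 * N) \<cdot> h - h0) * norm (Z ^ (2 * N) \<cdot> k)" using b(2) by simp
    also have "\<dots> \<le> norm (C ^ (2 * N) \<cdot> h - h0) * norm k" by (intro mult_left_mono Zpow) simp
    finally show ?thesis .
  qed
  moreover have "(\<lambda>N. norm (C ^ (2 * N) \<cdot> h - h0) * norm k) \<longlonglongrightarrow> norm (h0 - h0) * norm k"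
    by (intro tendsto_intros h0(1))
  ultimately have "\<bar>b h k\<bar> \<le> norm (h0 - h0) * norm k"
    by (intro LIMSEQ_le_const) auto
  then show ?thesis by simp
qed

section \<open>Unitary operators and the two implications of the equivalence\<close>

section \<open>Unitary operators\<close>

lemma cinner_adj:
  assumes "\<And>x y. inner (T \<cdot> x) y = inner x (T' \<cdot> y)" "imag * T' = T' * imag"
  shows "cinner (T \<cdot> x) y = cinner x (T' \<cdot> y)"
  using arg_cong[OF assms(2), of "\<lambda>S. S \<cdot> y"] assms(1) by (simp add: cinner_eq_inner)

lemma unitary_endo:
  assumes W: "unitary W"
  obtains T Ti :: "'a::euclidean_space cube_L2 endo" where "\<And>x. T \<cdot> x = W x" "T * Ti = 1" "Ti * T = 1"
    "\<And>x y. inner (T \<cdot> x) y = inner x (Ti \<cdot> y)" "\<And>x y. inner (Ti \<cdot> x) y = inner x (T \<cdot> y)"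
    "imag * T = T * imag" "imag * Ti = Ti * imag"
proof -
  have add: "W (f + g) = W f + W g" and sc: "W (c *\<^sub>C f) = c *\<^sub>C W f" and ip: "cinner (W f) (W g) = cinner f g"
    and sj: "surj W" for f g c using W by (auto simp: unitary_def)
  have lin: "linear W" by (rule linearI) (simp_all add: add sc scaleR_cube_L2_def)
  have nW: "norm (W f) = norm f" for f by (simp add: norm_eq_sqrt_inner inner_cube_L2_def ip)
  then obtain T where T: "\<And>x. T \<cdot> x = W x" using endo_exists[OF lin, of 1] by auto
  have inj: "inj W"
  proof (rule injI)
    fix x y assume "W x = W y"
    then have "norm (x - y) = 0" using linear_diff[OF lin, of x y] nW[of "x - y"] by simp
    then show "x = y" by simp
  qed
  have WV: "W (inv W y) = y" "inv W (W x) = x" for x y using sj inj by (simp_all add: surj_f_inv_f)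
  have "linear (inv W)"
    by (rule linearI) (rule injD[OF inj], simp add: WV linear_add[OF lin] linear_scale[OF lin])+
  moreover have "norm (inv W y) \<le> 1 * norm y" for y using nW[of "inv W y"] by (simp add: WV)
  ultimately obtain Ti where Ti: "\<And>x. Ti \<cdot> x = inv W x" using endo_exists[of "inv W" 1] by blast
  have adj: "inner (T \<cdot> x) y = inner x (Ti \<cdot> y)" for x y
    unfolding T Ti inner_cube_L2_def using ip[of x "inv W y"] by (simp add: WV)
  show ?thesis
  proof (rule that[OF T _ _ adj])
    show "T * Ti = 1" "Ti * T = 1" by (rule endo_eqI, simp add: T Ti WV)+
    show "inner (Ti \<cdot> x) y = inner x (T \<cdot> y)" for x y using adj[of y x] by (simp add: inner_commute)
    show "imag * T = T * imag" by (rule endo_eqI) (simp add: imag_app T sc)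
    show "imag * Ti = Ti * imag"
      by (rule endo_eqI) (simp add: imag_app Ti, rule injD[OF inj], simp add: WV sc)
  qed
qed

lemma unitary_app:
  assumes "T * Ti = 1" "\<And>x y. inner (T \<cdot> x) y = inner x (Ti \<cdot> y)" "Ti * T = 1" "imag * T = T * imag" "imag * Ti = Ti * imag"
  shows "unitary (app T)"
proof -
  have inv: "T \<cdot> Ti \<cdot> x = x" "Ti \<cdot> T \<cdot> x = x" for x
    using arg_cong[OF assms(1), of "\<lambda>S. S \<cdot> x"] arg_cong[OF assms(3), of "\<lambda>S. S \<cdot> x"] by simp_all
  show ?thesis
    unfolding unitary_def
  proof (intro conjI allI)
    show "T \<cdot> (f + g) = T \<cdot> f + T \<cdot> g" for f g by (rule app.add_right)
    show "T \<cdot> (c *\<^sub>C f) = c *\<^sub>C (T \<cdot> f)" for c f by (rule imag_commute_scaleC) (rule assms(4)[symmetric])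
    show "cinner (T \<cdot> f) (T \<cdot> g) = cinner f g" for f g
      by (simp add: cinner_adj[OF assms(2,5)] inv)
    show "surj (app T)" by (rule surjI[of _ "app Ti"]) (rule inv)
  qed
qed

lemma intertwining_iff:
  assumes "\<And>x. T (S x) = x" "\<And>x. S (T x) = x"
  shows "A O op_graph T = op_graph T O B \<longleftrightarrow> (\<forall>f g. (f, g) \<in> A \<longleftrightarrow> (T f, T g) \<in> B)"
proof -
  have 1: "(f, g) \<in> A O op_graph T \<longleftrightarrow> (f, S g) \<in> A" for f g
    using assms by (auto simp: op_graph_def) 
  have 2: "(f, g) \<in> op_graph T O B \<longleftrightarrow> (T f, g) \<in> B" for f g
    by (auto simp: op_graph_def)
  have "A O op_graph T = op_graph T O B \<longleftrightarrow> (\<forall>f g. (f, S g) \<in> A \<longleftrightarrow> (T f, g) \<in> B)"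
    by (simp only: set_eq_iff split_paired_All 1 2)
  also have "\<dots> \<longleftrightarrow> (\<forall>f g. (f, g) \<in> A \<longleftrightarrow> (T f, T g) \<in> B)"
    by (metis assms)
  finally show ?thesis .
qed

section \<open>Equivalent boundary unitaries give equivalent extensions\<close>

text \<open>In the weak form the adjoint \<open>Ti\<close> moves onto the test tensors, where it
  acts on the second factor only. The boundary values of \<open>a\<close> stay as they are, and the
  trace \<open>c\<close> becomes \<open>B \<cdot> c\<close>.\<close>

lemma P_ext_tensor_lift:
  assumes T: "\<And>x y. inner (T \<cdot> x) y = inner x (Ti \<cdot> y)" "imag * Ti = Ti * imag" "\<And>a k. Ti \<cdot> tens a k = tens a (Bi \<cdot> k)"
    and B: "\<And>x y. inner (B \<cdot> x) y = inner x (Bi \<cdot> y)" "imag * Bi = Bi * imag"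
    and TI: "T * imag = imag * T"
    and com: "\<And>c. B \<cdot> U c = V (B \<cdot> c)" and fg: "(f, g) \<in> P_ext U"
  shows "(T \<cdot> f, T \<cdot> g) \<in> P_ext V"
proof -
  obtain c where c: "\<And>a a' k. C1_pair a a' \<Longrightarrow>
    cinner ((\<i> * (2 * pi)) *\<^sub>C g) (tens (cls a) k) + cinner f (tens (cls a') k) =
    cnj (a 1) * cinner (U c) k - cnj (a 0) * cinner c k"
    using fg unfolding P_ext_iff by blast
  show ?thesis
    unfolding P_ext_iff
  proof (intro exI[of _ "B \<cdot> c"] allI impI)
    fix a a' k assume a: "C1_pair a a'"
    have "(\<i> * (2 * pi)) *\<^sub>C (T \<cdot> g) = T \<cdot> ((\<i> * (2 * pi)) *\<^sub>C g)" by (rule imag_commute_scaleC[OF TI, symmetric])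
    then show "cinner ((\<i> * (2 * pi)) *\<^sub>C (T \<cdot> g)) (tens (cls a) k) + cinner (T \<cdot> f) (tens (cls a') k) =
      cnj (a 1) * cinner (V (B \<cdot> c)) k - cnj (a 0) * cinner (B \<cdot> c) k"
      by (simp only: cinner_adj[OF T(1,2)] T(3) c[OF a] com[symmetric] cinner_adj[OF B])
  qed
qed

lemma unitarily_equivalent_P_extI:
  assumes "unitarily_equivalent (op_graph U) (op_graph V)"
  shows "unitarily_equivalent (P_ext U) (P_ext V)"
proof -
  obtain W where W: "unitary W" and eq: "op_graph U O op_graph W = op_graph W O op_graph V"
    using assms unfolding unitarily_equivalent_def by blast
  have com: "W (U c) = V (W c)" for c
  proof -
    have "(c, W (U c)) \<in> op_graph U O op_graph W" by (auto simp: op_graph_def)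
    then show ?thesis unfolding eq by (auto simp: op_graph_def)
  qed
  obtain B Bi where B: "\<And>x. B \<cdot> x = W x" "B * Bi = 1" "Bi * B = 1"
    "\<And>x y. inner (B \<cdot> x) y = inner x (Bi \<cdot> y)" "\<And>x y. inner (Bi \<cdot> x) y = inner x (B \<cdot> y)"
    "imag * B = B * imag" "imag * Bi = Bi * imag"
    by (rule unitary_endo[OF W]) (rule that, assumption+)
  obtain T where T: "\<And>a k. T \<cdot> tens a k = tens a (B \<cdot> k)" "T * imag = imag * T"
    by (rule tensor_lift_exists[OF B(6)[symmetric]]) (rule that, assumption+)
  obtain Ti where Ti: "\<And>a k. Ti \<cdot> tens a k = tens a (Bi \<cdot> k)" "Ti * imag = imag * Ti"
    by (rule tensor_lift_exists[OF B(7)[symmetric]]) (rule that, assumption+)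
  have BB: "B \<cdot> Bi \<cdot> x = x" "Bi \<cdot> B \<cdot> x = x" for x
    using arg_cong[OF B(2), of "\<lambda>S. S \<cdot> x"] arg_cong[OF B(3), of "\<lambda>S. S \<cdot> x"] by simp_all
  have TT: "T * Ti = 1" "Ti * T = 1" by (rule endo_eq_on_tensors, simp add: T(1) Ti(1) BB)+
  have TTapp: "T \<cdot> Ti \<cdot> x = x" "Ti \<cdot> T \<cdot> x = x" for x
    using arg_cong[OF TT(1), of "\<lambda>S. S \<cdot> x"] arg_cong[OF TT(2), of "\<lambda>S. S \<cdot> x"] by simp_all
  have adj: "inner (T \<cdot> f) g = inner f (Ti \<cdot> g)" for f g
    by (rule tensor_lift_adjoint[OF T(1) Ti(1) B(4) B(6)[symmetric] B(7)[symmetric]])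
  have adj': "inner (Ti \<cdot> f) g = inner f (T \<cdot> g)" for f g using adj[of g f] by (simp add: inner_commute)
  have "unitary (app T)" by (rule unitary_app[OF TT(1) adj TT(2) T(2)[symmetric] Ti(2)[symmetric]])
  moreover have "(f, g) \<in> P_ext U \<longleftrightarrow> (T \<cdot> f, T \<cdot> g) \<in> P_ext V" for f g
  proof
    show "(T \<cdot> f, T \<cdot> g) \<in> P_ext V" if "(f, g) \<in> P_ext U"
      by (rule P_ext_tensor_lift[OF adj Ti(2)[symmetric] Ti(1) B(4) B(7) T(2) _ that]) (simp add: B(1) com)
    assume *: "(T \<cdot> f, T \<cdot> g) \<in> P_ext V"
    have "Bi \<cdot> V c = U (Bi \<cdot> c)" for c
      using com[of "Bi \<cdot> c"] BB(1)[of c] BB(2)[of "U (Bi \<cdot> c)"] by (simp add: B(1))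
    from P_ext_tensor_lift[OF adj' T(2)[symmetric] T(1) B(5) B(6) Ti(2) this *]
    show "(f, g) \<in> P_ext U" by (simp add: TTapp)
  qed
  then have "P_ext U O op_graph (app T) = op_graph (app T) O P_ext V"
    by (subst intertwining_iff[of "app T" "app Ti"]) (simp_all add: TTapp)
  ultimately show ?thesis unfolding unitarily_equivalent_def by blast
qed

section \<open>Diagonalising the boundary condition\<close>

lemma bounded_linear_cinner_left: "bounded_linear (\<lambda>x. cinner x y)"
  by (rule bounded_linear_intro[where K = "norm y"])
    (simp_all add: cinner_add_left scaleR_cube_L2_def cinner_scaleC_left norm_cinner_le scaleR_conv_of_real)

lemma bounded_linear_cinner_right: "bounded_linear (\<lambda>y. cinner x y)"
  by (rule bounded_linear_intro[where K = "norm x"])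
    (simp_all add: cinner_add_right scaleR_cube_L2_def cinner_scaleC_right norm_cinner_le scaleR_conv_of_real mult.commute[of "norm _" "norm x"])

lemma cls_scale: "continuous_on UNIV u \<Longrightarrow> cls (\<lambda>x. c * u x) = c *\<^sub>C cls u"
  by (rule represents_eq[OF represents_cls_continuous represents_scaleC[OF represents_cls_continuous]])
    (auto intro!: continuous_intros)

lemma cls_add: "continuous_on UNIV u \<Longrightarrow> continuous_on UNIV v \<Longrightarrow> cls (\<lambda>x. u x + v x) = cls u + cls v"
  by (rule represents_eq[OF represents_cls_continuous represents_add[OF represents_cls_continuous represents_cls_continuous]])
    (auto intro!: continuous_intros)

text \<open>The scalar form of Green's identity, for use on the x-factor of single terms of the
  exponential series.\<close>

lemma green_interval:
  assumes b: "C1_pair b b'" and a: "C1_pair a a'"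
  shows "cinner (cls b') (cls a) + cinner (cls b) (cls a') = b 1 * cnj (a 1) - b 0 * cnj (a 0)"
proof -
  note r = represents_cls_continuous[OF C1_pair_continuous(1)[OF b]] represents_cls_continuous[OF C1_pair_continuous(2)[OF b]]
    represents_cls_continuous[OF C1_pair_continuous(1)[OF a]] represents_cls_continuous[OF C1_pair_continuous(2)[OF a]]
  note i = r[THEN represents_square_integrable]
  have "C1_pair (\<lambda>x. b x * cnj (a x)) (\<lambda>x. b x * cnj (a' x) + b' x * cnj (a x))"
    using b C1_pair_cnj[OF a] C1_pair_continuous[OF b] C1_pair_continuous[OF a]
    unfolding C1_pair_def by (auto intro!: has_vector_derivative_mult continuous_intros)
  from C1_pair_integral[OF this]
  have "(LINT x|cube. b x * cnj (a' x)) + (LINT x|cube. b' x * cnj (a x)) = b 1 * cnj (a 1) - b 0 * cnj (a 0)"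
    using i by (simp add: square_integrable_mult_cnj)
  then show ?thesis by (simp add: cinner_eq[OF r(2,3)] cinner_eq[OF r(1,4)] add.commute)
qed

text \<open>The x-factor of the j-th term in the expansion of exp (x M) on the n-th mode; the second
  tensor factor is the j-th power of \<open>M\<close> applied to a vector.\<close>

definition expterm :: "int \<Rightarrow> nat \<Rightarrow> real \<Rightarrow> complex"
  where "expterm n j x = of_real (x ^ j / fact j) * fexp n x"

text \<open>The derivative of \<open>expterm n j\<close>. The case j = 0 is separate because
  \<open>j - 1\<close> is then 0 again and would contribute a spurious
  \<open>expterm n 0\<close>.\<close>

definition expterm' :: "int \<Rightarrow> nat \<Rightarrow> real \<Rightarrow> complex"
  where "expterm' n j x = (if j = 0 then 0 else expterm n (j - 1) x) + (\<i> * of_real (2 * pi * of_int n)) * expterm n j x"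

lemma continuous_expterm: "continuous_on S (expterm n j)"
  unfolding expterm_def by (intro continuous_intros continuous_fexp) simp

lemma C1_pair_expterm: "C1_pair (expterm n j) (expterm' n j)"
  unfolding C1_pair_def
proof (intro conjI allI)
  fix x
  have "((\<lambda>x. complex_of_real (x ^ j / fact j)) has_vector_derivative of_real (real j * x ^ (j - 1) / fact j)) (at x)"
  proof (rule bounded_linear.has_vector_derivative[OF bounded_linear_of_real])
    show "((\<lambda>x. x ^ j / fact j) has_vector_derivative real j * x ^ (j - 1) / fact j) (at x)"
      unfolding has_real_derivative_iff_has_vector_derivative[symmetric] by (auto intro!: derivative_eq_intros)
  qed
  from has_vector_derivative_mult[OF this fexp_has_vector_derivative[of n x]]
  have "(expterm n j has_vector_derivative of_real (x ^ j / fact j) * (\<i> * of_real (2 * pi * of_int n) * fexp n x) +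
    of_real (real j * x ^ (j - 1) / fact j) * fexp n x) (at x)"
    by (simp add: expterm_def[abs_def])
  moreover have f: "real j * x ^ (j - 1) / fact j = (if j = 0 then 0 else x ^ (j - 1) / fact (j - 1))"
    by (cases j) simp_all
  ultimately show "(expterm n j has_vector_derivative expterm' n j x) (at x)"
    by (simp only: f expterm'_def expterm_def) (cases "j = 0"; simp add: mult_ac add.commute)
next
  show "continuous_on UNIV (expterm' n j)"
    unfolding expterm'_def[abs_def] by (cases "j = 0") (auto intro!: continuous_intros continuous_expterm)
qed

lemma cls_expterm': "cls (expterm' n 0) = (\<i> * of_real (2 * pi * of_int n)) *\<^sub>C cls (expterm n 0)"
  "cls (expterm' n (Suc j)) = cls (expterm n j) + (\<i> * of_real (2 * pi * of_int n)) *\<^sub>C cls (expterm n (Suc j))"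
proof -
  have "expterm' n 0 = (\<lambda>x. (\<i> * of_real (2 * pi * of_int n)) * expterm n 0 x)"
    by (rule ext) (simp add: expterm'_def)
  then show "cls (expterm' n 0) = (\<i> * of_real (2 * pi * of_int n)) *\<^sub>C cls (expterm n 0)"
    by (simp only: cls_scale[OF continuous_expterm])
  have "expterm' n (Suc j) = (\<lambda>x. expterm n j x + (\<i> * of_real (2 * pi * of_int n)) * expterm n (Suc j) x)"
    by (rule ext) (simp only: expterm'_def nat.distinct if_False diff_Suc_1)
  moreover have "continuous_on UNIV (\<lambda>x. (\<i> * of_real (2 * pi * of_int n)) * expterm n (Suc j) x)"
    by (intro continuous_intros continuous_expterm)
  ultimately show "cls (expterm' n (Suc j)) = cls (expterm n j) + (\<i> * of_real (2 * pi * of_int n)) *\<^sub>C cls (expterm n (Suc j))"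
    by (simp only: cls_add[OF continuous_expterm] cls_scale[OF continuous_expterm])
qed

text \<open>\<open>G\<close> is multiplication by \<open>exp (2\<pi>i x A)\<close>, where \<open>V = exp (2\<pi>i A)\<close>; it turns \<open>P_ext V\<close> into
  \<open>P_ext id\<close> plus \<open>1 \<otimes> A\<close>.\<close>

definition gauge :: "(real cube_L2 \<Rightarrow> real cube_L2) \<Rightarrow> real cube_L2 endo \<Rightarrow>
    (real \<times> real) cube_L2 endo \<Rightarrow> (real \<times> real) cube_L2 endo \<Rightarrow> bool"
  where "gauge V A G Gi \<longleftrightarrow>
    imag * A = A * imag \<and> (\<forall>x y. inner (A \<cdot> x) y = inner x (A \<cdot> y)) \<and>
    norm (2 *\<^sub>R A - 1) \<le> 1 \<and> (\<forall>x. A \<cdot> x = x \<longrightarrow> x = 0) \<and>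
    (\<forall>k. exp ((2 * pi) *\<^sub>R (imag * A)) \<cdot> k = V k) \<and>
    G * Gi = 1 \<and> Gi * G = 1 \<and> (\<forall>f g. inner (G \<cdot> f) g = inner f (Gi \<cdot> g)) \<and> imag * G = G * imag \<and>
    (\<forall>n k. (G \<cdot> tens (fbasis n) k, G \<cdot> tens (fbasis n) (A \<cdot> k + of_int n *\<^sub>R k)) \<in> P_ext V) \<and>
    (\<forall>f g n k. (f, g) \<in> P_ext V \<longrightarrow>
      cinner g (G \<cdot> tens (fbasis n) k) = cinner f (G \<cdot> tens (fbasis n) (A \<cdot> k + of_int n *\<^sub>R k)))"

text \<open>\<open>G\<close> is the exponential of \<open>X * T\<close>, where \<open>X\<close>
  multiplies by x and \<open>T\<close> is 1 \<otimes> M with M = 2 pi i A. On a mode it yields a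
  series of tensors, so Green's identity is applied to each term and summed: at 1 the boundary terms
  add up to exp M = V, and at 0 only the term j = 0 contributes.\<close>

lemma gauge_exists:
  assumes V: "unitary V"
  obtains A G Gi where "gauge V A G Gi"
proof -
  obtain Ve Vi where Ve: "\<And>x. Ve \<cdot> x = V x" "Ve * Vi = 1" "Vi * Ve = 1"
    "\<And>x y. inner (Ve \<cdot> x) y = inner x (Vi \<cdot> y)" "imag * Ve = Ve * imag"
    by (rule unitary_endo[OF V]) (rule that, assumption+)
  obtain A where A: "imag * A = A * imag" "\<And>x y. inner (A \<cdot> x) y = inner x (A \<cdot> y)"
    "norm (2 *\<^sub>R A - 1) \<le> 1" "\<And>x. A \<cdot> x = x \<Longrightarrow> x = 0" "exp ((2 * pi) *\<^sub>R (imag * A)) = Ve"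
    by (rule unitary_log_exists[OF imag_imag imag_skew Ve(2-5)]) (rule that, assumption+)
  define M where "M = (2 * pi) *\<^sub>R (imag * A)"
  have MI: "M * imag = imag * M" by (simp add: M_def mult.assoc A(1)[symmetric])
  have M_app: "M \<cdot> k = (\<i> * (2 * pi)) *\<^sub>C (A \<cdot> k)" for k
    by (simp add: M_def imag_app scaleR_cube_L2_def scaleC_scaleC mult.commute)
  have M_skew: "inner (M \<cdot> x) y = inner x ((- M) \<cdot> y)" for x y
  proof -
    have "inner (imag \<cdot> A \<cdot> x) y = - inner x (A \<cdot> imag \<cdot> y)" by (simp add: imag_skew A(2))
    also have "A \<cdot> imag \<cdot> y = imag \<cdot> A \<cdot> y" using arg_cong[OF A(1), of "\<lambda>S. S \<cdot> y"] by simp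
    finally show ?thesis by (simp add: M_def)
  qed
  obtain T where T: "\<And>a k. T \<cdot> tens a k = tens a (M \<cdot> k)" "T * imag = imag * T"
    by (rule tensor_lift_exists[OF MI]) (rule that, assumption+)
  obtain X :: "(real \<times> real) cube_L2 endo"
    where X: "\<And>F f. represents F f \<Longrightarrow> represents (\<lambda>p. of_real (fst p) * F p) (X \<cdot> f)"
    by (rule mult_x_exists) (rule that)
  have X_tens: "X \<cdot> tens (cls u) k = tens (cls (\<lambda>x. of_real x * u x)) k" if u: "continuous_on UNIV u" for u k
  proof -
    obtain K where K: "represents K k" using representative_exists by metis
    have "continuous_on UNIV (\<lambda>x. of_real x * u x)" by (intro continuous_intros u)
    from represents_eq[OF X[OF represents_tens[OF represents_cls_continuous[OF u] K]]]
      represents_tens[OF represents_cls_continuous[OF this] K]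
    show ?thesis by (simp add: mult.assoc)
  qed
  have X_sym: "inner (X \<cdot> f) g = inner f (X \<cdot> g)" for f g
  proof -
    obtain F G where FG: "represents F f" "represents G g" using representative_exists by metis
    show ?thesis
      unfolding inner_cube_L2_def cinner_eq[OF X[OF FG(1)] FG(2)] cinner_eq[OF FG(1) X[OF FG(2)]]
      by (simp add: mult_ac)
  qed
  have XI: "X * imag = imag * X"
  proof (rule endo_eqI)
    fix f :: "(real \<times> real) cube_L2"
    obtain F where F: "represents F f" using representative_exists by metis
    show "(X * imag) \<cdot> f = (imag * X) \<cdot> f"
      using represents_eq[OF X[OF represents_scaleC[OF F, of \<i>]]] represents_scaleC[OF X[OF F], of \<i>]
      by (simp add: imag_app mult.left_commute)
  qed
  have XT: "X * T = T * X"
    by (rule endo_eq_on_tensors) (simp add: fbasis_def X_tens[OF continuous_fexp] T(1))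
  have T_skew: "inner (T \<cdot> f) g = inner f ((- T) \<cdot> g)" for f g
  proof (rule tensor_lift_adjoint[OF T(1) _ M_skew MI])
    show "- T \<cdot> tens a k = tens a (- M \<cdot> k)" for a k
      by (simp add: T(1) bounded_bilinear.minus_right[OF bounded_bilinear_tens])
    show "- M * imag = imag * - M" by (simp add: MI)
  qed
  define Q where "Q = X * T"
  have Q_adj: "inner (Q \<cdot> f) g = inner f ((- Q) \<cdot> g)" for f g
    using arg_cong[OF XT, of "\<lambda>S. S \<cdot> g"] by (simp add: Q_def X_sym T_skew)
  define G where "G = exp Q"
  define Gi where "Gi = exp (- Q)"
  define E where "E = (\<lambda>n k. G \<cdot> tens (fbasis n) k)"
  define c2 where "c2 = \<i> * complex_of_real (2 * pi)"
  have GI: "imag * G = G * imag"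
  proof -
    have "imag * Q = Q * imag"
      unfolding Q_def mult.assoc T(2) unfolding mult.assoc[symmetric] XI ..
    then show ?thesis unfolding G_def by (rule exp_commute)
  qed
  have Qpow: "Q ^ j \<cdot> tens (cls u) k = tens (cls (\<lambda>x. of_real (x ^ j) * u x)) (M ^ j \<cdot> k)"
    if u: "continuous_on UNIV u" for u j k
  proof (induction j)
    case (Suc j)
    have "continuous_on UNIV (\<lambda>x. of_real (x ^ j) * u x)" by (intro continuous_intros u)
    note c = this
    have "Q ^ Suc j \<cdot> tens (cls u) k = X \<cdot> T \<cdot> Q ^ j \<cdot> tens (cls u) k" by (simp add: Q_def)
    then show ?case by (simp only: Suc T(1) X_tens[OF c]) (simp add: mult.assoc)
  qed simp
  have S1: "(\<lambda>j. tens (cls (expterm n j)) (M ^ j \<cdot> k)) sums E n k" for n k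
  proof -
    have "(\<lambda>j. (Q ^ j /\<^sub>R fact j) \<cdot> tens (fbasis n) k) sums (exp Q \<cdot> tens (fbasis n) k)"
      by (rule bounded_linear.sums[OF app.bounded_linear_left exp_converges])
    moreover have "(Q ^ j /\<^sub>R fact j) \<cdot> tens (fbasis n) k = tens (cls (expterm n j)) (M ^ j \<cdot> k)" for j
    proof -
      have "continuous_on UNIV (\<lambda>x. of_real (x ^ j) * fexp n x)" by (intro continuous_intros continuous_fexp)
      from cls_scale[OF this, of "of_real (inverse (fact j))"]
      have "cls (expterm n j) = inverse (fact j) *\<^sub>R cls (\<lambda>x. of_real (x ^ j) * fexp n x)"
        by (simp add: expterm_def[abs_def] scaleR_cube_L2_def divide_inverse mult_ac)
      then show ?thesis
        by (simp add: fbasis_def Qpow[OF continuous_fexp] bounded_bilinear.scaleR_left[OF bounded_bilinear_tens])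
    qed
    ultimately show ?thesis by (simp only: E_def G_def)
  qed
  have E_scaleC: "c *\<^sub>C E n k = E n (c *\<^sub>C k)" for c n k
    by (simp add: E_def tens_scaleC_right imag_commute_scaleC[OF GI[symmetric]])
  have E_add: "E n (k + l) = E n k + E n l" for n k l by (simp add: E_def tens_add_right app.add_right)
  have S2: "(\<lambda>j. tens (cls (expterm' n j)) (M ^ j \<cdot> k)) sums (c2 *\<^sub>C E n (A \<cdot> k + of_int n *\<^sub>R k))" for n k
  proof -
    define \<nu> where "\<nu> = \<i> * complex_of_real (2 * pi * of_int n)"
    \<comment> \<open>Differentiating the power in the j-th term reproduces the term j - 1, so this
      part of the derivative is the series for \<open>M \<cdot> k\<close> shifted by one place, with
      0 in front.\<close>
    define u where "u = (\<lambda>j. if j = 0 then 0 else tens (cls (expterm n (j - 1))) (M ^ (j - 1) \<cdot> M \<cdot> k))"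
    have "(\<lambda>j. u (Suc j)) sums E n (M \<cdot> k)" unfolding u_def using S1[of n "M \<cdot> k"] by simp
    then have "u sums (E n (M \<cdot> k) + u 0)" by (rule sums_Suc)
    then have u: "u sums E n (M \<cdot> k)" by (simp add: u_def)
    have "bounded_linear (\<lambda>x :: (real \<times> real) cube_L2. \<nu> *\<^sub>C x)"
      by (rule bounded_linear_intro[where K = "cmod \<nu>"])
        (simp_all add: scaleC_add_right scaleR_cube_L2_def scaleC_scaleC norm_scaleC mult.commute)
    from sums_add[OF u bounded_linear.sums[OF this S1]]
    have "(\<lambda>j. u j + \<nu> *\<^sub>C tens (cls (expterm n j)) (M ^ j \<cdot> k)) sums (E n (M \<cdot> k) + \<nu> *\<^sub>C E n k)" .
    moreover have "u j + \<nu> *\<^sub>C tens (cls (expterm n j)) (M ^ j \<cdot> k) = tens (cls (expterm' n j)) (M ^ j \<cdot> k)" for j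
    proof (cases j)
      case 0
      then show ?thesis by (simp only: u_def \<nu>_def cls_expterm'(1) tens_scaleC_left) simp
    next
      case (Suc i)
      have "M ^ i \<cdot> M \<cdot> k = M ^ Suc i \<cdot> k" by (simp add: power_Suc2 del: power_Suc)
      then show ?thesis
        unfolding Suc cls_expterm'(2) \<nu>_def[symmetric] tens_add_left tens_scaleC_left by (simp only: u_def) simp
    qed
    moreover have "E n (M \<cdot> k) + \<nu> *\<^sub>C E n k = c2 *\<^sub>C E n (A \<cdot> k + of_int n *\<^sub>R k)"
      unfolding E_scaleC E_add[symmetric] M_app \<nu>_def c2_def scaleR_cube_L2_def
      by (simp add: scaleC_add_right scaleC_scaleC mult_ac)
    ultimately show ?thesis by simp
  qed
  have e1: "expterm n j 1 = of_real (1 / fact j)" and e0: "expterm n j 0 = (if j = 0 then 1 else 0)" for n j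
    by (simp_all add: expterm_def fexp_0_1)
  have expM: "(\<lambda>j. (M ^ j /\<^sub>R fact j) \<cdot> k) sums V k" for k
    using bounded_linear.sums[OF app.bounded_linear_left exp_converges[of M], of k] by (simp add: M_def A(5) Ve(1))
  have single: "(\<lambda>j. if j = 0 then z else 0) sums z" for z :: complex
    using sums_single[of 0 "\<lambda>_. z"] by simp
  \<comment> \<open>The witness for the trace at 0 is \<open>k\<close> itself: multiplication by exp
    (x M) is the identity at x = 0.\<close>
  have dom: "(E n k, E n (A \<cdot> k + of_int n *\<^sub>R k)) \<in> P_ext V" for n k
    unfolding P_ext_iff
  proof (intro exI[of _ k] allI impI)
    fix a a' l assume a: "C1_pair a a'"
    let ?t = "\<lambda>j. cinner (tens (cls (expterm' n j)) (M ^ j \<cdot> k)) (tens (cls a) l) + cinner (tens (cls (expterm n j)) (M ^ j \<cdot> k)) (tens (cls a') l)"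
    have "?t sums (cinner (c2 *\<^sub>C E n (A \<cdot> k + of_int n *\<^sub>R k)) (tens (cls a) l) + cinner (E n k) (tens (cls a') l))"
      by (intro sums_add bounded_linear.sums[OF bounded_linear_cinner_left] S1 S2)
    moreover have "?t j = cnj (a 1) * cinner ((M ^ j /\<^sub>R fact j) \<cdot> k) l - (if j = 0 then cnj (a 0) * cinner k l else 0)" for j
    proof -
      have "?t j = (cinner (cls (expterm' n j)) (cls a) + cinner (cls (expterm n j)) (cls a')) * cinner (M ^ j \<cdot> k) l"
        by (simp add: cinner_tens_tens distrib_right)
      also have "\<dots> = (of_real (1 / fact j) * cnj (a 1) - (if j = 0 then 1 else 0) * cnj (a 0)) * cinner (M ^ j \<cdot> k) l"
        by (simp only: green_interval[OF C1_pair_expterm a] e1 e0)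
      also have "\<dots> = cnj (a 1) * cinner ((M ^ j /\<^sub>R fact j) \<cdot> k) l - (if j = 0 then cnj (a 0) * cinner k l else 0)"
        by (simp add: scaleR_cube_L2_def cinner_scaleC_left divide_inverse algebra_simps)
      finally show ?thesis .
    qed
    moreover have "(\<lambda>j. cnj (a 1) * cinner ((M ^ j /\<^sub>R fact j) \<cdot> k) l - (if j = 0 then cnj (a 0) * cinner k l else 0)) sums
        (cnj (a 1) * cinner (V k) l - cnj (a 0) * cinner k l)"
      by (intro sums_diff sums_mult bounded_linear.sums[OF bounded_linear_cinner_left expM] single)
    ultimately have "cinner (c2 *\<^sub>C E n (A \<cdot> k + of_int n *\<^sub>R k)) (tens (cls a) l) + cinner (E n k) (tens (cls a') l) =
        cnj (a 1) * cinner (V k) l - cnj (a 0) * cinner k l"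
      by (simp only: sums_unique2)
    then show "cinner ((\<i> * (2 * pi)) *\<^sub>C E n (A \<cdot> k + of_int n *\<^sub>R k)) (tens (cls a) l) + cinner (E n k) (tens (cls a') l) =
        cnj (a 1) * cinner (V k) l - cnj (a 0) * cinner k l"
      by (simp only: c2_def)
  qed
  \<comment> \<open>Here the terms of the series are the multipliers, tested against an arbitrary
    pair of the extension. The boundary terms add up to
    \<open>cinner (V c) (V k) - cinner c k\<close>, which is 0 as \<open>V\<close> is
    unitary.\<close>
  have sym: "cinner g (E n k) = cinner f (E n (A \<cdot> k + of_int n *\<^sub>R k))" if fg: "(f, g) \<in> P_ext V" for f g n k
  proof -
    obtain c where c: "\<And>a a' k. C1_pair a a' \<Longrightarrow> cinner (c2 *\<^sub>C g) (tens (cls a) k) + cinner f (tens (cls a') k) =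
      cnj (a 1) * cinner (V c) k - cnj (a 0) * cinner c k"
      using fg unfolding P_ext_iff c2_def by blast
    let ?t = "\<lambda>j. cinner (c2 *\<^sub>C g) (tens (cls (expterm n j)) (M ^ j \<cdot> k)) + cinner f (tens (cls (expterm' n j)) (M ^ j \<cdot> k))"
    have "?t sums (cinner (c2 *\<^sub>C g) (E n k) + cinner f (c2 *\<^sub>C E n (A \<cdot> k + of_int n *\<^sub>R k)))"
      by (intro sums_add bounded_linear.sums[OF bounded_linear_cinner_right] S1 S2)
    moreover have "?t j = cinner (V c) ((M ^ j /\<^sub>R fact j) \<cdot> k) - (if j = 0 then cinner c k else 0)" for j
      unfolding c[OF C1_pair_expterm] e1 e0
      by (simp add: scaleR_cube_L2_def cinner_scaleC_right divide_inverse)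
    moreover have "(\<lambda>j. cinner (V c) ((M ^ j /\<^sub>R fact j) \<cdot> k) - (if j = 0 then cinner c k else 0)) sums
        (cinner (V c) (V k) - cinner c k)"
      by (intro sums_diff bounded_linear.sums[OF bounded_linear_cinner_right expM] single)
    ultimately have "cinner (c2 *\<^sub>C g) (E n k) + cinner f (c2 *\<^sub>C E n (A \<cdot> k + of_int n *\<^sub>R k)) = cinner (V c) (V k) - cinner c k"
      by (simp only: sums_unique2)
    also have "\<dots> = 0" using V by (simp add: unitary_def)
    finally have "c2 * cinner g (E n k) = c2 * cinner f (E n (A \<cdot> k + of_int n *\<^sub>R k))"
      by (simp add: cinner_scaleC_left cinner_scaleC_right c2_def)
    then show ?thesis by (simp add: c2_def)
  qed
  have expV: "exp ((2 * pi) *\<^sub>R (imag * A)) \<cdot> k = V k" for k by (simp only: A(5) Ve(1))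
  have GG: "G * Gi = 1" "Gi * G = 1"
    using exp_minus_inverse[of Q] exp_minus_inverse[of "- Q"] by (simp_all add: G_def Gi_def)
  have G_adj: "inner (G \<cdot> f) g = inner f (Gi \<cdot> g)" for f g
    unfolding G_def Gi_def by (rule exp_adjoint[OF Q_adj])
  have "gauge V A G Gi"
    unfolding gauge_def
    by (intro conjI allI impI)
      (rule A(1-4) expV GG G_adj GI dom[unfolded E_def] sym[unfolded E_def] | assumption)+
  then show ?thesis by (rule that)
qed

lemma gaugeD:
  assumes "gauge V A G Gi"
  shows "imag * A = A * imag" "inner (A \<cdot> x) y = inner x (A \<cdot> y)"
    "norm (2 *\<^sub>R A - 1) \<le> 1" "A \<cdot> x = x \<Longrightarrow> x = 0"
    "exp ((2 * pi) *\<^sub>R (imag * A)) \<cdot> x = V x"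
    "G * Gi = 1" "Gi * G = 1" "inner (G \<cdot> f) g = inner f (Gi \<cdot> g)" "imag * G = G * imag"
    "(G \<cdot> tens (fbasis n) x, G \<cdot> tens (fbasis n) (A \<cdot> x + of_int n *\<^sub>R x)) \<in> P_ext V"
    "(f, g) \<in> P_ext V \<Longrightarrow>
      cinner g (G \<cdot> tens (fbasis n) x) = cinner f (G \<cdot> tens (fbasis n) (A \<cdot> x + of_int n *\<^sub>R x))"
  using assms unfolding gauge_def by iprover+

lemma unitary_gauge:
  assumes g: "gauge V A G Gi"
  shows "unitary (app G)"
proof (rule unitary_app)
  note G = gaugeD(6-9)[OF g]
  show "imag * Gi = Gi * imag"
  proof -
    have "imag * Gi = Gi * (G * imag) * Gi" by (simp add: mult.assoc[symmetric] G(2))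
    also have "\<dots> = Gi * imag" by (simp only: G(4)[symmetric]) (simp add: mult.assoc G(1))
    finally show ?thesis .
  qed
qed (rule gaugeD[OF g])+

section \<open>Equivalent extensions have equivalent boundary unitaries\<close>

text \<open>The pairing of the transported zeroth mode with the m-th mode on the other side
  intertwines \<open>A\<close> with \<open>B\<close> shifted by m, hence vanishes for m \<noteq> 0.
  \<open>W\<close> is assumed isometric and to map one extension into the other, so the lemma
  applies to an intertwiner and, with the roles exchanged, to its inverse.\<close>

lemma intertwiner_zero_mode:
  assumes g: "gauge U A G Gi" and g': "gauge V B G' Gi'"
    and W: "\<And>x. norm (W \<cdot> x) = norm x" "\<And>f g. (f, g) \<in> P_ext U \<Longrightarrow> (W \<cdot> f, W \<cdot> g) \<in> P_ext V"
  obtains w where "W \<cdot> G \<cdot> tens (fbasis 0) h = G' \<cdot> tens (fbasis 0) w"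
proof -
  have isoG: "norm (G \<cdot> f) = norm f" and isoG': "norm (G' \<cdot> f) = norm f" for f
    using unitary_gauge[OF g] unitary_gauge[OF g'] by (simp_all add: unitary_def norm_eq_sqrt_inner inner_cube_L2_def)
  have zero: "inner (W \<cdot> G \<cdot> tens (fbasis 0) h) (G' \<cdot> tens (fbasis m) k) = 0" if "m \<noteq> 0" for m k
  proof (rule intertwining_form_zero[where b = "\<lambda>h k. inner (W \<cdot> G \<cdot> tens (fbasis 0) h) (G' \<cdot> tens (fbasis m) k)"])
    note L = bounded_linear_compose[OF app.bounded_linear_right bounded_bilinear.bounded_linear_right[OF bounded_bilinear_tens]]
    show "bounded_bilinear (\<lambda>h k. inner (W \<cdot> G \<cdot> tens (fbasis 0) h) (G' \<cdot> tens (fbasis m) k))"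
      by (rule bounded_bilinear.comp[OF bounded_bilinear_inner bounded_linear_compose[OF app.bounded_linear_right L] L])
    show "\<bar>inner (W \<cdot> G \<cdot> tens (fbasis 0) h) (G' \<cdot> tens (fbasis m) k)\<bar> \<le> norm h * norm k" for h k
      using Cauchy_Schwarz_ineq2[of "W \<cdot> G \<cdot> tens (fbasis 0) h" "G' \<cdot> tens (fbasis m) k"]
      by (simp add: W(1) isoG isoG' norm_tens norm_fbasis)
    show "inner (W \<cdot> G \<cdot> tens (fbasis 0) (A \<cdot> h)) (G' \<cdot> tens (fbasis m) k) =
        inner (W \<cdot> G \<cdot> tens (fbasis 0) h) (G' \<cdot> tens (fbasis m) (B \<cdot> k + of_int m *\<^sub>R k))" for h k
      using gaugeD(11)[OF g' W(2)[OF gaugeD(10)[OF g, of 0 h]], of m k] by (simp add: inner_cube_L2_def)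
  qed (rule gaugeD[OF g] gaugeD[OF g'] that | assumption)+
  define s where "s = Gi' \<cdot> W \<cdot> G \<cdot> tens (fbasis 0) h"
  have s: "inner s y = inner (W \<cdot> G \<cdot> tens (fbasis 0) h) (G' \<cdot> y)" for y
    using gaugeD(8)[OF g', of y "W \<cdot> G \<cdot> tens (fbasis 0) h"] by (simp add: s_def inner_commute)
  \<comment> \<open>The zeroth Fourier coefficient of \<open>s\<close> in x; the other coefficients
    are 0 by \<open>zero\<close>.\<close>
  obtain w where w: "\<And>k. cinner s (tens (fbasis 0) k) = cinner w k" by (rule tens_adjoint_right) (rule that, assumption+)
  have "s - tens (fbasis 0) w = 0"
  proof (rule tensor_total_inner)
    fix n k
    show "inner (s - tens (fbasis 0) w) (tens (fbasis n) k) = 0"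
    proof (cases "n = 0")
      case True
      then show ?thesis
        unfolding inner_diff_left by (simp add: inner_cube_L2_def w cinner_tens_tens cinner_fbasis)
    next
      case False
      then show ?thesis
        unfolding inner_diff_left s zero[OF False] by (simp add: inner_cube_L2_def cinner_tens_tens cinner_fbasis)
    qed
  qed
  then have "G' \<cdot> tens (fbasis 0) w = G' \<cdot> s" by simp
  also have "\<dots> = W \<cdot> G \<cdot> tens (fbasis 0) h"
    using arg_cong[OF gaugeD(6)[OF g'], of "\<lambda>S. S \<cdot> W \<cdot> G \<cdot> tens (fbasis 0) h"] by (simp add: s_def)
  finally show ?thesis by (intro that) (rule sym)
qed

text \<open>\<open>D\<close> is the block of the intertwiner between the two zeroth modes, and the
  block of the inverse shows that it is onto. The gauge relations for n = 0 on both sides give D A =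
  B D, and the exponential series turns this into D U = V D.\<close>

lemma unitarily_equivalent_P_extD:
  assumes U: "unitary U" and V: "unitary V" and eq: "unitarily_equivalent (P_ext U) (P_ext V)"
  shows "unitarily_equivalent (op_graph U) (op_graph V)"
proof -
  obtain W where W: "unitary W" and WP: "P_ext U O op_graph W = op_graph W O P_ext V"
    using eq unfolding unitarily_equivalent_def by blast
  obtain T Ti where T: "\<And>x. T \<cdot> x = W x" "T * Ti = 1" "Ti * T = 1"
    "\<And>x y. inner (T \<cdot> x) y = inner x (Ti \<cdot> y)" "\<And>x y. inner (Ti \<cdot> x) y = inner x (T \<cdot> y)"
    "imag * T = T * imag" "imag * Ti = Ti * imag"
    by (rule unitary_endo[OF W]) (rule that, assumption+)
  have TT: "T \<cdot> Ti \<cdot> x = x" "Ti \<cdot> T \<cdot> x = x" for x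
    using arg_cong[OF T(2), of "\<lambda>S. S \<cdot> x"] arg_cong[OF T(3), of "\<lambda>S. S \<cdot> x"] by simp_all
  have nT: "norm (T \<cdot> x) = norm x" "norm (Ti \<cdot> x) = norm x" for x
    by (simp_all add: norm_eq_sqrt_inner T(4,5) TT)
  have "app T = W" by (rule ext) (rule T(1))
  then have "P_ext U O op_graph (app T) = op_graph (app T) O P_ext V" using WP by simp
  then have iff: "(f, g) \<in> P_ext U \<longleftrightarrow> (T \<cdot> f, T \<cdot> g) \<in> P_ext V" for f g
    by (subst (asm) intertwining_iff[of "app T" "app Ti"]) (simp_all add: TT)
  obtain A G Gi where g: "gauge U A G Gi" by (rule gauge_exists[OF U]) (rule that)
  obtain B G' Gi' where g': "gauge V B G' Gi'" by (rule gauge_exists[OF V]) (rule that)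
  have "\<exists>w. T \<cdot> G \<cdot> tens (fbasis 0) h = G' \<cdot> tens (fbasis 0) w" for h
    by (rule intertwiner_zero_mode[OF g g' nT(1), of h]) (use iff in blast)+
  then obtain D where D: "\<And>h. T \<cdot> G \<cdot> tens (fbasis 0) h = G' \<cdot> tens (fbasis 0) (D h)" by metis
  have "\<exists>w. Ti \<cdot> G' \<cdot> tens (fbasis 0) h = G \<cdot> tens (fbasis 0) w" for h
  proof (rule intertwiner_zero_mode[OF g' g nT(2), of h])
    show "(Ti \<cdot> f, Ti \<cdot> g) \<in> P_ext U" if "(f, g) \<in> P_ext V" for f g
      using that iff[of "Ti \<cdot> f" "Ti \<cdot> g"] by (simp add: TT)
  qed blast
  then obtain D' where D': "\<And>h. Ti \<cdot> G' \<cdot> tens (fbasis 0) h = G \<cdot> tens (fbasis 0) (D' h)" by metis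
  have cG: "cinner (G \<cdot> f) (G \<cdot> k) = cinner f k" and cG': "cinner (G' \<cdot> f) (G' \<cdot> k) = cinner f k"
    and cT: "cinner (T \<cdot> f) (T \<cdot> k) = cinner f k" for f k
    using unitary_gauge[OF g] unitary_gauge[OF g'] W by (simp_all add: unitary_def T(1))
  have c': "cinner (G' \<cdot> tens (fbasis 0) x) (G' \<cdot> tens (fbasis 0) y) = cinner x y" for x y
    by (simp add: cG' cinner_tens_tens cinner_fbasis)
  have inj: "x = y" if "G' \<cdot> tens (fbasis 0) x = G' \<cdot> tens (fbasis 0) y" for x y
    by (rule cinner_ext) (metis that c')
  have D_add: "D (x + y) = D x + D y" for x y
    by (rule inj) (simp add: D[symmetric] tens_add_right app.add_right)
  have D_scaleC: "D (c *\<^sub>C x) = c *\<^sub>C D x" for c x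
    by (rule inj) (simp add: D[symmetric] tens_scaleC_right imag_commute_scaleC[OF T(6)[symmetric]]
      imag_commute_scaleC[OF gaugeD(9)[OF g, symmetric]] imag_commute_scaleC[OF gaugeD(9)[OF g', symmetric]])
  have D_cinner: "cinner (D x) (D y) = cinner x y" for x y
  proof -
    have "cinner (D x) (D y) = cinner (T \<cdot> G \<cdot> tens (fbasis 0) x) (T \<cdot> G \<cdot> tens (fbasis 0) y)"
      by (simp only: D c')
    then show ?thesis by (simp add: cT cG cinner_tens_tens cinner_fbasis)
  qed
  have DD': "D (D' w) = w" for w
    by (rule inj) (simp add: D[symmetric] D'[symmetric] TT)
  have "surj D" by (rule surjI) (rule DD')
  then have "unitary D" unfolding unitary_def using D_add D_scaleC D_cinner by blast
  have D_scaleR: "D (r *\<^sub>R x) = r *\<^sub>R D x" for r x by (simp add: scaleR_cube_L2_def D_scaleC)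
  have D_norm: "norm (D x) = norm x" for x by (simp add: norm_eq_sqrt_inner inner_cube_L2_def D_cinner)
  have bl: "bounded_linear D"
    by (rule bounded_linear_intro[where K = 1]) (simp_all add: D_add D_scaleR D_norm)
  have DA: "D (A \<cdot> h) = B \<cdot> D h" for h
  proof (rule cinner_ext)
    fix k
    have "cinner (D (A \<cdot> h)) k = cinner (T \<cdot> G \<cdot> tens (fbasis 0) (A \<cdot> h)) (G' \<cdot> tens (fbasis 0) k)"
      by (simp only: D c')
    also have "\<dots> = cinner (T \<cdot> G \<cdot> tens (fbasis 0) h) (G' \<cdot> tens (fbasis 0) (B \<cdot> k))"
      using gaugeD(11)[OF g' iff[THEN iffD1, OF gaugeD(10)[OF g, of 0 h]], of 0 k] by simp
    also have "\<dots> = cinner (D h) (B \<cdot> k)" by (simp only: D c')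
    also have "\<dots> = cinner (B \<cdot> D h) k" by (rule cinner_adj[OF gaugeD(2,1)[OF g'], symmetric])
    finally show "cinner (D (A \<cdot> h)) k = cinner (B \<cdot> D h) k" .
  qed
  define M where "M = (2 * pi) *\<^sub>R (imag * A)"
  define N where "N = (2 * pi) *\<^sub>R (imag * B)"
  have DM: "D (M \<cdot> h) = N \<cdot> D h" for h
    by (simp add: M_def N_def D_scaleR imag_app D_scaleC DA)
  have DMj: "D (M ^ j \<cdot> h) = N ^ j \<cdot> D h" for j h
    by (induction j) (simp_all add: DM)
  have DU: "D (U h) = V (D h)" for h
  proof (rule sums_unique2)
    have s: "(\<lambda>j. (R ^ j /\<^sub>R fact j) \<cdot> x) sums (exp R \<cdot> x)" for R x
      by (rule bounded_linear.sums[OF app.bounded_linear_left exp_converges])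
    have "(\<lambda>j. D ((M ^ j /\<^sub>R fact j) \<cdot> h)) sums D (exp M \<cdot> h)"
      by (rule bounded_linear.sums[OF bl s])
    then show "(\<lambda>j. (N ^ j /\<^sub>R fact j) \<cdot> D h) sums D (U h)"
      by (simp add: D_scaleR DMj) (simp add: M_def gaugeD(5)[OF g])
    show "(\<lambda>j. (N ^ j /\<^sub>R fact j) \<cdot> D h) sums V (D h)"
      using s[of N "D h"] by (simp only: N_def gaugeD(5)[OF g'])
  qed
  have "op_graph U O op_graph D = op_graph D O op_graph V" by (auto simp: op_graph_def DU)
  with \<open>unitary D\<close> show ?thesis unfolding unitarily_equivalent_def by blast
qed

theorem theorem1p1:
  fixes U V :: "real cube_L2 \<Rightarrow> real cube_L2"
  assumes "unitary U" and "unitary V"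
  shows "unitarily_equivalent (P_ext U) (P_ext V) \<longleftrightarrow>
    unitarily_equivalent (op_graph U) (op_graph V)"
  using unitarily_equivalent_P_extD[OF assms] unitarily_equivalent_P_extI by blast

end
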